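(* Assume that: (P1) there exist $\lambda_0>0$ and a quasi-stationary distribution $\alpha$, a probability measure on $E$, with $\alpha P_t=e^{-\lambda_0t}\alpha$ for all $t\ge0$, and a function $\eta$, positive on $E$, such that $\alpha(\eta)=1$ and $P_t\eta(x)=e^{-\lambda_0t}\eta(x)$ for all $x\in E$, $t\ge0$; (P2) there exists $C_P\in(0,+\infty)$ such that $$\mathrm{Var}_{\eta\circ\alpha}(f)\le-C_P\Big[\int_Ef\,\big(\lambda_0f\eta+\mathcal{L}(f\eta)\big)\,d\alpha\Big]$$ for any measurable function $f$ such that $\lambda_0\int_Ef^2\,d(\eta\circ\alpha)+\int_Ef\,\mathcal{L}(f\eta)\,d\alpha$ is well-defined; (P3) there exists a function $\psi:E\to[1,+\infty)$ such that $\alpha(\psi)<+\infty$ and $\alpha(\psi^2/\eta)<+\infty$. Then, for any probability measure $\mu$ on $E$, there exists $t_\mu$ such that, for any $t\ge t_\mu$, $$\sup_{|f|\le\psi}\big|\mathbb{E}_\mu[f(X_t)\mid\tau_\partial>t]-\alpha(f)\big|\le C_\psi\,\chi_2(\eta\circ\mu\mid\eta\circ\alpha)\,e^{-t/C_P},$$ where $C_\psi=(a+b\,\alpha(\psi))\,\alpha(\psi^2/\eta)^{1/2}$ with some positive constants $a,b$.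
   Context: $(X_t)_{t\ge0}$ is a time-homogeneous Markov process on a metric space $(E\cup\{\partial\},d)$, $\partial\notin E$, absorbed at $\partial$: $X_t=\partial$ for all $t\ge\tau_\partial:=\inf\{t\ge0:X_t=\partial\}$. $\mathbb{P}_\mu,\mathbb{E}_\mu$ correspond to initial law $\mu$ and $\mathbb{P}_x=\mathbb{P}_{\delta_x}$. Standing assumptions: $\mathbb{P}_x[\tau_\partial<+\infty]=1$ and $\mathbb{P}_x[\tau_\partial>t]>0$ for all $x\in E$, $t\ge0$. $P_tf(x):=\mathbb{E}_x(f(X_t)\mathbf{1}_{\tau_\partial>t})$ and $\alpha P_t:=\mathbb{P}_\alpha(X_t\in\cdot,\tau_\partial>t)$. $\alpha$ is a quasi-stationary distribution if $\mathbb{P}_\alpha(X_t\in\cdot\mid\tau_\partial>t)=\alpha$ for all $t\ge0$. The generator is $\mathcal{L}f(x):=\lim_{t\to0}\frac{P_tf(x)-f(x)}{t}$, defined for $f$ in $\mathcal{D}(\mathcal{L})$, the set of $f$ for which the limit exists for every $x$. $\mu(f):=\int f\,d\mu$; $\mathrm{Var}_\pi(f):=\int(f-\pi(f))^2d\pi$. For a positive measure $\mu$ and measurable $f>0$ with $\mu(f)<+\infty$, $f\circ\mu(dx):=f(x)\mu(dx)/\mu(f)$. $\chi_2(\mu\mid\nu):=\sqrt{\int(\frac{d\mu}{d\nu}-1)^2d\nu}$ if $\mu\ll\nu$ and $+\infty$ otherwise. The supremum is over measurable $f$ with $|f|\le\psi$. Convention: the bound is regarded as trivially true when its right-hand side is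 $+\infty$, and $\chi_2(\eta\circ\mu\mid\cdot)$ is read as $+\infty$ if $\mu(\eta)=+\infty$.
   Formalization: The process is additionally assumed to satisfy X_t → x in P_x-probability as t → 0+ for every x in E (weaker than right-continuous paths); without any regularity the claim fails, e.g. X_0+φ(t) on a circle with wild additive φ, killed at an exponential time. *)

theory Defs
  imports "HOL-Probability.Probability"
begin

text \<open>
  The type \<open>'e\<close> plays the role of the metric space \<open>E \<union> {\<partial>}\<close>; the cemetery \<open>\<partial>\<close> is the point \<open>c\<close>
  and \<open>E = - {c}\<close>. Measures on \<open>E\<close> are measures on \<open>state_space c\<close>. Functions on \<open>E\<close> are total
  functions on \<open>'e\<close>; no notion below depends on their value at \<open>c\<close>.
\<close>

definition state_space :: "'e::metric_space \<Rightarrow> 'e measure" where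
  "state_space c = restrict_space borel (- {c})"

text \<open>The infimum of the empty set is \<open>\<infinity>\<close>.\<close>

definition absorption_time :: "(real \<Rightarrow> 'w \<Rightarrow> 'e) \<Rightarrow> 'e \<Rightarrow> 'w \<Rightarrow> ereal" where
  "absorption_time X c \<omega> = Inf (ereal ` {t. 0 \<le> t \<and> X t \<omega> = c})"

definition alive :: "'w measure \<Rightarrow> (real \<Rightarrow> 'w \<Rightarrow> 'e) \<Rightarrow> 'e \<Rightarrow> real \<Rightarrow> 'w set" where
  "alive N X c t = {\<omega> \<in> space N. ereal t < absorption_time X c \<omega>}"

definition natural_filtration ::
  "'w measure \<Rightarrow> (real \<Rightarrow> 'w \<Rightarrow> 'e::topological_space) \<Rightarrow> real \<Rightarrow> 'w measure" where
  "natural_filtration M X s =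
     sigma (space M) {X u -` A \<inter> space M | u A. 0 \<le> u \<and> u \<le> s \<and> A \<in> sets borel}"

text \<open>
  \<open>M\<close> only supplies the measurable space of events; \<open>P x\<close> is the law of the process started at \<open>x\<close>,
  and the law with initial distribution \<open>\<mu>\<close> is the mixture \<open>\<mu> \<bind> P\<close>. Times are the reals \<open>t \<ge> 0\<close>.

  \<open>stochastically_continuous\<close> is the only regularity imposed on the process. It is weaker than
  right-continuity of the paths. Some such convention is needed for the generator to carry any
  information: if \<open>X\<^sub>t = X\<^sub>0 + \<phi>(t)\<close> on the circle with a suitable discontinuous additive \<open>\<phi>\<close>, killed
  at an independent exponential time, the pointwise generator is defined on constants only.
\<close>

locale absorbed_markov_process =
  fixes M :: "'w measure" and P :: "'e::metric_space \<Rightarrow> 'w measure"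
    and X :: "real \<Rightarrow> 'w \<Rightarrow> 'e" and c :: 'e
  assumes kernel: "P \<in> borel \<rightarrow>\<^sub>M prob_algebra M"
    and state_measurable: "\<And>t. 0 \<le> t \<Longrightarrow> X t \<in> M \<rightarrow>\<^sub>M borel"
    and start: "\<And>x. AE \<omega> in P x. X 0 \<omega> = x"
    and markov: "\<And>x s t A. 0 \<le> s \<Longrightarrow> 0 \<le> t \<Longrightarrow> A \<in> sets borel \<Longrightarrow>
      AE \<omega> in P x. real_cond_exp (P x) (natural_filtration M X s)
          (indicator {\<omega>' \<in> space M. X (s + t) \<omega>' \<in> A}) \<omega>
        = measure (P (X s \<omega>)) {\<omega>' \<in> space M. X t \<omega>' \<in> A}"
    and absorbed: "\<And>\<omega> t. \<omega> \<in> space M \<Longrightarrow> 0 \<le> t \<Longrightarrow> absorption_time X c \<omega> \<le> ereal t \<Longrightarrow> X t \<omega> = c"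
    and stochastically_continuous: "\<And>x \<epsilon>. x \<noteq> c \<Longrightarrow> 0 < \<epsilon> \<Longrightarrow>
      ((\<lambda>t. measure (P x) {\<omega> \<in> space M. \<epsilon> \<le> dist (X t \<omega>) x}) \<longlongrightarrow> 0) (at_right 0)"
    and almost_surely_absorbed: "\<And>x. x \<noteq> c \<Longrightarrow> AE \<omega> in P x. absorption_time X c \<omega> < \<infinity>"
    and survival: "\<And>x t. x \<noteq> c \<Longrightarrow> 0 \<le> t \<Longrightarrow> 0 < measure (P x) (alive (P x) X c t)"

definition semigroup_integrand ::
  "(real \<Rightarrow> 'w \<Rightarrow> 'e) \<Rightarrow> 'e \<Rightarrow> real \<Rightarrow> ('e \<Rightarrow> real) \<Rightarrow> 'w \<Rightarrow> real" where
  "semigroup_integrand X c t f \<omega> = f (X t \<omega>) * indicator {\<omega>. ereal t < absorption_time X c \<omega>} \<omega>"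

definition killed_semigroup ::
  "('e \<Rightarrow> 'w measure) \<Rightarrow> (real \<Rightarrow> 'w \<Rightarrow> 'e) \<Rightarrow> 'e \<Rightarrow> real \<Rightarrow> ('e \<Rightarrow> real) \<Rightarrow> 'e \<Rightarrow> real" where
  "killed_semigroup P X c t f x = (\<integral>\<omega>. semigroup_integrand X c t f \<omega> \<partial>P x)"

text \<open>The measure \<open>\<mu>P\<^sub>t\<close>.\<close>

definition killed_law ::
  "('e::metric_space \<Rightarrow> 'w measure) \<Rightarrow> (real \<Rightarrow> 'w \<Rightarrow> 'e) \<Rightarrow> 'e \<Rightarrow> 'e measure \<Rightarrow> real \<Rightarrow> 'e measure" where
  "killed_law P X c \<mu> t =
     distr (restrict_space (\<mu> \<bind> P) (alive (\<mu> \<bind> P) X c t)) (state_space c) (X t)"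

definition quasi_stationary ::
  "('e::metric_space \<Rightarrow> 'w measure) \<Rightarrow> (real \<Rightarrow> 'w \<Rightarrow> 'e) \<Rightarrow> 'e \<Rightarrow> 'e measure \<Rightarrow> bool" where
  "quasi_stationary P X c \<alpha> \<longleftrightarrow> \<alpha> \<in> space (prob_algebra (state_space c)) \<and>
     (\<forall>t\<ge>0. \<forall>A\<in>sets (state_space c).
        \<P>(\<omega> in \<alpha> \<bind> P. X t \<omega> \<in> A \<bar> ereal t < absorption_time X c \<omega>) = measure \<alpha> A)"

text \<open>
  Integrability is part of the domain because the Bochner integral of a non-integrable function is \<open>0\<close>.
\<close>

definition generator_domain ::
  "('e::metric_space \<Rightarrow> 'w measure) \<Rightarrow> (real \<Rightarrow> 'w \<Rightarrow> 'e) \<Rightarrow> 'e \<Rightarrow> ('e \<Rightarrow> real) set" where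
  "generator_domain P X c = {f \<in> borel_measurable (state_space c). \<forall>x. x \<noteq> c \<longrightarrow>
     (\<forall>\<^sub>F t in at_right 0. integrable (P x) (semigroup_integrand X c t f)) \<and>
     (\<exists>l. ((\<lambda>t. (killed_semigroup P X c t f x - f x) / t) \<longlongrightarrow> l) (at_right 0))}"

definition generator ::
  "('e \<Rightarrow> 'w measure) \<Rightarrow> (real \<Rightarrow> 'w \<Rightarrow> 'e) \<Rightarrow> 'e \<Rightarrow> ('e \<Rightarrow> real) \<Rightarrow> 'e \<Rightarrow> real" where
  "generator P X c f x = Lim (at_right 0) (\<lambda>t. (killed_semigroup P X c t f x - f x) / t)"

text \<open>The normalised measure \<open>f \<circ> \<mu>\<close>; meaningful only if \<open>f\<close> is positive and \<open>\<mu>\<close>-integrable.\<close>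

definition reweight :: "('e \<Rightarrow> real) \<Rightarrow> 'e measure \<Rightarrow> 'e measure" where
  "reweight f \<mu> = density \<mu> (\<lambda>x. ennreal (f x / (\<integral>y. f y \<partial>\<mu>)))"

definition var :: "'e measure \<Rightarrow> ('e \<Rightarrow> real) \<Rightarrow> real" where
  "var \<pi> f = (\<integral>x. (f x - (\<integral>y. f y \<partial>\<pi>))\<^sup>2 \<partial>\<pi>)"

text \<open>
  \<open>chi2 \<mu> \<nu>\<close> is intended for finite measures on the same measurable space, where the Radon-Nikodym
  derivative \<open>RN_deriv \<nu> \<mu>\<close> (of \<open>\<mu>\<close> with respect to \<open>\<nu>\<close>) is finite almost everywhere.
\<close>

definition chi2 :: "'e measure \<Rightarrow> 'e measure \<Rightarrow> ennreal" where
  "chi2 \<mu> \<nu> =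
     (if absolutely_continuous \<nu> \<mu> \<and> integrable \<nu> (\<lambda>x. (enn2real (RN_deriv \<nu> \<mu> x) - 1)\<^sup>2)
      then ennreal (sqrt (\<integral>x. (enn2real (RN_deriv \<nu> \<mu> x) - 1)\<^sup>2 \<partial>\<nu>)) else \<infinity>)"

definition conditional_law ::
  "('e \<Rightarrow> 'w measure) \<Rightarrow> (real \<Rightarrow> 'w \<Rightarrow> 'e) \<Rightarrow> 'e \<Rightarrow> 'e measure \<Rightarrow> real \<Rightarrow> 'w measure" where
  "conditional_law P X c \<mu> t = uniform_measure (\<mu> \<bind> P) (alive (\<mu> \<bind> P) X c t)"

text \<open>
  A test function whose conditional expectation is undefined counts as infinitely far from \<open>\<alpha>\<close>, so a
  finite bound on the supremum includes the existence of all these expectations.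
\<close>

definition conditional_distance ::
  "('e::metric_space \<Rightarrow> 'w measure) \<Rightarrow> (real \<Rightarrow> 'w \<Rightarrow> 'e) \<Rightarrow> 'e \<Rightarrow> ('e \<Rightarrow> real) \<Rightarrow>
   'e measure \<Rightarrow> 'e measure \<Rightarrow> real \<Rightarrow> ennreal" where
  "conditional_distance P X c \<psi> \<alpha> \<mu> t =
     (SUP f\<in>{f \<in> borel_measurable (state_space c). \<forall>x. x \<noteq> c \<longrightarrow> \<bar>f x\<bar> \<le> \<psi> x}.
        if integrable (conditional_law P X c \<mu> t) (\<lambda>\<omega>. f (X t \<omega>))
        then ennreal \<bar>(\<integral>\<omega>. f (X t \<omega>) \<partial>conditional_law P X c \<mu> t) - (\<integral>x. f x \<partial>\<alpha>)\<bar>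
        else \<infinity>)"

end

theory Submission
  imports Defs
begin

text \<open>
  The Doob transform \<open>Q\<^sub>t f = e\<^bsup>\<lambda>\<^sub>0t\<^esup> P\<^sub>t(f\<eta>) / \<eta>\<close> is a Markov semigroup with invariant probability
  \<open>\<beta> = \<eta> \<circ> \<alpha>\<close>, and the hypothesis on \<open>Var\<close> is its Poincare inequality. To obtain exponential decay of
  the variance from an inequality for the pointwise generator, take \<open>g\<close> bounded continuous and the time
  averages \<open>A\<^sub>t = \<integral>\<^bsub>t\<^esub>\<^bsup>t+h\<^esup> Q\<^sub>s g ds = Q\<^sub>t A\<^sub>0\<close>: stochastic continuity makes \<open>s \<mapsto> Q\<^sub>s g(x)\<close> right-continuous,
  so \<open>A\<^sub>t\<close> lies in the domain with generator \<open>Q\<^bsub>t+h\<^esub> g - Q\<^sub>t g\<close>, and the right derivative of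
  \<open>Var\<^sub>\<beta>(A\<^sub>t)\<close> is at most \<open>-(2/C\<^sub>P) Var\<^sub>\<beta>(A\<^sub>t)\<close>. Let \<open>h \<rightarrow> 0\<close> and use density of the bounded continuous
  functions in \<open>L\<^sup>2(\<beta>)\<close>.

  If \<open>\<eta> \<circ> \<mu> = (1 + r) \<beta>\<close>, then \<open>\<mu>P\<^sub>t f = \<mu>(\<eta>) e\<^bsup>-\<lambda>\<^sub>0t\<^esup> (\<alpha>(f) + \<beta>(r Q\<^sub>t(f/\<eta>)))\<close>, where the last term is at most
  \<open>e\<^bsup>-t/C\<^sub>P\<^esup> \<chi>\<^sub>2 \<alpha>(\<psi>\<^sup>2/\<eta>)\<^bsup>1/2\<^esup>\<close> for \<open>\<bar>f\<bar> \<le> \<psi>\<close>. Dividing the formula for \<open>f\<close> by the one for \<open>1\<close>, whose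
  error term is at most \<open>1/2\<close> for large \<open>t\<close>, gives the bound with \<open>a = b = 2\<close>.
\<close>

section \<open>Real-variable and integration lemmas\<close>

text \<open>(P2) speaks of the pointwise generator, and nothing says that its domain is dense or
  stable under the semigroup, or that it is the domain of a generator on L2. The variance of
  \<open>Q\<^sub>t f\<close> can therefore not be differentiated for a general \<open>f\<close>;
  time averages are functions that lie in the domain by construction, and the semigroup only shifts
  their window, so (P2) applies to them at every time. The hypotheses on the process give continuity
  of \<open>Q\<^sub>t g(x)\<close> in t from the right only. All derivatives below are therefore
  right derivatives, and decay is concluded from a monotonicity lemma for these. A second obstacle
  is that \<eta> may be unbounded: stochastic continuity of X does not pass to the Doob transform by
  itself, since \<eta>-weight could sit on events of vanishing probability. The eigenfunction
  equation rules this out. Finally, the law started from \<mu> is handled by pairing with the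
  density r in L2(\<beta>), so that decay of functions suffices and no adjoint semigroup has to be
  built. Since (P2) controls a squared norm at rate \<open>2 / C_P\<close>, the pairing decays at
  rate \<open>1 / C_P\<close>.\<close>

lemma right_derivative_nonpos_imp_le:
  fixes F :: "real \<Rightarrow> real"
  assumes T: "0 \<le> T" and cont: "continuous_on {0..T} F"
    and deriv: "\<And>t. 0 \<le> t \<Longrightarrow> t < T \<Longrightarrow> \<exists>d\<le>0. (F has_real_derivative d) (at_right t)"
  shows "F T \<le> F 0"
proof (rule field_le_epsilon)
  fix \<epsilon> :: real assume "0 < \<epsilon>"
  \<comment> \<open>Subtracting the slope \<delta> makes the right derivative strictly negative, at
    a total cost of at most \<epsilon> over \<open>{0..T}\<close>. The denominator
    \<open>T + 1\<close> also covers \<open>T = 0\<close>.\<close>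
  define \<delta> where "\<delta> = \<epsilon> / (T + 1)"
  have \<delta>: "0 < \<delta>" "\<delta> * T \<le> \<epsilon>" using \<open>0 < \<epsilon>\<close> T by (auto simp: \<delta>_def field_simps)
  define G where "G u = F u - \<delta> * u" for u
  \<comment> \<open>This closed bounded set has a largest point s. If s < T, the right difference
    quotient of \<open>F\<close> drops below \<delta> somewhere to the right of s, which yields a
    larger point of the set.\<close>
  define C where "C = {u \<in> {0..T}. G u \<le> G 0}"
  have "continuous_on {0..T} G" unfolding G_def by (intro continuous_intros cont)
  then have "closed C" unfolding C_def
    by (intro continuous_on_closed_Collect_le) auto
  moreover have "bounded C" unfolding C_def by (rule bounded_subset[of "{0..T}"]) auto
  moreover have "0 \<in> C" using T by (simp add: C_def)
  ultimately obtain s where s: "s \<in> C" "\<And>u. u \<in> C \<Longrightarrow> u \<le> s"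
    using compact_attains_sup[of C] compact_eq_bounded_closed by blast
  have "s = T"
  proof (rule ccontr)
    assume "s \<noteq> T"
    with s have sT: "0 \<le> s" "s < T" by (auto simp: C_def)
    from deriv[OF this] obtain d where "d \<le> 0" "(F has_real_derivative d) (at_right s)" by auto
    then have "((\<lambda>y. (F y - F s) / (y - s)) \<longlongrightarrow> d) (at_right s)"
      by (simp add: has_field_derivative_iff)
    from order_tendstoD(2)[OF this, of \<delta>] \<open>d \<le> 0\<close> \<delta>
    have ev: "eventually (\<lambda>y. (F y - F s) / (y - s) < \<delta>) (at_right s)" by simp
    have ev2: "eventually (\<lambda>y. y \<in> {s<..<T}) (at_right s)"
      using sT eventually_at_right_real by blast
    from eventually_happens[OF eventually_conj[OF ev ev2]] obtain y
      where y: "(F y - F s) / (y - s) < \<delta>" "s < y" "y < T" by auto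
    then have "G y \<le> G s" by (simp add: G_def field_simps)
    then have "y \<in> C" using s(1) y sT by (auto simp: C_def)
    with s(2) y show False by fastforce
  qed
  with s(1) \<delta> show "F T \<le> F 0 + \<epsilon>" by (auto simp: C_def G_def)
qed

text \<open>The fundamental theorem of calculus within \<open>{t..b}\<close> asks for continuity at
  t within this interval, and since t is its left endpoint that is right-continuity. The integral up
  to t contributes a constant.\<close>

lemma integral_has_right_derivative:
  fixes f :: "real \<Rightarrow> real"
  assumes f: "f integrable_on {a..b}" and t: "a \<le> t" "t < b"
    and c: "(f \<longlongrightarrow> f t) (at_right t)"
  shows "((\<lambda>u. integral {a..u} f) has_real_derivative f t) (at_right t)"
proof -
  have w: "at t within {t..b} = at_right t" using t by (simp add: at_within_Icc_at_right)
  have "((\<lambda>u. integral {t..u} f) has_vector_derivative f t) (at t within ({t..b} - {}))"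
  proof (rule integral_has_vector_derivative_continuous_at)
    show "f integrable_on {t..b}" using f t by (auto intro: integrable_subinterval_real)
  qed (use t c w in \<open>auto simp: continuous_within\<close>)
  then have "((\<lambda>u. integral {a..t} f + integral {t..u} f) has_real_derivative f t) (at t within {t..b})"
    by (auto intro!: derivative_eq_intros simp: has_real_derivative_iff_has_vector_derivative)
  then have "((\<lambda>u. integral {a..u} f) has_real_derivative f t) (at t within {t..b})"
  proof (rule has_field_derivative_transform_within[where d = 1])
    show "integral {a..t} f + integral {t..u} f = integral {a..u} f" if "u \<in> {t..b}" for u
      using that t f by (intro Henstock_Kurzweil_Integration.integral_combine)
        (auto intro: integrable_subinterval_real)
  qed (use t in auto)
  then show ?thesis by (simp add: w)
qed

lemma integral_difference_quotient_at_right: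
  fixes f :: "real \<Rightarrow> real"
  assumes f: "f integrable_on {a..b}" and t: "a \<le> t" "t < b"
    and c: "(f \<longlongrightarrow> f t) (at_right t)"
  shows "((\<lambda>r. (integral {a..t + r} f - integral {a..t} f) / r) \<longlongrightarrow> f t) (at_right 0)"
  using integral_has_right_derivative[OF assms]
  unfolding has_field_derivative_iff
  by (subst (asm) at_right_to_0) (simp add: filterlim_filtermap add.commute)

text \<open>Limits at \<open>at_right a\<close> can be tested along sequences in the interval from a
  to b that tend to a. Along these, dominated convergence applies with the constant
  \<open>B\<close>, integrable because the measure is finite.\<close>

lemma bounded_convergence_at_right:
  fixes f :: "real \<Rightarrow> 'a \<Rightarrow> real"
  assumes N: "finite_measure N" and ab: "a < b"
    and lim: "\<And>x. x \<in> space N \<Longrightarrow> ((\<lambda>t. f t x) \<longlongrightarrow> g x) (at_right a)"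
    and bd: "\<And>t x. a < t \<Longrightarrow> t < b \<Longrightarrow> x \<in> space N \<Longrightarrow> \<bar>f t x\<bar> \<le> B"
    and meas: "\<And>t. a < t \<Longrightarrow> t < b \<Longrightarrow> f t \<in> borel_measurable N"
  shows "((\<lambda>t. \<integral>x. f t x \<partial>N) \<longlongrightarrow> (\<integral>x. g x \<partial>N)) (at_right a)"
proof (rule tendsto_at_right_sequentially[OF ab])
  interpret finite_measure N by fact
  fix S :: "nat \<Rightarrow> real" assume S: "\<And>n. a < S n" "\<And>n. S n < b" "S \<longlonglongrightarrow> a"
  have S': "filterlim S (at_right a) sequentially"
    using S by (intro tendsto_imp_filterlim_at_right) auto
  have lim': "(\<lambda>n. f (S n) x) \<longlonglongrightarrow> g x" if "x \<in> space N" for x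
    using filterlim_compose[OF lim[OF that] S'] .
  show "(\<lambda>n. \<integral>x. f (S n) x \<partial>N) \<longlonglongrightarrow> (\<integral>x. g x \<partial>N)"
  proof (rule integral_dominated_convergence)
    show "g \<in> borel_measurable N"
      by (rule borel_measurable_LIMSEQ_real[of _ "\<lambda>n. f (S n)"]) (auto simp: lim' meas S)
    show "integrable N (\<lambda>x. B)" by simp
  qed (use bd S meas lim' in auto)
qed

lemma Cauchy_Schwarz_integral:
  fixes f g :: "'a \<Rightarrow> real"
  assumes [measurable]: "f \<in> borel_measurable N" "g \<in> borel_measurable N"
    and f: "integrable N (\<lambda>x. (f x)\<^sup>2)" and g: "integrable N (\<lambda>x. (g x)\<^sup>2)"
  shows "integrable N (\<lambda>x. f x * g x)"
    and "\<bar>\<integral>x. f x * g x \<partial>N\<bar> \<le> sqrt (\<integral>x. (f x)\<^sup>2 \<partial>N) * sqrt (\<integral>x. (g x)\<^sup>2 \<partial>N)"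
proof -
  have ab: "\<bar>a * b\<bar> \<le> a\<^sup>2 + b\<^sup>2" for a b :: real
  proof -
    have "0 \<le> \<bar>a\<bar> * \<bar>b\<bar>" by simp
    with sum_squares_bound[of "\<bar>a\<bar>" "\<bar>b\<bar>"] show ?thesis unfolding abs_mult power2_abs by linarith
  qed
  show int: "integrable N (\<lambda>x. f x * g x)"
    by (rule Bochner_Integration.integrable_bound[OF Bochner_Integration.integrable_add[OF f g]])
      (use ab in auto)
  have "(\<integral>\<^sup>+x. ennreal \<bar>f x\<bar> * ennreal \<bar>g x\<bar> \<partial>N)\<^sup>2
      \<le> (\<integral>\<^sup>+x. (ennreal \<bar>f x\<bar>)\<^sup>2 \<partial>N) * (\<integral>\<^sup>+x. (ennreal \<bar>g x\<bar>)\<^sup>2 \<partial>N)"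
    by (rule Cauchy_Schwarz_nn_integral) auto
  moreover have "(\<integral>\<^sup>+x. ennreal \<bar>f x\<bar> * ennreal \<bar>g x\<bar> \<partial>N) = ennreal (\<integral>x. \<bar>f x * g x\<bar> \<partial>N)"
    using integrable_abs[OF int]
    by (subst nn_integral_eq_integral[symmetric]) (auto simp: ennreal_mult abs_mult)
  moreover have "(\<integral>\<^sup>+x. (ennreal \<bar>f x\<bar>)\<^sup>2 \<partial>N) = ennreal (\<integral>x. (f x)\<^sup>2 \<partial>N)"
    using f by (subst nn_integral_eq_integral[symmetric]) (auto simp: ennreal_power)
  moreover have "(\<integral>\<^sup>+x. (ennreal \<bar>g x\<bar>)\<^sup>2 \<partial>N) = ennreal (\<integral>x. (g x)\<^sup>2 \<partial>N)"
    using g by (subst nn_integral_eq_integral[symmetric]) (auto simp: ennreal_power)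
  ultimately have "(\<integral>x. \<bar>f x * g x\<bar> \<partial>N)\<^sup>2 \<le> (\<integral>x. (f x)\<^sup>2 \<partial>N) * (\<integral>x. (g x)\<^sup>2 \<partial>N)"
    by (simp add: ennreal_power ennreal_mult[symmetric])
  from real_sqrt_le_mono[OF this]
  have "(\<integral>x. \<bar>f x * g x\<bar> \<partial>N) \<le> sqrt (\<integral>x. (f x)\<^sup>2 \<partial>N) * sqrt (\<integral>x. (g x)\<^sup>2 \<partial>N)"
    by (simp add: real_sqrt_mult)
  then show "\<bar>\<integral>x. f x * g x \<partial>N\<bar> \<le> sqrt (\<integral>x. (f x)\<^sup>2 \<partial>N) * sqrt (\<integral>x. (g x)\<^sup>2 \<partial>N)"
    using integral_abs_bound[of N "\<lambda>x. f x * g x"] by linarith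
qed

text \<open>Jensen's inequality for the square. With a nonnegative integral on the right it needs no
  square integrability; it is applied to every \<open>Q t x\<close>, where square integrability is
  known only for almost every x.\<close>

lemma (in prob_space) square_integral_le_nn_integral:
  fixes f :: "'a \<Rightarrow> real"
  assumes [measurable]: "f \<in> borel_measurable M"
  shows "ennreal ((\<integral>x. f x \<partial>M)\<^sup>2) \<le> (\<integral>\<^sup>+x. ennreal ((f x)\<^sup>2) \<partial>M)"
proof (cases "integrable M (\<lambda>x. (f x)\<^sup>2)")
  case True
  have "\<bar>\<integral>x. f x * 1 \<partial>M\<bar> \<le> sqrt (\<integral>x. (f x)\<^sup>2 \<partial>M) * sqrt (\<integral>x. 1\<^sup>2 \<partial>M)"
    by (rule Cauchy_Schwarz_integral) (use True in auto)
  then have "(\<integral>x. f x \<partial>M)\<^sup>2 \<le> (\<integral>x. (f x)\<^sup>2 \<partial>M)"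
    by (auto simp: prob_space intro: sqrt_ge_absD)
  then show ?thesis using True by (simp add: nn_integral_eq_integral)
next
  case False
  then have "(\<integral>\<^sup>+x. ennreal ((f x)\<^sup>2) \<partial>M) = \<infinity>"
    by (auto simp: integrable_iff_bounded less_top[symmetric])
  then show ?thesis by simp
qed

text \<open>The inner Bochner integral has the default value 0 wherever \<open>f\<close> is not
  integrable under \<open>N x\<close>. The finiteness assumption makes the set of such x null, so
  positive and negative parts can be integrated separately and subtracted.\<close>

lemma integral_bind_kernel:
  fixes f :: "'b \<Rightarrow> real"
  assumes N[measurable]: "N \<in> M \<rightarrow>\<^sub>M subprob_algebra B" and f[measurable]: "f \<in> borel_measurable B"
    and ne: "space M \<noteq> {}"
    and fin: "(\<integral>\<^sup>+x. \<integral>\<^sup>+y. ennreal \<bar>f y\<bar> \<partial>N x \<partial>M) < \<infinity>"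
  shows "integrable (M \<bind> N) f" and "AE x in M. integrable (N x) f"
    and "integrable M (\<lambda>x. \<integral>y. f y \<partial>N x)"
    and "(\<integral>y. f y \<partial>(M \<bind> N)) = (\<integral>x. \<integral>y. f y \<partial>N x \<partial>M)"
proof -
  have sN: "sets (N x) = sets B" if "x \<in> space M" for x
    using measurable_space[OF N that] by (simp add: space_subprob_algebra)
  have fN[measurable]: "f \<in> borel_measurable (N x)" if "x \<in> space M" for x
    using f sN[OF that] measurable_cong_sets by blast
  have sb: "sets (M \<bind> N) = sets B" by (rule sets_bind[OF sN ne])
  have fb[measurable]: "f \<in> borel_measurable (M \<bind> N)" using f sb measurable_cong_sets by blast
  show int: "integrable (M \<bind> N) f"
    using fin by (auto simp: integrable_iff_bounded nn_integral_bind[where B=B])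
  have m: "(\<lambda>x. \<integral>\<^sup>+y. u y \<partial>N x) \<in> borel_measurable M"
    if "u \<in> borel_measurable B" for u
    using that by measurable
  have "AE x in M. (\<integral>\<^sup>+y. ennreal \<bar>f y\<bar> \<partial>N x) \<noteq> \<infinity>"
    by (rule nn_integral_PInf_AE) (use fin m in auto)
  then show ae: "AE x in M. integrable (N x) f"
    using AE_space by eventually_elim (auto simp: integrable_iff_bounded top.not_eq_extremum)
  define p where "p x = (\<integral>\<^sup>+y. ennreal (f y) \<partial>N x)" for x
  define q where "q x = (\<integral>\<^sup>+y. ennreal (- f y) \<partial>N x)" for x
  have [measurable]: "p \<in> borel_measurable M" "q \<in> borel_measurable M"
    unfolding p_def q_def by (auto intro!: m)
  have pp: "(\<integral>\<^sup>+x. p x \<partial>M) = (\<integral>\<^sup>+y. ennreal (f y) \<partial>(M \<bind> N))"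
    "(\<integral>\<^sup>+x. q x \<partial>M) = (\<integral>\<^sup>+y. ennreal (- f y) \<partial>(M \<bind> N))"
    unfolding p_def q_def by (auto simp: nn_integral_bind[where B=B])
  have fin': "(\<integral>\<^sup>+x. p x \<partial>M) \<noteq> \<infinity>" "(\<integral>\<^sup>+x. q x \<partial>M) \<noteq> \<infinity>"
    using int unfolding pp real_integrable_def by auto
  have aep: "AE x in M. p x \<noteq> \<infinity>" "AE x in M. q x \<noteq> \<infinity>"
    by (rule nn_integral_PInf_AE; use fin' in simp)+
  have pe: "(\<integral>\<^sup>+x. ennreal (enn2real (p x)) \<partial>M) = (\<integral>\<^sup>+x. p x \<partial>M)"
    "(\<integral>\<^sup>+x. ennreal (enn2real (q x)) \<partial>M) = (\<integral>\<^sup>+x. q x \<partial>M)"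
    by (rule nn_integral_cong_AE; use aep in \<open>auto simp: less_top\<close>)+
  have ip: "integrable M (\<lambda>x. enn2real (p x))" "integrable M (\<lambda>x. enn2real (q x))"
    using fin' pe by (auto intro!: integrableI_bounded simp: less_top)
  have vp: "(\<integral>x. enn2real (p x) \<partial>M) = enn2real (\<integral>\<^sup>+x. p x \<partial>M)"
    "(\<integral>x. enn2real (q x) \<partial>M) = enn2real (\<integral>\<^sup>+x. q x \<partial>M)"
    by (subst integral_eq_nn_integral; simp add: pe)+
  have ai: "AE x in M. (\<integral>y. f y \<partial>N x) = enn2real (p x) - enn2real (q x)"
    using ae by eventually_elim (simp add: real_lebesgue_integral_def p_def q_def)
  have [measurable]: "(\<lambda>x. \<integral>y. f y \<partial>N x) \<in> borel_measurable M"
    using N f by measurable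
  show "integrable M (\<lambda>x. \<integral>y. f y \<partial>N x)"
    by (subst integrable_cong_AE[OF _ _ ai]) (auto intro: ip)
  have "(\<integral>x. \<integral>y. f y \<partial>N x \<partial>M) = (\<integral>x. enn2real (p x) - enn2real (q x) \<partial>M)"
    by (rule integral_cong_AE) (use ai in auto)
  also have "\<dots> = (\<integral>y. f y \<partial>(M \<bind> N))"
    using ip int by (simp add: vp pp real_lebesgue_integral_def)
  finally show "(\<integral>y. f y \<partial>(M \<bind> N)) = (\<integral>x. \<integral>y. f y \<partial>N x \<partial>M)" ..
qed

section \<open>Density of bounded continuous functions in \<open>L\<^sup>2\<close>\<close>

text \<open>The error is the squared norm. Its integrability is demanded separately, because the
  integral of a non-integrable error would be 0 and pass the test.\<close>

definition L2_approximable :: "'a::metric_space measure \<Rightarrow> ('a \<Rightarrow> real) \<Rightarrow> bool" where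
  "L2_approximable N f \<longleftrightarrow> (\<forall>\<epsilon>>0. \<exists>g. continuous_on UNIV g \<and> bounded (range g) \<and>
     integrable N (\<lambda>x. (f x - g x)\<^sup>2) \<and> (\<integral>x. (f x - g x)\<^sup>2 \<partial>N) < \<epsilon>)"

text \<open>A cheap substitute for the triangle inequality in L2; the factors 2 are the origin of
  the bounds \<open>\<epsilon> / 4\<close> in the approximation lemmas.\<close>

lemma square_integral_add_le:
  fixes f g :: "'a \<Rightarrow> real"
  assumes [measurable]: "f \<in> borel_measurable N" "g \<in> borel_measurable N"
    and f: "integrable N (\<lambda>x. (f x)\<^sup>2)" and g: "integrable N (\<lambda>x. (g x)\<^sup>2)"
  shows "integrable N (\<lambda>x. (f x + g x)\<^sup>2)"
    and "(\<integral>x. (f x + g x)\<^sup>2 \<partial>N) \<le> 2 * (\<integral>x. (f x)\<^sup>2 \<partial>N) + 2 * (\<integral>x. (g x)\<^sup>2 \<partial>N)"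
proof -
  have ab: "(a + b)\<^sup>2 \<le> 2 * a\<^sup>2 + 2 * b\<^sup>2" for a b :: real
    using sum_squares_bound[of a b] by (simp add: power2_sum)
  have i: "integrable N (\<lambda>x. 2 * (f x)\<^sup>2 + 2 * (g x)\<^sup>2)" using f g by simp
  show j: "integrable N (\<lambda>x. (f x + g x)\<^sup>2)"
    by (rule Bochner_Integration.integrable_bound[OF i]) (auto simp: ab)
  have "(\<integral>x. (f x + g x)\<^sup>2 \<partial>N) \<le> (\<integral>x. 2 * (f x)\<^sup>2 + 2 * (g x)\<^sup>2 \<partial>N)"
    by (rule integral_mono[OF j i]) (rule ab)
  then show "(\<integral>x. (f x + g x)\<^sup>2 \<partial>N) \<le> 2 * (\<integral>x. (f x)\<^sup>2 \<partial>N) + 2 * (\<integral>x. (g x)\<^sup>2 \<partial>N)"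
    using f g by simp
qed

context
  fixes N :: "'a::metric_space measure"
  assumes N: "finite_measure N" and sN: "sets N = sets borel"
begin

lemma borel_measurable_sets_eq: "f \<in> borel_measurable borel \<Longrightarrow> f \<in> borel_measurable N"
  using sN measurable_cong_sets by blast

lemma L2_approximable_trans:
  assumes f: "f \<in> borel_measurable borel"
    and approx: "\<And>\<epsilon>. 0 < \<epsilon> \<Longrightarrow> \<exists>h. h \<in> borel_measurable borel \<and> L2_approximable N h \<and>
      integrable N (\<lambda>x. (f x - h x)\<^sup>2) \<and> (\<integral>x. (f x - h x)\<^sup>2 \<partial>N) < \<epsilon>"
  shows "L2_approximable N f"
  unfolding L2_approximable_def
proof (intro allI impI)
  fix \<epsilon> :: real assume "0 < \<epsilon>"
  then obtain h where h: "h \<in> borel_measurable borel" "L2_approximable N h"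
    "integrable N (\<lambda>x. (f x - h x)\<^sup>2)" "(\<integral>x. (f x - h x)\<^sup>2 \<partial>N) < \<epsilon> / 4"
    using approx[of "\<epsilon> / 4"] by auto
  from h(2) \<open>0 < \<epsilon>\<close> obtain g where g: "continuous_on UNIV g" "bounded (range g)"
    "integrable N (\<lambda>x. (h x - g x)\<^sup>2)" "(\<integral>x. (h x - g x)\<^sup>2 \<partial>N) < \<epsilon> / 4"
    unfolding L2_approximable_def by (meson zero_less_divide_iff zero_less_numeral)
  have [measurable]: "g \<in> borel_measurable N" "h \<in> borel_measurable N" "f \<in> borel_measurable N"
    using g(1) h(1) f by (auto intro!: borel_measurable_sets_eq borel_measurable_continuous_onI)
  have "integrable N (\<lambda>x. ((f x - h x) + (h x - g x))\<^sup>2)"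
    "(\<integral>x. ((f x - h x) + (h x - g x))\<^sup>2 \<partial>N) \<le> 2 * (\<integral>x. (f x - h x)\<^sup>2 \<partial>N) + 2 * (\<integral>x. (h x - g x)\<^sup>2 \<partial>N)"
    by (rule square_integral_add_le; use h g in simp)+
  with g h show "\<exists>g. continuous_on UNIV g \<and> bounded (range g) \<and>
     integrable N (\<lambda>x. (f x - g x)\<^sup>2) \<and> (\<integral>x. (f x - g x)\<^sup>2 \<partial>N) < \<epsilon>"
    by (intro exI[of _ g]) auto
qed

lemma L2_approximable_add:
  assumes [measurable]: "f \<in> borel_measurable N" "g \<in> borel_measurable N"
    and f: "L2_approximable N f" and g: "L2_approximable N g"
  shows "L2_approximable N (\<lambda>x. f x + g x)"
  unfolding L2_approximable_def
proof (intro allI impI)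
  fix \<epsilon> :: real assume "0 < \<epsilon>"
  then have e: "0 < \<epsilon> / 4" by simp
  from f e obtain u where u: "continuous_on UNIV u" "bounded (range u)"
    "integrable N (\<lambda>x. (f x - u x)\<^sup>2)" "(\<integral>x. (f x - u x)\<^sup>2 \<partial>N) < \<epsilon> / 4"
    unfolding L2_approximable_def by blast
  from g e obtain v where v: "continuous_on UNIV v" "bounded (range v)"
    "integrable N (\<lambda>x. (g x - v x)\<^sup>2)" "(\<integral>x. (g x - v x)\<^sup>2 \<partial>N) < \<epsilon> / 4"
    unfolding L2_approximable_def by blast
  have [measurable]: "u \<in> borel_measurable N" "v \<in> borel_measurable N"
    using u(1) v(1) by (auto intro!: borel_measurable_sets_eq borel_measurable_continuous_onI)
  have "integrable N (\<lambda>x. ((f x - u x) + (g x - v x))\<^sup>2)"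
    "(\<integral>x. ((f x - u x) + (g x - v x))\<^sup>2 \<partial>N) \<le> 2 * (\<integral>x. (f x - u x)\<^sup>2 \<partial>N) + 2 * (\<integral>x. (g x - v x)\<^sup>2 \<partial>N)"
    by (rule square_integral_add_le; use u v in simp)+
  moreover have "(f x - u x) + (g x - v x) = f x + g x - (u x + v x)" for x by simp
  moreover have "bounded (range (\<lambda>x. u x + v x))"
    using u(2) v(2) by (rule bounded_plus_comp)
  ultimately show "\<exists>w. continuous_on UNIV w \<and> bounded (range w) \<and>
     integrable N (\<lambda>x. (f x + g x - w x)\<^sup>2) \<and> (\<integral>x. (f x + g x - w x)\<^sup>2 \<partial>N) < \<epsilon>"
    using u v by (intro exI[of _ "\<lambda>x. u x + v x"]) (auto intro!: continuous_intros)
qed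

lemma L2_approximable_continuous:
  "continuous_on UNIV g \<Longrightarrow> bounded (range g) \<Longrightarrow> L2_approximable N g"
  unfolding L2_approximable_def by (intro allI impI exI[of _ g]) auto

lemma L2_approximable_scale:
  assumes f: "L2_approximable N f"
  shows "L2_approximable N (\<lambda>x. a * f x)"
proof (cases "a = 0")
  case True
  then show ?thesis using L2_approximable_continuous[of "\<lambda>_. 0"] by simp
next
  case False
  show ?thesis
  unfolding L2_approximable_def
  proof (intro allI impI)
    fix \<epsilon> :: real assume "0 < \<epsilon>"
    then have "0 < \<epsilon> / a\<^sup>2" using False by simp
    with f obtain u where u: "continuous_on UNIV u" "bounded (range u)"
      "integrable N (\<lambda>x. (f x - u x)\<^sup>2)" "(\<integral>x. (f x - u x)\<^sup>2 \<partial>N) < \<epsilon> / a\<^sup>2"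
      unfolding L2_approximable_def by blast
    have "(a * f x - a * u x)\<^sup>2 = a\<^sup>2 * (f x - u x)\<^sup>2" for x
      by (simp add: power_mult_distrib[symmetric] algebra_simps)
    moreover have "bounded (range (\<lambda>x. a * u x))"
      using bounded_scaling[OF u(2), of a] by (simp add: image_image)
    ultimately show "\<exists>w. continuous_on UNIV w \<and> bounded (range w) \<and>
       integrable N (\<lambda>x. (a * f x - w x)\<^sup>2) \<and> (\<integral>x. (a * f x - w x)\<^sup>2 \<partial>N) < \<epsilon>"
      using u False by (intro exI[of _ "\<lambda>x. a * u x"]) (auto intro!: continuous_intros simp: field_simps)
  qed
qed

lemma L2_approximable_sum:
  assumes "finite I" "\<And>i. i \<in> I \<Longrightarrow> f i \<in> borel_measurable N" "\<And>i. i \<in> I \<Longrightarrow> L2_approximable N (f i)"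
  shows "L2_approximable N (\<lambda>x. \<Sum>i\<in>I. f i x)"
  using assms
proof (induction I)
  case empty
  show ?case using L2_approximable_continuous[of "\<lambda>_. 0"] by simp
next
  case (insert i I)
  then show ?case by (auto intro!: L2_approximable_add borel_measurable_sum)
qed

lemma L2_approximable_bounded_LIMSEQ:
  assumes f: "f \<in> borel_measurable borel" and h: "\<And>n. h n \<in> borel_measurable borel"
    and a: "\<And>n. L2_approximable N (h n)"
    and lim: "\<And>x. (\<lambda>n. h n x) \<longlonglongrightarrow> f x"
    and w: "integrable N w" "\<And>n x. (f x - h n x)\<^sup>2 \<le> w x"
  shows "L2_approximable N f"
proof (rule L2_approximable_trans[OF f])
  fix \<epsilon> :: real assume "0 < \<epsilon>"
  have [measurable]: "f \<in> borel_measurable N" "h n \<in> borel_measurable N" for n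
    using f h by (auto intro!: borel_measurable_sets_eq)
  have i: "integrable N (\<lambda>x. (f x - h n x)\<^sup>2)" for n
    by (rule Bochner_Integration.integrable_bound[OF w(1)]) (use w(2) in \<open>auto intro!: order_trans[OF _ abs_ge_self]\<close>)
  have "(\<lambda>n. \<integral>x. (f x - h n x)\<^sup>2 \<partial>N) \<longlonglongrightarrow> (\<integral>x. 0 \<partial>N)"
  proof (rule integral_dominated_convergence[OF _ _ w(1)])
    show "AE x in N. (\<lambda>n. (f x - h n x)\<^sup>2) \<longlonglongrightarrow> 0"
      by (intro AE_I2) (use lim in \<open>auto intro!: tendsto_eq_intros\<close>)
  qed (use w in auto)
  from order_tendstoD(2)[OF this, of \<epsilon>] \<open>0 < \<epsilon>\<close>
  obtain n where "(\<integral>x. (f x - h n x)\<^sup>2 \<partial>N) < \<epsilon>" by (auto simp: eventually_sequentially)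
  then show "\<exists>h. h \<in> borel_measurable borel \<and> L2_approximable N h \<and>
      integrable N (\<lambda>x. (f x - h x)\<^sup>2) \<and> (\<integral>x. (f x - h x)\<^sup>2 \<partial>N) < \<epsilon>"
    using i h a by (intro exI[of _ "h n"]) auto
qed

text \<open>Dynkin's theorem: closed sets are stable under intersection and generate the Borel sets,
  and approximable sets are closed under complements and disjoint countable unions. A closed set is
  reached from above by continuous cut-offs of the distance to it.\<close>

lemma L2_approximable_indicator:
  assumes "A \<in> sets borel"
  shows "L2_approximable N (indicator A)"
proof -
  interpret finite_measure N by fact
  have sb: "sigma_sets UNIV (Collect closed) = (sets borel :: 'a set set)"
    by (subst borel_eq_closed) simp
  have "Int_stable (Collect closed :: 'a set set)" by (auto simp: Int_stable_def)
  moreover have "Collect closed \<subseteq> Pow (UNIV :: 'a set)" by simp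
  moreover have "A \<in> sigma_sets UNIV (Collect closed)" using assms by (simp add: sb)
  ultimately show ?thesis
  proof (induction rule: sigma_sets_induct_disjoint)
    case (basic F)
    then have F: "closed F" by simp
    show ?case
    \<comment> \<open>\<open>infdist\<close> to the empty set is 0, so the cut-offs below would be
      constantly 1 instead of tending to 0.\<close>
    proof (cases "F = {}")
      case True
      then show ?thesis using L2_approximable_continuous[of "\<lambda>_. 0"] by (simp add: indicator_def)
    next
      case False
      define h where "h n x = max 0 (1 - real n * infdist x F)" for n x
      have h01: "0 \<le> h n x" "h n x \<le> 1" for n x by (auto simp: h_def infdist_nonneg)
      have hc: "continuous_on UNIV (h n)" for n
        unfolding h_def by (intro continuous_intros)
      have hb: "bounded (range (h n))" for n
        by (rule boundedI[of _ 1]) (use h01 in auto)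
      show ?thesis
      proof (rule L2_approximable_bounded_LIMSEQ[where h = h and w = "\<lambda>_. 1"])
        show "(\<lambda>n. h n x) \<longlonglongrightarrow> indicator F x" for x
        proof (cases "x \<in> F")
          case True
          then show ?thesis by (simp add: h_def)
        next
          case nF: False
          then have d: "0 < infdist x F"
            using F False in_closed_iff_infdist_zero[of F x] infdist_nonneg[of x F] by linarith
          then obtain n0 where n0: "1 < real n0 * infdist x F" using reals_Archimedean3 by blast
          have "h n x = indicator F x" if "n \<ge> n0" for n
          proof -
            have "real n0 * infdist x F \<le> real n * infdist x F"
              using that d by (intro mult_right_mono) auto
            then show ?thesis using nF n0 by (simp add: h_def)
          qed
          then show ?thesis by (intro tendsto_eventually) (auto simp: eventually_sequentially)
        qed
        show "(indicator F x - h n x)\<^sup>2 \<le> 1" for n x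
          using h01[of n x] by (intro abs_le_square_iff[of _ 1, THEN iffD1, simplified]) (auto simp: indicator_def)
      qed (use F hc hb in \<open>auto intro!: L2_approximable_continuous borel_measurable_continuous_onI\<close>)
    qed
  next
    case (empty)
    then show ?case using L2_approximable_continuous[of "\<lambda>_. 0"] by (simp add: indicator_def)
  next
    case (compl A)
    then have [measurable]: "A \<in> sets N" by (simp add: sN sb)
    have "L2_approximable N (\<lambda>x. 1 + (-1) * indicator A x)"
      by (intro L2_approximable_add L2_approximable_scale L2_approximable_continuous compl) auto
    moreover have "(\<lambda>x. 1 + (-1) * indicator A x :: real) = indicator (UNIV - A)"
      by (auto simp: indicator_def)
    ultimately show ?case by simp
  next
    case (union A)
    then have [measurable]: "A i \<in> sets borel" for i by (auto simp: sb)
    then have [measurable]: "A i \<in> sets N" for i by (simp add: sN)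
    \<comment> \<open>By disjointness the partial sums are themselves indicators, which bounds the
      squared error by 1.\<close>
    have eq: "(\<Sum>i<n. indicator (A i) x) = (indicator (\<Union>i<n. A i) x :: real)" for n x
      using union(1) by (intro indicator_UN_disjoint[symmetric]) (auto simp: disjoint_family_on_def)
    show ?case
    proof (rule L2_approximable_bounded_LIMSEQ[where h = "\<lambda>n x. \<Sum>i<n. indicator (A i) x" and w = "\<lambda>_. 1"])
      show "L2_approximable N (\<lambda>x. \<Sum>i<n. indicator (A i) x)" for n
        by (intro L2_approximable_sum union) auto
      show "(\<lambda>n. \<Sum>i<n. indicator (A i) x) \<longlonglongrightarrow> (indicator (\<Union>i. A i) x :: real)" for x
        unfolding eq using LIMSEQ_indicator_UN[of A x] by simp
      show "(indicator (\<Union>i. A i) x - (\<Sum>i<n. indicator (A i) x))\<^sup>2 \<le> (1 :: real)" for n x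
        unfolding eq by (auto simp: indicator_def)
    qed auto
  qed
qed

lemma L2_approximable_square_integrable:
  assumes f: "f \<in> borel_measurable borel" and f2: "integrable N (\<lambda>x. (f x)\<^sup>2)"
  shows "L2_approximable N f"
proof -
  from borel_measurable_implies_sequence_metric[OF f, of 0] obtain F where
    F: "\<And>i. simple_function borel (F i)" "\<And>x. (\<lambda>i. F i x) \<longlonglongrightarrow> f x"
      "\<And>i x. dist (F i x) 0 \<le> 2 * dist (f x) 0"
    by auto
  have [measurable]: "F i \<in> borel_measurable borel" for i
    using F(1) by (rule borel_measurable_simple_function)
  show ?thesis
  \<comment> \<open>The simple functions satisfy
    \<open>\<bar>F i x\<bar> \<le> 2 * \<bar>f x\<bar>\<close>, so the error is at most three times
    \<open>\<bar>f x\<bar>\<close>; squaring gives the factor 9.\<close>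
  proof (rule L2_approximable_bounded_LIMSEQ[where h = F and w = "\<lambda>x. 9 * (f x)\<^sup>2", OF f _ _ F(2)])
    fix i
    have fin: "finite (range (F i))" using simple_functionD(1)[OF F(1)] by simp
    have "L2_approximable N (\<lambda>x. \<Sum>y\<in>range (F i). y * indicator (F i -` {y}) x)"
    proof (intro L2_approximable_sum L2_approximable_scale L2_approximable_indicator fin)
      show "F i -` {y} \<in> sets borel" for y
        using measurable_sets[of "F i" borel borel "{y}"] by simp
      then have "F i -` {y} \<in> sets N" for y by (simp add: sN)
      then show "(\<lambda>x. y * indicator (F i -` {y}) x) \<in> borel_measurable N" for y by measurable
    qed
    moreover have "F i = (\<lambda>x. \<Sum>y\<in>range (F i). y * indicator (F i -` {y}) x)"
    proof
      show "F i x = (\<Sum>y\<in>range (F i). y * indicator (F i -` {y}) x)" for x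
        by (rule trans[OF simple_function_indicator_representation_banach[OF F(1)]]) (simp_all add: mult.commute)
    qed
    ultimately show "L2_approximable N (F i)" by (simp only:)
    show "(f x - F i x)\<^sup>2 \<le> 9 * (f x)\<^sup>2" for x
    proof -
      have "\<bar>f x - F i x\<bar> \<le> 3 * \<bar>f x\<bar>" using F(3)[of i x] by (simp add: dist_real_def)
      from power_mono[OF this, of 2] show ?thesis by (simp add: power_mult_distrib)
    qed
  qed (use f2 in auto)
qed

end

section \<open>Markov semigroups satisfying a Poincare inequality\<close>

text \<open>Continuity is required only at time 0 and only in probability, but from every starting
  point. Chapman-Kolmogorov spreads it to right-continuity at all times.\<close>

locale markov_kernel_semigroup =
  fixes Q :: "real \<Rightarrow> 'a::metric_space \<Rightarrow> 'a measure" and \<beta> :: "'a measure"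
  assumes kernel: "\<And>t. 0 \<le> t \<Longrightarrow> Q t \<in> borel \<rightarrow>\<^sub>M prob_algebra borel"
    and initial: "\<And>x. Q 0 x = return borel x"
    and chapman_kolmogorov: "\<And>s t x. 0 \<le> s \<Longrightarrow> 0 \<le> t \<Longrightarrow> Q (s + t) x = Q s x \<bind> Q t"
    and stochastically_continuous: "\<And>x \<epsilon>. 0 < \<epsilon> \<Longrightarrow>
      ((\<lambda>t. measure (Q t x) {y. \<epsilon> \<le> dist y x}) \<longlongrightarrow> 0) (at_right 0)"
    and \<beta>_prob: "\<beta> \<in> space (prob_algebra borel)"
    and invariant: "\<And>t. 0 \<le> t \<Longrightarrow> \<beta> \<bind> Q t = \<beta>"
begin

text \<open>Clipping the time at \<open>0\<close> lets Lebesgue integrals over time range over all of \<open>\<real>\<close>.\<close>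

definition S :: "real \<Rightarrow> ('a \<Rightarrow> real) \<Rightarrow> 'a \<Rightarrow> real" where
  "S t g x = (\<integral>y. g y \<partial>Q (max 0 t) x)"

lemma kernel_sub: "0 \<le> t \<Longrightarrow> Q t \<in> borel \<rightarrow>\<^sub>M subprob_algebra borel"
  using kernel by (rule measurable_prob_algebraD)

lemma sets_Q [simp]: "0 \<le> t \<Longrightarrow> sets (Q t x) = sets borel"
  using measurable_space[OF kernel, of t x] by (simp add: space_prob_algebra)

lemma space_Q [simp]: "0 \<le> t \<Longrightarrow> space (Q t x) = UNIV"
  using sets_eq_imp_space_eq[OF sets_Q] by simp

lemma prob_Q: "0 \<le> t \<Longrightarrow> prob_space (Q t x)"
  using measurable_space[OF kernel, of t x] by (simp add: space_prob_algebra)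

lemma sets_\<beta> [simp]: "sets \<beta> = sets borel" and prob_\<beta>: "prob_space \<beta>"
  using \<beta>_prob by (simp_all add: space_prob_algebra)

lemma space_\<beta> [simp]: "space \<beta> = UNIV"
  using sets_eq_imp_space_eq[OF sets_\<beta>] by simp

lemma borel_measurable_Q: "0 \<le> t \<Longrightarrow> f \<in> borel_measurable borel \<Longrightarrow> f \<in> borel_measurable (Q t x)"
  by (subst measurable_cong_sets[OF sets_Q refl])

lemma borel_measurable_\<beta>: "f \<in> borel_measurable \<beta> \<longleftrightarrow> f \<in> borel_measurable borel"
  by (rule arg_cong[where f="\<lambda>A. f \<in> A"], rule measurable_cong_sets) simp_all

lemma kernel_\<beta>: "0 \<le> t \<Longrightarrow> Q t \<in> \<beta> \<rightarrow>\<^sub>M subprob_algebra borel"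
  using kernel_sub measurable_cong_sets[OF sets_\<beta> refl] by blast

lemma S_measurable:
  assumes "g \<in> borel_measurable borel"
  shows "S t g \<in> borel_measurable borel"
  unfolding S_def
  by (rule measurable_compose[OF kernel_sub integral_measurable_subprob_algebra]) (use assms in auto)

lemma measure_Q_UNIV [simp]: "0 \<le> t \<Longrightarrow> measure (Q t x) UNIV = 1"
  using prob_space.prob_space[OF prob_Q, of t x] by simp

lemma integrable_Q_bounded:
  fixes g :: "'a \<Rightarrow> real"
  assumes "g \<in> borel_measurable borel" "\<And>x. \<bar>g x\<bar> \<le> B" "0 \<le> t"
  shows "integrable (Q t x) g"
proof -
  interpret prob_space "Q t x" using assms(3) by (rule prob_Q)
  show ?thesis by (rule integrable_const_bound[of _ B]) (use assms borel_measurable_Q in auto)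
qed

lemma integrable_\<beta>_bounded:
  fixes g :: "'a \<Rightarrow> real"
  assumes "g \<in> borel_measurable borel" "\<And>x. \<bar>g x\<bar> \<le> B"
  shows "integrable \<beta> g"
proof -
  interpret prob_space \<beta> by (rule prob_\<beta>)
  show ?thesis by (rule integrable_const_bound[of _ B]) (use assms borel_measurable_\<beta> in auto)
qed

lemma S_bounded:
  assumes "g \<in> borel_measurable borel" "\<And>x. \<bar>g x\<bar> \<le> B"
  shows "\<bar>S t g x\<bar> \<le> B"
proof -
  interpret prob_space "Q (max 0 t) x" by (rule prob_Q) simp
  have "\<bar>S t g x\<bar> \<le> (\<integral>y. \<bar>g y\<bar> \<partial>Q (max 0 t) x)" unfolding S_def by (rule integral_abs_bound)
  also have "\<dots> \<le> (\<integral>y. B \<partial>Q (max 0 t) x)"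
    using integrable_Q_bounded[OF assms, of "max 0 t" x] by (intro integral_mono) (auto simp: assms)
  finally show ?thesis by (simp add: prob_space)
qed

lemma nn_integral_invariant:
  assumes "0 \<le> t" "f \<in> borel_measurable borel"
  shows "(\<integral>\<^sup>+x. \<integral>\<^sup>+y. f y \<partial>Q t x \<partial>\<beta>) = (\<integral>\<^sup>+x. f x \<partial>\<beta>)"
  using nn_integral_bind[OF assms(2) kernel_\<beta>[OF assms(1)]] invariant[OF assms(1)] by simp

lemma nn_integral_abs_bounded:
  assumes "prob_space N" "\<And>x. \<bar>g x\<bar> \<le> B"
  shows "(\<integral>\<^sup>+x. ennreal \<bar>g x\<bar> \<partial>N) \<le> ennreal B"
proof -
  interpret prob_space N by fact
  have "(\<integral>\<^sup>+x. ennreal \<bar>g x\<bar> \<partial>N) \<le> (\<integral>\<^sup>+x. ennreal B \<partial>N)"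
    using assms by (intro nn_integral_mono ennreal_leI) auto
  then show ?thesis by (simp add: emeasure_space_1)
qed

lemma S_add:
  assumes g: "g \<in> borel_measurable borel" "\<And>x. \<bar>g x\<bar> \<le> B" and "0 \<le> s" "0 \<le> t"
  shows "S (s + t) g x = S s (S t g) x"
proof -
  interpret prob_space "Q s x" using \<open>0 \<le> s\<close> by (rule prob_Q)
  have k: "Q t \<in> Q s x \<rightarrow>\<^sub>M subprob_algebra borel"
    using kernel_sub[OF \<open>0 \<le> t\<close>] measurable_cong_sets[OF sets_Q[OF \<open>0 \<le> s\<close>] refl] by blast
  have "(\<integral>\<^sup>+y. \<integral>\<^sup>+z. ennreal \<bar>g z\<bar> \<partial>Q t y \<partial>Q s x) \<le> (\<integral>\<^sup>+y. ennreal B \<partial>Q s x)"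
    using \<open>0 \<le> t\<close> g by (intro nn_integral_mono nn_integral_abs_bounded prob_Q) auto
  also have "\<dots> < \<infinity>" by (simp add: emeasure_space_1)
  finally have "(\<integral>y. g y \<partial>(Q s x \<bind> Q t)) = (\<integral>y. \<integral>z. g z \<partial>Q t y \<partial>Q s x)"
    using \<open>0 \<le> s\<close> by (intro integral_bind_kernel[OF k g(1)]) auto
  then show ?thesis using assms by (simp add: S_def chapman_kolmogorov)
qed

text \<open>For unbounded \<open>g\<close> the value \<open>S t g x\<close> may be the default 0 of
  a non-integrable function. The third conclusion confines this to a null set, which is what makes
  \<open>S t\<close> additive almost everywhere.\<close>

lemma integral_S_\<beta>:
  assumes g: "g \<in> borel_measurable borel" and i: "integrable \<beta> g" and t: "0 \<le> t"
  shows "integrable \<beta> (S t g)" and "(\<integral>x. S t g x \<partial>\<beta>) = (\<integral>x. g x \<partial>\<beta>)"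
    and "AE x in \<beta>. integrable (Q t x) g"
proof -
  have "(\<integral>\<^sup>+x. \<integral>\<^sup>+y. ennreal \<bar>g y\<bar> \<partial>Q t x \<partial>\<beta>) = (\<integral>\<^sup>+x. ennreal \<bar>g x\<bar> \<partial>\<beta>)"
    using g t by (intro nn_integral_invariant) auto
  then have fin: "(\<integral>\<^sup>+x. \<integral>\<^sup>+y. ennreal \<bar>g y\<bar> \<partial>Q t x \<partial>\<beta>) < \<infinity>"
    using i by (auto simp: integrable_iff_bounded)
  note ib = integral_bind_kernel[OF kernel_\<beta>[OF t] g _ fin]
  show "integrable \<beta> (S t g)" "(\<integral>x. S t g x \<partial>\<beta>) = (\<integral>x. g x \<partial>\<beta>)"
    "AE x in \<beta>. integrable (Q t x) g"
    using ib t by (auto simp: S_def[abs_def] invariant)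
qed

text \<open>\<open>S t\<close> contracts L2(\<beta>): Jensen under each \<open>Q t x\<close>, then
  invariance of \<beta>.\<close>

lemma integral_square_S_le:
  assumes g: "g \<in> borel_measurable borel" and i: "integrable \<beta> (\<lambda>x. (g x)\<^sup>2)" and t: "0 \<le> t"
  shows "integrable \<beta> (\<lambda>x. (S t g x)\<^sup>2)" and "(\<integral>x. (S t g x)\<^sup>2 \<partial>\<beta>) \<le> (\<integral>x. (g x)\<^sup>2 \<partial>\<beta>)"
proof -
  have [measurable]: "S t g \<in> borel_measurable \<beta>" "g \<in> borel_measurable \<beta>"
    using S_measurable[OF g] g by (simp_all add: borel_measurable_\<beta>)
  have "(\<integral>\<^sup>+x. ennreal ((S t g x)\<^sup>2) \<partial>\<beta>) \<le> (\<integral>\<^sup>+x. \<integral>\<^sup>+y. ennreal ((g y)\<^sup>2) \<partial>Q t x \<partial>\<beta>)"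
    unfolding S_def using t
    by (intro nn_integral_mono)
      (auto intro!: prob_space.square_integral_le_nn_integral prob_Q borel_measurable_Q[OF _ g])
  also have "\<dots> = (\<integral>\<^sup>+x. ennreal ((g x)\<^sup>2) \<partial>\<beta>)"
    using t g by (intro nn_integral_invariant) auto
  also have "\<dots> = ennreal (\<integral>x. (g x)\<^sup>2 \<partial>\<beta>)" by (rule nn_integral_eq_integral[OF i]) simp
  finally have *: "(\<integral>\<^sup>+x. ennreal ((S t g x)\<^sup>2) \<partial>\<beta>) \<le> ennreal (\<integral>x. (g x)\<^sup>2 \<partial>\<beta>)" .
  show j: "integrable \<beta> (\<lambda>x. (S t g x)\<^sup>2)"
    by (rule integrableI_bounded) (use * in \<open>auto simp: order.strict_trans1 ennreal_less_top\<close>)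
  have "(\<integral>\<^sup>+x. ennreal ((S t g x)\<^sup>2) \<partial>\<beta>) = ennreal (\<integral>x. (S t g x)\<^sup>2 \<partial>\<beta>)"
    by (rule nn_integral_eq_integral[OF j]) simp
  with * show "(\<integral>x. (S t g x)\<^sup>2 \<partial>\<beta>) \<le> (\<integral>x. (g x)\<^sup>2 \<partial>\<beta>)" by simp
qed

text \<open>Within distance \<open>\<delta>\<close> of x the oscillation of \<open>g\<close> is
  below \<open>\<epsilon> / 2\<close>; beyond it the difference is at most \<open>2 * B\<close>, and
  the probability of being there tends to 0.\<close>

lemma S_tendsto_0:
  assumes c: "continuous_on UNIV g" and b: "\<And>x. \<bar>g x\<bar> \<le> B"
  shows "((\<lambda>t. S t g x) \<longlongrightarrow> g x) (at_right 0)"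
proof (rule tendstoI)
  fix \<epsilon> :: real assume "0 < \<epsilon>"
  have [measurable]: "g \<in> borel_measurable borel" using c by (rule borel_measurable_continuous_onI)
  have B: "0 \<le> B" using b[of x] by linarith
  from c have "isCont g x" by (simp add: continuous_on_eq_continuous_at)
  then obtain \<delta> where \<delta>: "0 < \<delta>" "\<And>y. dist y x < \<delta> \<Longrightarrow> dist (g y) (g x) < \<epsilon> / 2"
    using \<open>0 < \<epsilon>\<close> unfolding continuous_at_eps_delta by (metis half_gt_zero)
  let ?m = "\<lambda>t. measure (Q t x) {y. \<delta> \<le> dist y x}"
  have "((\<lambda>t. 2 * B * ?m t) \<longlongrightarrow> 2 * B * 0) (at_right 0)"
    by (intro tendsto_intros stochastically_continuous \<delta>)
  then have "\<forall>\<^sub>F t in at_right 0. 2 * B * ?m t < \<epsilon> / 2"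
    using \<open>0 < \<epsilon>\<close> by (intro order_tendstoD(2)[where a="\<epsilon>/2"]) auto
  moreover have "\<forall>\<^sub>F t in at_right (0::real). 0 < t" by (simp add: eventually_at_right_less)
  ultimately show "\<forall>\<^sub>F t in at_right 0. dist (S t g x) (g x) < \<epsilon>"
  proof eventually_elim
    case (elim t)
    interpret prob_space "Q t x" using elim by (intro prob_Q) simp
    have i: "integrable (Q t x) g" using integrable_Q_bounded[of g B t x] b elim by auto
    have m: "{y. \<delta> \<le> dist y x} \<in> sets (Q t x)"
      using elim by (simp, intro borel_closed closed_Collect_le continuous_intros)
    have mi: "integrable (Q t x) (indicator {y. \<delta> \<le> dist y x} :: 'a \<Rightarrow> real)"
      using m emeasure_finite by (intro integrable_real_indicator) (simp_all add: less_top[symmetric])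
    have "S t g x - g x = (\<integral>y. g y - g x \<partial>Q t x)"
      using i elim by (simp add: S_def prob_space)
    also have "\<bar>\<dots>\<bar> \<le> (\<integral>y. \<bar>g y - g x\<bar> \<partial>Q t x)" by (rule integral_abs_bound)
    also have "\<dots> \<le> (\<integral>y. \<epsilon> / 2 + 2 * B * indicator {y. \<delta> \<le> dist y x} y \<partial>Q t x)"
    proof (rule integral_mono)
      show "integrable (Q t x) (\<lambda>y. \<epsilon> / 2 + 2 * B * indicator {y. \<delta> \<le> dist y x} y)"
        using mi by simp
      show "\<bar>g y - g x\<bar> \<le> \<epsilon> / 2 + 2 * B * indicator {y. \<delta> \<le> dist y x} y" for y
        using b[of x] b[of y] \<delta>(2)[of y] \<open>0 < \<epsilon>\<close> by (auto simp: indicator_def dist_real_def)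
    qed (use i in auto)
    also have "\<dots> = \<epsilon> / 2 + 2 * B * ?m t"
      using mi elim by (subst Bochner_Integration.integral_add) (auto simp del: integrable_indicator_iff)
    finally show ?case using elim by (simp add: dist_real_def)
  qed
qed

lemma S_zero: "g \<in> borel_measurable borel \<Longrightarrow> S 0 g x = g x"
  by (simp add: S_def initial integral_return)

text \<open>Write \<open>S (s + t) g\<close> as \<open>S s (S t g)\<close>, with the small time
  innermost: under the fixed law \<open>Q s x\<close> the integrand \<open>S t g\<close> converges
  boundedly to \<open>g\<close> by the case of time 0. For negative s the clipping makes the
  function locally constant to the right.\<close>

lemma S_right_continuous:
  assumes c: "continuous_on UNIV g" and b: "\<And>x. \<bar>g x\<bar> \<le> B"
  shows "((\<lambda>t. S t g x) \<longlongrightarrow> S s g x) (at_right s)"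
proof (cases "0 \<le> s")
  case False
  have "\<forall>\<^sub>F t in at_right s. t \<in> {s<..<0}" using False by (intro eventually_at_right_real) simp
  then have "\<forall>\<^sub>F t in at_right s. S t g x = S s g x"
    by eventually_elim (auto simp: S_def)
  then show ?thesis by (rule tendsto_eventually)
next
  case True
  have [measurable]: "g \<in> borel_measurable borel" using c by (rule borel_measurable_continuous_onI)
  interpret prob_space "Q s x" using True by (rule prob_Q)
  have "((\<lambda>t. \<integral>y. S t g y \<partial>Q s x) \<longlongrightarrow> (\<integral>y. g y \<partial>Q s x)) (at_right 0)"
  proof (rule bounded_convergence_at_right[where b = 1 and B = B])
    show "finite_measure (Q s x)" by (rule finite_measure_axioms)
  qed (use S_tendsto_0[OF c b] S_bounded[OF _ b] in
      \<open>auto intro!: borel_measurable_Q[OF True] S_measurable\<close>)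
  moreover have "\<forall>\<^sub>F t in at_right 0. (\<integral>y. S t g y \<partial>Q s x) = S (t + s) g x"
    using eventually_at_right_less
  proof eventually_elim
    case (elim t)
    then show ?case using S_add[of g B s t x] b True by (simp add: S_def add.commute)
  qed
  ultimately have "((\<lambda>t. S (t + s) g x) \<longlongrightarrow> S s g x) (at_right 0)"
    using True by (auto simp: S_def elim: Lim_transform_eventually)
  then show ?thesis by (subst at_right_to_0) (simp add: filterlim_filtermap)
qed

text \<open>Right-continuity in time allows sampling at the next grid point to the right, which
  turns the function into a limit of functions with countably many time values. The
  \<open>+ 1\<close> after the floor keeps the sample strictly to the right of s even when s is a
  grid point.\<close>

lemma S_joint_measurable:
  assumes c: "continuous_on UNIV g" and b: "\<And>x. \<bar>g x\<bar> \<le> B"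
  shows "(\<lambda>(s, x). S s g x) \<in> borel_measurable (borel \<Otimes>\<^sub>M borel)"
proof -
  have gm: "g \<in> borel_measurable borel" using c by (rule borel_measurable_continuous_onI)
  define r where "r n s = (of_int \<lfloor>s * real (Suc n)\<rfloor> + 1) / real (Suc n)" for n and s :: real
  have r: "s < r n s" "r n s \<le> s + 1 / real (Suc n)" for n s
  proof -
    have "s * real (Suc n) < of_int \<lfloor>s * real (Suc n)\<rfloor> + 1"
      "of_int \<lfloor>s * real (Suc n)\<rfloor> \<le> s * real (Suc n)" by linarith+
    then show "s < r n s" "r n s \<le> s + 1 / real (Suc n)"
      unfolding r_def by (simp_all add: field_simps del: of_nat_Suc)
  qed
  have lim: "(\<lambda>n. r n s) \<longlonglongrightarrow> s" for s
  proof (rule tendsto_sandwich[of "\<lambda>_. s" _ _ "\<lambda>n. s + 1 / real (Suc n)"])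
    show "(\<lambda>n. s + 1 / real (Suc n)) \<longlonglongrightarrow> s"
      using tendsto_add[OF tendsto_const LIMSEQ_inverse_real_of_nat, of s] by (simp add: inverse_eq_divide)
  qed (use r in \<open>auto intro!: always_eventually less_imp_le\<close>)
  show ?thesis
  proof (rule borel_measurable_LIMSEQ_real)
    fix p :: "real \<times> 'a" obtain s x where p: "p = (s, x)" by (cases p)
    have "filterlim (\<lambda>n. r n s) (at_right s) sequentially"
      by (rule tendsto_imp_filterlim_at_right[OF lim]) (simp add: r(1))
    from filterlim_compose[OF S_right_continuous[OF c b] this]
    show "(\<lambda>n. case p of (s, x) \<Rightarrow> S (r n s) g x) \<longlonglongrightarrow> (case p of (s, x) \<Rightarrow> S s g x)"
      by (simp add: p)
  next
    fix n
    have "(\<lambda>p :: real \<times> 'a. S ((of_int \<lfloor>fst p * real (Suc n)\<rfloor> + 1) / real (Suc n)) g (snd p))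
        \<in> borel_measurable (borel \<Otimes>\<^sub>M borel)"
    proof (rule measurable_compose_countable[where f = "\<lambda>i p. S ((of_int i + 1) / real (Suc n)) g (snd p)"
          and g = "\<lambda>p. \<lfloor>fst p * real (Suc n)\<rfloor>"])
      show "(\<lambda>p. S ((of_int i + 1) / real (Suc n)) g (snd p)) \<in> borel_measurable (borel \<Otimes>\<^sub>M borel)" for i
        by (rule measurable_compose[OF measurable_snd S_measurable[OF gm]])
    qed measurable
    then show "(\<lambda>p. case p of (s, x) \<Rightarrow> S (r n s) g x) \<in> borel_measurable (borel \<Otimes>\<^sub>M borel)"
      by (simp add: r_def case_prod_beta')
  qed
qed

end

section \<open>Time averages of the semigroup\<close>

context markov_kernel_semigroup
begin

text \<open>The Henstock-Kurzweil integral serves the differentiation in t; its Lebesgue form in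
  \<open>time_integral_eq_lebesgue\<close> serves measurability and Fubini.\<close>

definition time_integral :: "real \<Rightarrow> ('a \<Rightarrow> real) \<Rightarrow> real \<Rightarrow> 'a \<Rightarrow> real" where
  "time_integral h g t x = integral {t..t + h} (\<lambda>s. S s g x)"

context
  fixes g :: "'a \<Rightarrow> real" and B h :: real
  assumes g: "continuous_on UNIV g" and bound: "\<And>x. \<bar>g x\<bar> \<le> B" and h: "0 < h"
begin

private lemma gm: "g \<in> borel_measurable borel"
  using g by (rule borel_measurable_continuous_onI)

private lemma B_nonneg: "0 \<le> B"
  using bound[of undefined] by linarith

lemma S_set_integrable: "set_integrable lborel {a..b} (\<lambda>s. S s g x)"
proof -
  have [measurable]: "(\<lambda>s. S s g x) \<in> borel_measurable borel"
    using measurable_compose[OF _ S_joint_measurable[OF g bound], of "\<lambda>s. (s, x)" borel] by simp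
  show ?thesis unfolding set_integrable_def
  proof (rule Bochner_Integration.integrable_bound)
    show "integrable lborel (\<lambda>s. B * indicator {a..b} s)"
      by (intro integrable_mult_right integrable_real_indicator) (auto simp: emeasure_lborel_Icc_eq)
  qed (use S_bounded[OF gm bound] B_nonneg in \<open>auto simp: indicator_def\<close>)
qed

lemma S_integrable_on: "(\<lambda>s. S s g x) integrable_on {a..b}"
  using set_borel_integral_eq_integral(1)[OF S_set_integrable] .

lemma time_integral_eq_lebesgue:
  "time_integral h g t x = (\<integral>s. indicator {t..t + h} s * S s g x \<partial>lborel)"
  using set_borel_integral_eq_integral(2)[OF S_set_integrable]
  by (simp add: time_integral_def set_lebesgue_integral_def)

lemma time_integral_measurable: "time_integral h g t \<in> borel_measurable borel"
proof -
  have "(\<lambda>(x, s). S s g x) \<in> borel_measurable (borel \<Otimes>\<^sub>M borel)"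
    using measurable_pair_swap[OF S_joint_measurable[OF g bound]] by (simp add: case_prod_beta')
  then have "(\<lambda>x. \<integral>s. indicator {t..t + h} s * S s g x \<partial>lborel) \<in> borel_measurable borel"
    by (intro lborel.borel_measurable_lebesgue_integral) (simp add: case_prod_beta')
  then show ?thesis by (simp add: time_integral_eq_lebesgue[abs_def])
qed

private lemma integral_S_bound:
  assumes "a \<le> b"
  shows "\<bar>integral {a..b} (\<lambda>s. S s g x)\<bar> \<le> B * (b - a)"
  using has_integral_bound_real[OF B_nonneg finite.emptyI integrable_integral[OF S_integrable_on], of a b x]
    assms S_bounded[OF gm bound]
  by simp

lemma time_integral_bounded: "\<bar>time_integral h g t x\<bar> \<le> B * h"
  using integral_S_bound[of t "t + h" x] h by (simp add: time_integral_def)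

private lemma time_integral_eq_diff:
  assumes "0 \<le> t"
  shows "time_integral h g t x = integral {0..t + h} (\<lambda>s. S s g x) - integral {0..t} (\<lambda>s. S s g x)"
  using Henstock_Kurzweil_Integration.integral_combine[of 0 t "t + h" "\<lambda>s. S s g x"] assms h S_integrable_on
  by (simp add: time_integral_def)

text \<open>Moving the window from t to u adds a piece of length u - t at the right end and removes
  one at the left end, each contributing at most \<open>B * (u - t)\<close>. The bound is uniform in
  x, so it dominates difference quotients under \<beta>.\<close>

lemma time_integral_lipschitz:
  assumes "0 \<le> t" "t \<le> u"
  shows "\<bar>time_integral h g u x - time_integral h g t x\<bar> \<le> 2 * B * (u - t)"
proof -
  have d: "integral {0..b} (\<lambda>s. S s g x) - integral {0..a} (\<lambda>s. S s g x) = integral {a..b} (\<lambda>s. S s g x)"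
    if "0 \<le> a" "a \<le> b" for a b
    using Henstock_Kurzweil_Integration.integral_combine[of 0 a b "\<lambda>s. S s g x"] that S_integrable_on
    by simp
  have "time_integral h g u x - time_integral h g t x
      = integral {t + h..u + h} (\<lambda>s. S s g x) - integral {t..u} (\<lambda>s. S s g x)"
    using assms h d[of "t + h" "u + h"] d[of t u] by (simp add: time_integral_eq_diff)
  then show ?thesis
    using integral_S_bound[of "t + h" "u + h" x] integral_S_bound[of t u x] assms by (simp add: algebra_simps)
qed

lemma time_integral_derivative:
  assumes "0 \<le> t"
  shows "((\<lambda>r. (time_integral h g (t + r) x - time_integral h g t x) / r)
    \<longlongrightarrow> S (t + h) g x - S t g x) (at_right 0)"
proof -
  let ?I = "\<lambda>u. integral {0..u} (\<lambda>s. S s g x)"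
  have q: "((\<lambda>r. (?I (u + r) - ?I u) / r) \<longlongrightarrow> S u g x) (at_right 0)" if "0 \<le> u" for u
    by (rule integral_difference_quotient_at_right[where b = "u + 1"])
      (use that in \<open>auto intro: S_integrable_on S_right_continuous[OF g bound]\<close>)
  have "((\<lambda>r. (?I (t + h + r) - ?I (t + h)) / r - (?I (t + r) - ?I t) / r)
      \<longlongrightarrow> S (t + h) g x - S t g x) (at_right 0)"
    using assms h by (intro tendsto_diff q) auto
  moreover have "\<forall>\<^sub>F r in at_right 0. (?I (t + h + r) - ?I (t + h)) / r - (?I (t + r) - ?I t) / r =
      (time_integral h g (t + r) x - time_integral h g t x) / r"
    using eventually_at_right_less
  proof eventually_elim
    case (elim r)
    then show ?case using assms by (simp add: time_integral_eq_diff diff_divide_distrib add_ac)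
  qed
  ultimately show ?thesis by (rule Lim_transform_eventually)
qed

text \<open>Fubini moves \<open>S r\<close> under the time integral, where the semigroup law shifts
  the integrand by r. Difference quotients of the semigroup at an average thereby become difference
  quotients in the window position.\<close>

lemma S_time_integral:
  assumes r: "0 \<le> r" and t: "0 \<le> t"
  shows "S r (time_integral h g t) x = time_integral h g (r + t) x"
proof -
  interpret Q: prob_space "Q r x" using r by (rule prob_Q)
  interpret P: pair_sigma_finite lborel "Q r x" ..
  have sets: "sets (lborel \<Otimes>\<^sub>M Q r x) = sets (borel \<Otimes>\<^sub>M borel)"
    by (rule sets_pair_measure_cong) (simp_all add: r)
  have m: "(\<lambda>(s, y). indicator {t..t + h} s * S s g y) \<in> borel_measurable (lborel \<Otimes>\<^sub>M Q r x)"
    using S_joint_measurable[OF g bound] unfolding measurable_cong_sets[OF sets refl]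
    by (simp add: case_prod_beta')
  have "integrable (lborel \<Otimes>\<^sub>M Q r x) (\<lambda>(s, y). indicator {t..t + h} s * S s g y)"
  proof (rule integrableI_bounded_set[where A = "{t..t + h} \<times> UNIV" and B = B])
    show "emeasure (lborel \<Otimes>\<^sub>M Q r x) ({t..t + h} \<times> UNIV) < \<infinity>"
      using h r Q.emeasure_space_1 by (subst Q.emeasure_pair_measure_Times) auto
    show "{t..t + h} \<times> UNIV \<in> sets (lborel \<Otimes>\<^sub>M Q r x)" using r by (intro pair_measureI) simp_all
    show "AE p in lborel \<Otimes>\<^sub>M Q r x. p \<in> {t..t + h} \<times> UNIV \<longrightarrow>
        norm (case p of (s, y) \<Rightarrow> indicator {t..t + h} s * S s g y) \<le> B"
      by (rule AE_I2) (clarsimp simp: S_bounded[OF gm bound])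
    show "AE p in lborel \<Otimes>\<^sub>M Q r x. p \<notin> {t..t + h} \<times> UNIV \<longrightarrow>
        (case p of (s, y) \<Rightarrow> indicator {t..t + h} s * S s g y) = 0"
      by (rule AE_I2) (clarsimp simp: indicator_def)
  qed (rule m)
  then have "(\<integral>y. (\<integral>s. indicator {t..t + h} s * S s g y \<partial>lborel) \<partial>Q r x)
      = (\<integral>s. (\<integral>y. indicator {t..t + h} s * S s g y \<partial>Q r x) \<partial>lborel)"
    by (rule P.Fubini_integral)
  \<comment> \<open>The form \<open>r + 1 * s\<close> prepares the affine substitution with slope
    1.\<close>
  also have "\<dots> = (\<integral>s. indicator {r + t..r + t + h} (r + 1 * s) * S (r + 1 * s) g x \<partial>lborel)"
  proof (rule Bochner_Integration.integral_cong[OF refl])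
    fix s
    show "(\<integral>y. indicator {t..t + h} s * S s g y \<partial>Q r x)
        = indicator {r + t..r + t + h} (r + 1 * s) * S (r + 1 * s) g x"
    \<comment> \<open>Below t both indicators vanish. From t on, s is nonnegative, as the semigroup
      law requires: at negative times the clipping would break it.\<close>
    proof (cases "t \<le> s")
      case True
      then have "S (r + s) g x = (\<integral>y. S s g y \<partial>Q r x)"
        using S_add[OF gm bound r, of s x] r t by (simp add: S_def)
      then show ?thesis by (simp add: indicator_def)
    qed (simp add: indicator_def)
  qed
  also have "\<dots> = (\<integral>u. indicator {r + t..r + t + h} u * S u g x \<partial>lborel)"
    using lborel_integral_real_affine[of 1 "\<lambda>u. indicator {r + t..r + t + h} u * S u g x" r] by simp
  finally show ?thesis using r by (simp add: S_def[of r] time_integral_eq_lebesgue)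
qed

end

end

text \<open>The quantity \<open>- (\<integral>x. f x * l x \<partial>\<beta>)\<close> is the
  Dirichlet form. The inequality is asked only for bounded \<open>f\<close> with bounded derivative
  \<open>l\<close>, a class in which all integrals exist and which contains the time
  averages.\<close>

locale poincare_semigroup = markov_kernel_semigroup Q \<beta>
  for Q :: "real \<Rightarrow> 'a::metric_space \<Rightarrow> 'a measure" and \<beta> +
  fixes C :: real
  assumes C: "0 < C"
    and poincare: "\<And>f l B. f \<in> borel_measurable borel \<Longrightarrow> l \<in> borel_measurable borel \<Longrightarrow>
      (\<And>x. \<bar>f x\<bar> \<le> B) \<Longrightarrow> (\<And>x. \<bar>l x\<bar> \<le> B) \<Longrightarrow>
      (\<And>x. ((\<lambda>t. (S t f x - f x) / t) \<longlongrightarrow> l x) (at_right 0)) \<Longrightarrow>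
      (\<integral>x. (f x - (\<integral>y. f y \<partial>\<beta>))\<^sup>2 \<partial>\<beta>) \<le> - C * (\<integral>x. f x * l x \<partial>\<beta>)"
begin

text \<open>Gronwall's argument with right derivatives. By invariance the mean \<open>m\<close> does
  not depend on time, so the variance along the orbit is the function \<open>W\<close>, whose
  continuity comes from the Lipschitz bound on windows.\<close>

lemma variance_time_integral_decay:
  fixes g :: "'a \<Rightarrow> real"
  assumes g: "continuous_on UNIV g" and bound: "\<And>x. \<bar>g x\<bar> \<le> B" and h: "0 < h" and T: "0 \<le> T"
  shows "(\<integral>x. (S T (time_integral h g 0) x - (\<integral>y. time_integral h g 0 y \<partial>\<beta>))\<^sup>2 \<partial>\<beta>)
    \<le> exp (- 2 * T / C) * (\<integral>x. (time_integral h g 0 x - (\<integral>y. time_integral h g 0 y \<partial>\<beta>))\<^sup>2 \<partial>\<beta>)"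
proof -
  interpret \<beta>: prob_space \<beta> by (rule prob_\<beta>)
  have gm: "g \<in> borel_measurable borel" using g by (rule borel_measurable_continuous_onI)
  have B: "0 \<le> B" using bound[of undefined] by linarith
  define A where "A = time_integral h g"
  define m where "m = (\<integral>y. A 0 y \<partial>\<beta>)"
  define l where "l t x = S (t + h) g x - S t g x" for t x
  have Am: "A t \<in> borel_measurable borel" for t
    unfolding A_def by (rule time_integral_measurable[OF g bound h])
  have Ab: "\<bar>A t x\<bar> \<le> B * h" for t x
    unfolding A_def by (rule time_integral_bounded[OF g bound h])
  have lm: "l t \<in> borel_measurable borel" for t
    unfolding l_def using S_measurable[OF gm] by simp
  have lb: "\<bar>l t x\<bar> \<le> 2 * B" for t x
    unfolding l_def using S_bounded[OF gm bound, of "t + h" x] S_bounded[OF gm bound, of t x] by linarith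
  have SA: "S r (A t) x = A (r + t) x" if "0 \<le> r" "0 \<le> t" for r t x
    unfolding A_def by (rule S_time_integral[OF g bound h that])
  have Ai: "integrable \<beta> (A t)" for t by (rule integrable_\<beta>_bounded[OF Am Ab])
  have li: "integrable \<beta> (l t)" for t by (rule integrable_\<beta>_bounded[OF lm lb])
  have mA: "(\<integral>x. A t x \<partial>\<beta>) = m" if "0 \<le> t" for t
    using integral_S_\<beta>(2)[OF Am Ai that, of 0] SA[OF that, of 0] by (simp add: m_def)
  have mb: "\<bar>m\<bar> \<le> B * h"
  proof -
    have "\<bar>m\<bar> \<le> (\<integral>x. \<bar>A 0 x\<bar> \<partial>\<beta>)" unfolding m_def by (rule integral_abs_bound)
    also have "\<dots> \<le> (\<integral>x. B * h \<partial>\<beta>)" using Ai Ab by (intro integral_mono) auto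
    finally show ?thesis using \<beta>.prob_space by simp
  qed
  have Amb: "\<bar>A t x - m\<bar> \<le> 2 * (B * h)" for t x using Ab[of t x] mb by linarith
  \<comment> \<open>By invariance the derivative has mean 0, which removes the cross term with
    \<open>m\<close> when \<open>W\<close> is differentiated.\<close>
  have ml: "(\<integral>x. l t x \<partial>\<beta>) = 0" if "0 \<le> t" for t
  proof -
    have "integrable \<beta> g" by (rule integrable_\<beta>_bounded[OF gm bound])
    from integral_S_\<beta>(1,2)[OF gm this] that h show ?thesis by (simp add: l_def)
  qed
  define W where "W t = (\<integral>x. (A t x - m)\<^sup>2 \<partial>\<beta>)" for t
  have iW: "integrable \<beta> (\<lambda>x. (A t x - m)\<^sup>2)" for t
  proof (rule integrable_\<beta>_bounded[where B = "(2 * (B * h))\<^sup>2"])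
    show "\<bar>(A t x - m)\<^sup>2\<bar> \<le> (2 * (B * h))\<^sup>2" for x
      using power_mono[OF Amb[of t x], of 2] by simp
  qed (use Am in measurable)
  have iAl: "integrable \<beta> (\<lambda>x. A t x * l t x)" for t
  proof (rule integrable_\<beta>_bounded[where B = "B * h * (2 * B)"])
    show "\<bar>A t x * l t x\<bar> \<le> B * h * (2 * B)" for x
      unfolding abs_mult using Ab lb B h by (intro mult_mono) auto
  qed (use Am lm in measurable)
  \<comment> \<open>The factorisation isolates the difference quotient of \<open>A\<close> from a
    bounded factor; it yields both the limit and the domination needed to differentiate under the
    integral.\<close>
  have diff_squares: "(A u x - m)\<^sup>2 - (A t x - m)\<^sup>2 = (A u x - A t x) * ((A u x - m) + (A t x - m))"
    for t u x by (simp add: power2_eq_square algebra_simps)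
  have diff2: "\<bar>(A u x - m)\<^sup>2 - (A t x - m)\<^sup>2\<bar> \<le> 8 * B\<^sup>2 * h * (u - t)" if "0 \<le> t" "t \<le> u" for t u x
  proof -
    \<comment> \<open>The Lipschitz constant \<open>2 * B\<close> of the window times the bound
      \<open>4 * (B * h)\<close> on the sum of the centred values gives the constant 8.\<close>
    have "\<bar>(A u x - m)\<^sup>2 - (A t x - m)\<^sup>2\<bar> \<le> (2 * B * (u - t)) * (4 * (B * h))"
      unfolding diff_squares abs_mult
    proof (rule mult_mono)
      show "\<bar>A u x - A t x\<bar> \<le> 2 * B * (u - t)"
        unfolding A_def by (rule time_integral_lipschitz[OF g bound h that])
      show "\<bar>(A u x - m) + (A t x - m)\<bar> \<le> 4 * (B * h)"
        using Amb[of u x] Amb[of t x] by linarith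
    qed (use B that in auto)
    then show ?thesis by (simp add: power2_eq_square algebra_simps)
  qed
  have W_lip: "\<bar>W u - W t\<bar> \<le> 8 * B\<^sup>2 * h * (u - t)" if "0 \<le> t" "t \<le> u" for t u
  proof -
    have "W u - W t = (\<integral>x. (A u x - m)\<^sup>2 - (A t x - m)\<^sup>2 \<partial>\<beta>)" unfolding W_def using iW by simp
    also have "\<bar>\<dots>\<bar> \<le> (\<integral>x. \<bar>(A u x - m)\<^sup>2 - (A t x - m)\<^sup>2\<bar> \<partial>\<beta>)" by (rule integral_abs_bound)
    also have "\<dots> \<le> (\<integral>x. 8 * B\<^sup>2 * h * (u - t) \<partial>\<beta>)"
      using iW diff2[OF that] by (intro integral_mono) auto
    finally show ?thesis using \<beta>.prob_space by simp
  qed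
  have W_cont: "continuous_on {0..T} W"
  proof -
    have "(8 * B\<^sup>2 * h)-lipschitz_on {0..T} W"
    proof (rule lipschitz_onI)
      fix x y assume "x \<in> {0..T}" "y \<in> {0..T}"
      then show "dist (W x) (W y) \<le> 8 * B\<^sup>2 * h * dist x y"
        using W_lip[of x y] W_lip[of y x] by (cases "x \<le> y") (auto simp: dist_real_def abs_minus_commute)
    qed (use h in simp)
    then show ?thesis by (rule lipschitz_on_continuous_on)
  qed
  have W_deriv: "(W has_real_derivative 2 * (\<integral>x. A t x * l t x \<partial>\<beta>)) (at_right t)" if t: "0 \<le> t" for t
  proof -
    have dA: "((\<lambda>r. (A (t + r) x - A t x) / r) \<longlongrightarrow> l t x) (at_right 0)" for x
      unfolding A_def l_def by (rule time_integral_derivative[OF g bound h t])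
    have A_lim: "((\<lambda>r. A (t + r) x) \<longlongrightarrow> A t x) (at_right 0)" for x
    proof -
      have "((\<lambda>r. (A (t + r) x - A t x) / r * r + A t x) \<longlongrightarrow> l t x * 0 + A t x) (at_right 0)"
        by (intro tendsto_intros dA)
      moreover have "\<forall>\<^sub>F r in at_right 0. (A (t + r) x - A t x) / r * r + A t x = A (t + r) x"
        using eventually_at_right_less[of 0] by eventually_elim simp
      ultimately show ?thesis by (auto elim: Lim_transform_eventually)
    qed
    have "((\<lambda>r. \<integral>x. ((A (t + r) x - m)\<^sup>2 - (A t x - m)\<^sup>2) / r \<partial>\<beta>)
        \<longlongrightarrow> (\<integral>x. l t x * ((A t x - m) + (A t x - m)) \<partial>\<beta>)) (at_right 0)"
    proof (rule bounded_convergence_at_right[where b = 1 and B = "8 * B\<^sup>2 * h"])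
      fix x
      have "((\<lambda>r. (A (t + r) x - A t x) / r * ((A (t + r) x - m) + (A t x - m)))
          \<longlongrightarrow> l t x * ((A t x - m) + (A t x - m))) (at_right 0)"
        by (intro tendsto_intros dA A_lim)
      then show "((\<lambda>r. ((A (t + r) x - m)\<^sup>2 - (A t x - m)\<^sup>2) / r)
          \<longlongrightarrow> l t x * ((A t x - m) + (A t x - m))) (at_right 0)"
        by (simp add: diff_squares)
    next
      fix r x assume "0 < (r::real)"
      then show "\<bar>((A (t + r) x - m)\<^sup>2 - (A t x - m)\<^sup>2) / r\<bar> \<le> 8 * B\<^sup>2 * h"
        using diff2[of t "t + r" x] t by (simp add: field_simps)
    next
      show "finite_measure \<beta>" by (rule \<beta>.finite_measure_axioms)
      show "(\<lambda>x. ((A (t + r) x - m)\<^sup>2 - (A t x - m)\<^sup>2) / r) \<in> borel_measurable \<beta>" for r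
        unfolding borel_measurable_\<beta> using Am by measurable
    qed simp
    moreover have "(\<integral>x. l t x * ((A t x - m) + (A t x - m)) \<partial>\<beta>) = (\<integral>x. 2 * (A t x * l t x) - 2 * m * l t x \<partial>\<beta>)"
      by (rule Bochner_Integration.integral_cong) (auto simp: algebra_simps)
    moreover have "\<dots> = 2 * (\<integral>x. A t x * l t x \<partial>\<beta>)"
      using iAl[of t] li[of t] ml[OF t] by simp
    moreover have "(\<integral>x. ((A (t + r) x - m)\<^sup>2 - (A t x - m)\<^sup>2) / r \<partial>\<beta>) = (W (t + r) - W t) / r" for r
      unfolding W_def using iW by simp
    ultimately have "((\<lambda>r. (W (t + r) - W t) / r) \<longlongrightarrow> 2 * (\<integral>x. A t x * l t x \<partial>\<beta>)) (at_right 0)"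
      by (simp only:)
    then show ?thesis
      unfolding has_field_derivative_iff by (subst at_right_to_0) (simp add: filterlim_filtermap add.commute)
  qed
  have W_poincare: "W t \<le> - C * (\<integral>x. A t x * l t x \<partial>\<beta>)" if t: "0 \<le> t" for t
  proof -
    have "(\<integral>x. (A t x - (\<integral>y. A t y \<partial>\<beta>))\<^sup>2 \<partial>\<beta>) \<le> - C * (\<integral>x. A t x * l t x \<partial>\<beta>)"
    proof (rule poincare[OF Am lm, where B = "max (B * h) (2 * B)"])
      fix x
      have "\<forall>\<^sub>F r in at_right 0. (A (t + r) x - A t x) / r = (S r (A t) x - A t x) / r"
        using eventually_at_right_less[of 0] by eventually_elim (simp add: SA t add.commute)
      moreover have "((\<lambda>r. (A (t + r) x - A t x) / r) \<longlongrightarrow> l t x) (at_right 0)"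
        unfolding A_def l_def by (rule time_integral_derivative[OF g bound h t])
      ultimately show "((\<lambda>r. (S r (A t) x - A t x) / r) \<longlongrightarrow> l t x) (at_right 0)"
        by (rule Lim_transform_eventually[rotated])
    qed (use Ab lb in \<open>auto simp: le_max_iff_disj\<close>)
    then show ?thesis by (simp add: mA[OF t] W_def)
  qed
  \<comment> \<open>The integrating factor turns the differential inequality for \<open>W\<close>
    into monotonicity.\<close>
  let ?F = "\<lambda>t. exp (2 * t / C) * W t"
  have "?F T \<le> ?F 0"
  proof (rule right_derivative_nonpos_imp_le[OF T])
    show "continuous_on {0..T} ?F" using C by (intro continuous_intros W_cont) auto
    fix t :: real assume t: "0 \<le> t"
    let ?d = "2 / C * exp (2 * t / C) * W t + exp (2 * t / C) * (2 * (\<integral>x. A t x * l t x \<partial>\<beta>))"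
    have deriv: "(?F has_real_derivative ?d) (at_right t)"
      using C by (auto intro!: derivative_eq_intros W_deriv t simp: field_simps)
    have "?d = 2 / C * exp (2 * t / C) * (W t + C * (\<integral>x. A t x * l t x \<partial>\<beta>))"
      using C by (simp add: field_simps)
    also have "\<dots> \<le> 0"
      using W_poincare[OF t] C by (intro mult_nonneg_nonpos) auto
    finally show "\<exists>d\<le>0. (?F has_real_derivative d) (at_right t)"
      by (intro exI[of _ ?d] conjI deriv)
  qed
  then have "exp (2 * T / C) * W T \<le> W 0" by simp
  then have "W T \<le> W 0 / exp (2 * T / C)" by (subst pos_le_divide_eq) (simp_all add: mult.commute)
  then have "W T \<le> exp (- 2 * T / C) * W 0" by (simp add: exp_minus inverse_eq_divide)
  moreover have "S T (A 0) x = A T x" for x using SA[OF T order_refl, of x] by simp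
  ultimately show ?thesis unfolding W_def m_def A_def by (simp only:)
qed

end

section \<open>From time averages to all of L2(\<beta>)\<close>

context poincare_semigroup
begin

lemma time_average_tendsto:
  fixes g :: "'a \<Rightarrow> real"
  assumes g: "continuous_on UNIV g" and bound: "\<And>x. \<bar>g x\<bar> \<le> B"
  shows "((\<lambda>h. time_integral h g 0 x / h) \<longlongrightarrow> g x) (at_right 0)"
proof -
  have gm: "g \<in> borel_measurable borel" using g by (rule borel_measurable_continuous_onI)
  have "((\<lambda>h. (integral {0..0 + h} (\<lambda>s. S s g x) - integral {0..0} (\<lambda>s. S s g x)) / h) \<longlongrightarrow> S 0 g x) (at_right 0)"
    by (rule integral_difference_quotient_at_right[where b = 1])
      (auto intro: S_integrable_on[OF g bound zero_less_one] S_right_continuous[OF g bound])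
  then show ?thesis by (simp add: time_integral_def S_zero gm)
qed

text \<open>The averages \<open>A h\<close> converge pointwise to \<open>g\<close> by
  right-continuity at time 0 and are bounded by \<open>B\<close> uniformly in h, so bounded
  convergence passes both variances to the limit.\<close>

lemma variance_decay_continuous:
  fixes g :: "'a \<Rightarrow> real"
  assumes g: "continuous_on UNIV g" and bound: "\<And>x. \<bar>g x\<bar> \<le> B" and T: "0 \<le> T"
  shows "(\<integral>x. (S T g x - (\<integral>y. g y \<partial>\<beta>))\<^sup>2 \<partial>\<beta>)
    \<le> exp (- 2 * T / C) * (\<integral>x. (g x - (\<integral>y. g y \<partial>\<beta>))\<^sup>2 \<partial>\<beta>)"
proof -
  interpret \<beta>: prob_space \<beta> by (rule prob_\<beta>)
  have gm: "g \<in> borel_measurable borel" using g by (rule borel_measurable_continuous_onI)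
  define A where "A h x = time_integral h g 0 x / h" for h x
  define m where "m h = (\<integral>y. A h y \<partial>\<beta>)" for h
  have Am: "A h \<in> borel_measurable borel" if "0 < h" for h
    unfolding A_def using time_integral_measurable[OF g bound that] by simp
  have Ab: "\<bar>A h x\<bar> \<le> B" if "0 < h" for h x
    using time_integral_bounded[OF g bound that, of 0 x] that by (simp add: A_def field_simps)
  have A_lim: "((\<lambda>h. A h x) \<longlongrightarrow> g x) (at_right 0)" for x
    unfolding A_def by (rule time_average_tendsto[OF g bound])
  have m_lim: "(m \<longlongrightarrow> (\<integral>y. g y \<partial>\<beta>)) (at_right 0)"
    unfolding m_def
    by (rule bounded_convergence_at_right[where b = 1 and B = B])
      (use Ab A_lim Am in \<open>auto simp: borel_measurable_\<beta> intro: \<beta>.finite_measure_axioms\<close>)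
  have SA_lim: "((\<lambda>h. S T (A h) x) \<longlongrightarrow> S T g x) (at_right 0)" for x
    unfolding S_def
    by (rule bounded_convergence_at_right[where b = 1 and B = B])
      (use Ab A_lim Am T in \<open>auto intro!: borel_measurable_Q intro: prob_space.finite_measure prob_Q\<close>)
  have mb: "\<bar>m h\<bar> \<le> B" if "0 < h" for h
  proof -
    have "\<bar>m h\<bar> \<le> (\<integral>x. \<bar>A h x\<bar> \<partial>\<beta>)" unfolding m_def by (rule integral_abs_bound)
    also have "\<dots> \<le> (\<integral>x. B \<partial>\<beta>)"
      using integrable_\<beta>_bounded[OF Am[OF that] Ab[OF that]] Ab[OF that] by (intro integral_mono) auto
    finally show ?thesis using \<beta>.prob_space by simp
  qed
  have sq: "\<bar>(u - m h)\<^sup>2\<bar> \<le> (2 * B)\<^sup>2" if "0 < h" "\<bar>u\<bar> \<le> B" for h u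
  proof -
    have "\<bar>u - m h\<bar> \<le> 2 * B" using mb[OF that(1)] that(2) by linarith
    from power_mono[OF this, of 2] show ?thesis by simp
  qed
  have lim1: "((\<lambda>h. \<integral>x. (S T (A h) x - m h)\<^sup>2 \<partial>\<beta>) \<longlongrightarrow> (\<integral>x. (S T g x - (\<integral>y. g y \<partial>\<beta>))\<^sup>2 \<partial>\<beta>)) (at_right 0)"
  proof (rule bounded_convergence_at_right[where b = 1 and B = "(2 * B)\<^sup>2"])
    show "((\<lambda>h. (S T (A h) x - m h)\<^sup>2) \<longlongrightarrow> (S T g x - (\<integral>y. g y \<partial>\<beta>))\<^sup>2) (at_right 0)" for x
      by (intro tendsto_intros SA_lim m_lim)
    show "\<bar>(S T (A h) x - m h)\<^sup>2\<bar> \<le> (2 * B)\<^sup>2" if "0 < h" for h x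
      by (rule sq[OF that S_bounded[OF Am[OF that] Ab[OF that]]])
    show "(\<lambda>x. (S T (A h) x - m h)\<^sup>2) \<in> borel_measurable \<beta>" if "0 < h" for h
      unfolding borel_measurable_\<beta> using S_measurable[OF Am[OF that]] by measurable
  qed (auto intro: \<beta>.finite_measure_axioms)
  have lim2: "((\<lambda>h. \<integral>x. (A h x - m h)\<^sup>2 \<partial>\<beta>) \<longlongrightarrow> (\<integral>x. (g x - (\<integral>y. g y \<partial>\<beta>))\<^sup>2 \<partial>\<beta>)) (at_right 0)"
  proof (rule bounded_convergence_at_right[where b = 1 and B = "(2 * B)\<^sup>2"])
    show "((\<lambda>h. (A h x - m h)\<^sup>2) \<longlongrightarrow> (g x - (\<integral>y. g y \<partial>\<beta>))\<^sup>2) (at_right 0)" for x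
      by (intro tendsto_intros A_lim m_lim)
    show "\<bar>(A h x - m h)\<^sup>2\<bar> \<le> (2 * B)\<^sup>2" if "0 < h" for h x by (rule sq[OF that Ab[OF that]])
    show "(\<lambda>x. (A h x - m h)\<^sup>2) \<in> borel_measurable \<beta>" if "0 < h" for h
      unfolding borel_measurable_\<beta> using Am[OF that] by measurable
  qed (auto intro: \<beta>.finite_measure_axioms)
  \<comment> \<open>Both sides are homogeneous of degree two, so the estimate for the time integral
    passes to the average on division by \<open>h\<^sup>2\<close>.\<close>
  have le: "(\<integral>x. (S T (A h) x - m h)\<^sup>2 \<partial>\<beta>) \<le> exp (- 2 * T / C) * (\<integral>x. (A h x - m h)\<^sup>2 \<partial>\<beta>)" if h: "0 < h" for h
  proof -
    define I where "I = time_integral h g 0"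
    have eq: "S T (A h) x - m h = (S T I x - (\<integral>y. I y \<partial>\<beta>)) / h" "A h x - m h = (I x - (\<integral>y. I y \<partial>\<beta>)) / h" for x
      by (simp_all add: S_def m_def A_def I_def diff_divide_distrib)
    show ?thesis
      using divide_right_mono[OF variance_time_integral_decay[OF g bound h T], of "h\<^sup>2"]
      by (simp add: eq power_divide flip: I_def)
  qed
  show ?thesis
  proof (rule tendsto_le[OF _ _ lim1])
    show "((\<lambda>h. exp (- 2 * T / C) * (\<integral>x. (A h x - m h)\<^sup>2 \<partial>\<beta>))
      \<longlongrightarrow> exp (- 2 * T / C) * (\<integral>x. (g x - (\<integral>y. g y \<partial>\<beta>))\<^sup>2 \<partial>\<beta>)) (at_right 0)"
      by (intro tendsto_intros lim2)
    show "\<forall>\<^sub>F h in at_right 0. (\<integral>x. (S T (A h) x - m h)\<^sup>2 \<partial>\<beta>) \<le> exp (- 2 * T / C) * (\<integral>x. (A h x - m h)\<^sup>2 \<partial>\<beta>)"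
      using eventually_at_right_less[of 0] by eventually_elim (rule le)
  qed simp
qed

text \<open>Since r has mean 0, \<open>S t g\<close> may be centred before Cauchy-Schwarz is
  applied, and the square root of its variance decays like \<open>exp (- t / C)\<close>. Replacing
  \<open>f\<close> by a bounded continuous \<open>g\<close> close to it in L2 costs little, because
  \<open>S t\<close> is a contraction.\<close>

lemma bilinear_decay:
  fixes f r :: "'a \<Rightarrow> real"
  assumes f: "f \<in> borel_measurable borel" "integrable \<beta> (\<lambda>x. (f x)\<^sup>2)"
    and r: "r \<in> borel_measurable borel" "integrable \<beta> (\<lambda>x. (r x)\<^sup>2)" "(\<integral>x. r x \<partial>\<beta>) = 0"
    and t: "0 \<le> t"
  shows "\<bar>\<integral>x. r x * S t f x \<partial>\<beta>\<bar> \<le> exp (- t / C) * sqrt (\<integral>x. (r x)\<^sup>2 \<partial>\<beta>) * sqrt (\<integral>x. (f x)\<^sup>2 \<partial>\<beta>)"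
proof (rule field_le_epsilon)
  interpret \<beta>: prob_space \<beta> by (rule prob_\<beta>)
  let ?n = "\<lambda>f. sqrt (\<integral>x. (f x)\<^sup>2 \<partial>\<beta>)"
  fix \<epsilon> :: real assume "0 < \<epsilon>"
  \<comment> \<open>The approximation error enters twice, through the norm of \<open>g\<close> and
    through the remainder \<open>k\<close>, each time multiplied by the norm of r. The
    \<open>+ 1\<close> covers the case r = 0.\<close>
  define d where "d = \<epsilon> / (2 * ?n r + 1)"
  have rn: "0 \<le> ?n r" by simp
  have "0 < \<epsilon> / (2 * a + 1) \<and> \<epsilon> / (2 * a + 1) * (2 * a) \<le> \<epsilon>" if "0 \<le> a" for a :: real
    using that \<open>0 < \<epsilon>\<close> by (auto simp: field_simps)
  from this[OF rn] have d: "0 < d" "d * (2 * ?n r) \<le> \<epsilon>" unfolding d_def by blast+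
  have "L2_approximable \<beta> f"
    by (rule L2_approximable_square_integrable) (use f in \<open>auto intro: \<beta>.finite_measure_axioms\<close>)
  then obtain g where g: "continuous_on UNIV g" "bounded (range g)"
    "integrable \<beta> (\<lambda>x. (f x - g x)\<^sup>2)" "(\<integral>x. (f x - g x)\<^sup>2 \<partial>\<beta>) < d\<^sup>2"
    unfolding L2_approximable_def using d(1) by (meson zero_less_power)
  from g(2) obtain B where B: "\<And>x. \<bar>g x\<bar> \<le> B" by (auto simp: bounded_iff)
  have gm: "g \<in> borel_measurable borel" using g(1) by (rule borel_measurable_continuous_onI)
  have [measurable]: "f \<in> borel_measurable \<beta>" "g \<in> borel_measurable \<beta>" "r \<in> borel_measurable \<beta>"
    "S t f \<in> borel_measurable \<beta>" "S t g \<in> borel_measurable \<beta>"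
    using f gm r S_measurable by (auto simp: borel_measurable_\<beta>)
  define k where "k x = f x - g x" for x
  have km: "k \<in> borel_measurable borel" unfolding k_def using f gm by simp
  have k2: "integrable \<beta> (\<lambda>x. (k x)\<^sup>2)" and kd: "?n k \<le> d"
    using g(3,4) d(1) by (auto simp: k_def real_le_lsqrt)
  have [measurable]: "S t k \<in> borel_measurable \<beta>" "k \<in> borel_measurable \<beta>"
    using km S_measurable by (auto simp: borel_measurable_\<beta>)
  have sq_int: "integrable \<beta> u" if "u \<in> borel_measurable \<beta>" "integrable \<beta> (\<lambda>x. (u x)\<^sup>2)" for u :: "'a \<Rightarrow> real"
    using \<beta>.square_integrable_imp_integrable[OF that] .
  have gi: "integrable \<beta> g" and g2: "integrable \<beta> (\<lambda>x. (g x)\<^sup>2)"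
  proof -
    show "integrable \<beta> g" by (rule integrable_\<beta>_bounded[OF gm B])
    show "integrable \<beta> (\<lambda>x. (g x)\<^sup>2)"
      by (rule integrable_\<beta>_bounded[where B = "B\<^sup>2"]) (use gm power_mono[OF B, where n = 2] in auto)
  qed
  have fi: "integrable \<beta> f" and ri: "integrable \<beta> r" and ki: "integrable \<beta> k"
    using f r k2 by (auto intro!: sq_int)
  \<comment> \<open>The triangle inequality in L2, obtained by expanding the square of
    \<open>f - k\<close>.\<close>
  have gn: "?n g \<le> ?n f + d"
  proof -
    have fk: "integrable \<beta> (\<lambda>x. f x * k x)" "\<bar>\<integral>x. f x * k x \<partial>\<beta>\<bar> \<le> ?n f * ?n k"
      using Cauchy_Schwarz_integral[of f \<beta> k] f(2) k2 by auto
    have "(\<integral>x. (g x)\<^sup>2 \<partial>\<beta>) = (\<integral>x. (f x)\<^sup>2 - 2 * (f x * k x) + (k x)\<^sup>2 \<partial>\<beta>)"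
      by (rule Bochner_Integration.integral_cong) (auto simp: k_def power2_eq_square algebra_simps)
    also have "\<dots> = (?n f)\<^sup>2 - 2 * (\<integral>x. f x * k x \<partial>\<beta>) + (?n k)\<^sup>2"
      using f(2) fk(1) k2 by simp
    also have "\<dots> \<le> (?n f + ?n k)\<^sup>2" using fk(2) by (simp add: power2_sum)
    finally have "?n g \<le> ?n f + ?n k" by (intro real_le_lsqrt) (auto simp: add_nonneg_nonneg)
    with kd show ?thesis by simp
  qed
  define m where "m = (\<integral>x. g x \<partial>\<beta>)"
  have Sg: "integrable \<beta> (\<lambda>x. (S t g x)\<^sup>2)" by (rule integral_square_S_le(1)[OF gm g2 t])
  have Sk: "integrable \<beta> (\<lambda>x. (S t k x)\<^sup>2)" "(\<integral>x. (S t k x)\<^sup>2 \<partial>\<beta>) \<le> (\<integral>x. (k x)\<^sup>2 \<partial>\<beta>)"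
    by (rule integral_square_S_le[OF km k2 t])+
  have rg: "\<bar>\<integral>x. r x * S t g x \<partial>\<beta>\<bar> \<le> exp (- t / C) * ?n r * ?n g"
  proof -
    have m2: "integrable \<beta> (\<lambda>x. (S t g x - m)\<^sup>2)"
      using square_integral_add_le(1)[of "S t g" \<beta> "\<lambda>_. - m"] Sg by simp
    have i: "integrable \<beta> (\<lambda>x. r x * S t g x)"
      by (rule Cauchy_Schwarz_integral(1)) (use r(2) Sg in auto)
    have "(\<integral>x. r x * S t g x \<partial>\<beta>) = (\<integral>x. r x * (S t g x - m) \<partial>\<beta>)"
      using i ri r(3) by (simp add: right_diff_distrib)
    also have "\<bar>\<dots>\<bar> \<le> ?n r * sqrt (\<integral>x. (S t g x - m)\<^sup>2 \<partial>\<beta>)"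
      by (rule Cauchy_Schwarz_integral(2)) (use r(2) m2 in auto)
    also have "\<dots> \<le> ?n r * (exp (- t / C) * ?n g)"
    proof (intro mult_left_mono rn)
      have "(\<integral>x. (S t g x - m)\<^sup>2 \<partial>\<beta>) \<le> exp (- 2 * t / C) * (\<integral>x. (g x - m)\<^sup>2 \<partial>\<beta>)"
        unfolding m_def by (rule variance_decay_continuous[OF g(1) B t])
      also have "(\<integral>x. (g x - m)\<^sup>2 \<partial>\<beta>) = (\<integral>x. (g x)\<^sup>2 \<partial>\<beta>) - m\<^sup>2"
        unfolding m_def by (rule \<beta>.variance_eq[OF gi g2])
      also have "exp (- 2 * t / C) * ((\<integral>x. (g x)\<^sup>2 \<partial>\<beta>) - m\<^sup>2) \<le> exp (- 2 * t / C) * (\<integral>x. (g x)\<^sup>2 \<partial>\<beta>)"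
        by (intro mult_left_mono) auto
      also have "\<dots> = (exp (- t / C))\<^sup>2 * (\<integral>x. (g x)\<^sup>2 \<partial>\<beta>)"
        by (simp add: power2_eq_square flip: exp_add)
      finally show "sqrt (\<integral>x. (S t g x - m)\<^sup>2 \<partial>\<beta>) \<le> exp (- t / C) * ?n g"
        by (intro real_le_lsqrt) (auto simp: power_mult_distrib)
    qed
    finally show ?thesis by (simp add: mult_ac)
  qed
  have rk: "integrable \<beta> (\<lambda>x. r x * S t k x)" "\<bar>\<integral>x. r x * S t k x \<partial>\<beta>\<bar> \<le> ?n r * ?n k"
  proof -
    show "integrable \<beta> (\<lambda>x. r x * S t k x)"
      by (rule Cauchy_Schwarz_integral(1)) (use r(2) Sk in auto)
    have "\<bar>\<integral>x. r x * S t k x \<partial>\<beta>\<bar> \<le> ?n r * ?n (S t k)"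
      by (rule Cauchy_Schwarz_integral(2)) (use r(2) Sk in auto)
    also have "\<dots> \<le> ?n r * ?n k" using Sk(2) by (intro mult_left_mono rn) simp
    finally show "\<bar>\<integral>x. r x * S t k x \<partial>\<beta>\<bar> \<le> ?n r * ?n k" .
  qed
  have irg: "integrable \<beta> (\<lambda>x. r x * S t g x)"
    by (rule Cauchy_Schwarz_integral(1)) (use r(2) Sg in auto)
  \<comment> \<open>Additivity of \<open>S t\<close> can fail where \<open>f\<close> is not
    integrable under \<open>Q t x\<close>, hence only an almost everywhere statement.\<close>
  have "AE x in \<beta>. r x * S t f x = r x * S t g x + r x * S t k x"
    using integral_S_\<beta>(3)[OF f(1) fi t] integral_S_\<beta>(3)[OF gm gi t]
  proof eventually_elim
    case (elim x)
    then have "S t f x = S t g x + S t k x" using t by (simp add: S_def k_def)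
    then show ?case by (simp add: distrib_left)
  qed
  then have "(\<integral>x. r x * S t f x \<partial>\<beta>) = (\<integral>x. r x * S t g x + r x * S t k x \<partial>\<beta>)"
    by (intro integral_cong_AE) auto
  also have "\<dots> = (\<integral>x. r x * S t g x \<partial>\<beta>) + (\<integral>x. r x * S t k x \<partial>\<beta>)"
    using irg rk(1) by simp
  finally have "\<bar>\<integral>x. r x * S t f x \<partial>\<beta>\<bar> \<le> exp (- t / C) * ?n r * ?n g + ?n r * ?n k"
    using rg rk(2) by linarith
  also have "\<dots> \<le> exp (- t / C) * ?n r * (?n f + d) + ?n r * d"
    using gn kd rn by (intro add_mono mult_left_mono) auto
  also have "\<dots> = exp (- t / C) * ?n r * ?n f + exp (- t / C) * (?n r * d) + ?n r * d"
    by (simp add: algebra_simps)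
  also have "\<dots> \<le> exp (- t / C) * ?n r * ?n f + 1 * (?n r * d) + ?n r * d"
    using t C rn d(1) by (intro add_mono mult_right_mono) auto
  also have "\<dots> \<le> exp (- t / C) * ?n r * ?n f + \<epsilon>" using d(2) by (simp add: algebra_simps)
  finally show "\<bar>\<integral>x. r x * S t f x \<partial>\<beta>\<bar> \<le> exp (- t / C) * ?n r * ?n f + \<epsilon>" .
qed

end

section \<open>The transition kernels of the absorbed process\<close>

text \<open>Killing is encoded as extension by 0 at the cemetery: killed expectations of
  \<open>f\<close> become ordinary expectations of \<open>zero_ext c f\<close> under the law of
  \<open>X t\<close> on the whole type, where kernels have full mass.\<close>

definition zero_ext :: "'e \<Rightarrow> ('e \<Rightarrow> real) \<Rightarrow> 'e \<Rightarrow> real" where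
  "zero_ext c f y = (if y = c then 0 else f y)"

lemma zero_ext_simps [simp]: "zero_ext c f c = 0" "y \<noteq> c \<Longrightarrow> zero_ext c f y = f y"
  by (auto simp: zero_ext_def)

lemma space_state_space: "space (state_space c) = - {c}"
  by (simp add: state_space_def space_restrict_space)

lemma borel_measurable_zero_ext:
  assumes "f \<in> borel_measurable (state_space c)"
  shows "zero_ext c f \<in> borel_measurable borel"
proof -
  have "(\<lambda>x. indicator (- {c}) x *\<^sub>R f x) \<in> borel_measurable borel"
    using assms unfolding state_space_def by (subst (asm) borel_measurable_restrict_space_iff) auto
  moreover have "zero_ext c f = (\<lambda>x. indicator (- {c}) x *\<^sub>R f x)"
    by (auto simp: zero_ext_def fun_eq_iff)
  ultimately show ?thesis by simp
qed

lemma measurable_state_spaceI: "f \<in> borel \<rightarrow>\<^sub>M N \<Longrightarrow> f \<in> state_space c \<rightarrow>\<^sub>M N"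
  unfolding state_space_def by (rule measurable_restrict_space1)

context absorbed_markov_process
begin

lemma sets_P [simp]: "sets (P x) = sets M" and prob_P: "prob_space (P x)"
  using measurable_space[OF kernel, of x] by (auto simp: space_prob_algebra)

lemma space_P [simp]: "space (P x) = space M"
  by (rule sets_eq_imp_space_eq) simp

lemma borel_measurable_P: "f \<in> M \<rightarrow>\<^sub>M N \<Longrightarrow> f \<in> P x \<rightarrow>\<^sub>M N"
  by (subst measurable_cong_sets[OF sets_P refl])

text \<open>The infimum over past times reduces to the state at time t alone: a visit to c at t
  bounds the infimum by t, and conversely an infimum at most t forces \<open>X t\<close> to be c by
  absorption.\<close>

lemma less_absorption_time_iff:
  assumes "\<omega> \<in> space M" "0 \<le> t"
  shows "ereal t < absorption_time X c \<omega> \<longleftrightarrow> X t \<omega> \<noteq> c"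
proof
  assume "ereal t < absorption_time X c \<omega>"
  then show "X t \<omega> \<noteq> c"
    using assms Inf_lower[of "ereal t" "ereal ` {t. 0 \<le> t \<and> X t \<omega> = c}"]
    by (auto simp: absorption_time_def)
qed (use absorbed[OF assms] in force)

lemma alive_eq:
  assumes "space N = space M" "0 \<le> t"
  shows "alive N X c t = {\<omega> \<in> space M. X t \<omega> \<noteq> c}"
  using assms less_absorption_time_iff by (auto simp: alive_def)

lemma semigroup_integrand_eq:
  "\<omega> \<in> space M \<Longrightarrow> 0 \<le> t \<Longrightarrow> semigroup_integrand X c t f \<omega> = zero_ext c f (X t \<omega>)"
  by (simp add: semigroup_integrand_def less_absorption_time_iff zero_ext_def indicator_def)

definition K :: "real \<Rightarrow> 'e \<Rightarrow> 'e measure" where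
  "K t x = distr (P x) borel (X t)"

lemma sets_K [simp]: "sets (K t x) = sets borel" and space_K [simp]: "space (K t x) = UNIV"
  by (simp_all add: K_def)

lemma K_kernel: "0 \<le> t \<Longrightarrow> K t \<in> borel \<rightarrow>\<^sub>M prob_algebra borel"
  unfolding K_def by (rule measurable_compose[OF kernel measurable_distr_prob_space[OF state_measurable]])

lemma K_kernel_sub: "0 \<le> t \<Longrightarrow> K t \<in> borel \<rightarrow>\<^sub>M subprob_algebra borel"
  using K_kernel by (rule measurable_prob_algebraD)

lemma prob_K: "0 \<le> t \<Longrightarrow> prob_space (K t x)"
  using measurable_space[OF K_kernel, of t x] by (simp add: space_prob_algebra)

lemma borel_measurable_K: "f \<in> borel \<rightarrow>\<^sub>M N \<Longrightarrow> f \<in> K t x \<rightarrow>\<^sub>M N"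
  by (subst measurable_cong_sets[OF sets_K refl])

lemma K_eq_return:
  assumes "0 \<le> t" "AE \<omega> in P x. X t \<omega> = y"
  shows "K t x = return borel y"
proof -
  interpret prob_space "P x" by (rule prob_P)
  have "K t x = distr (P x) borel (\<lambda>_. y)"
    unfolding K_def using assms borel_measurable_P[OF state_measurable]
    by (intro distr_cong_AE) auto
  also have "\<dots> = return borel y" by (rule distr_const) simp
  finally show ?thesis .
qed

lemma K_0: "K 0 x = return borel x"
  by (rule K_eq_return) (use start in auto)

lemma K_cemetery:
  assumes "0 \<le> t"
  shows "K t c = return borel c"
proof (rule K_eq_return[OF assms])
  show "AE \<omega> in P c. X t \<omega> = c"
    using start[of c] AE_space
  proof eventually_elim
    case (elim \<omega>)
    then have "absorption_time X c \<omega> \<le> ereal 0"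
      using less_absorption_time_iff[of \<omega> 0] by (auto simp: not_less zero_ereal_def)
    also have "ereal 0 \<le> ereal t" using assms by simp
    finally show ?case using absorbed[of \<omega> t] elim assms by simp
  qed
qed

lemma subalgebra_natural_filtration: "subalgebra (P x) (natural_filtration M X s)"
proof -
  have "{X u -` A \<inter> space M | u A. 0 \<le> u \<and> u \<le> s \<and> A \<in> sets borel} \<subseteq> sets M"
    using state_measurable by (auto intro: measurable_sets)
  then show ?thesis
    unfolding subalgebra_def natural_filtration_def
    using sets.sigma_sets_subset sets.sets_into_space
    by (subst sets_measure_of) (blast, simp add: space_measure_of_conv)
qed

text \<open>The Markov property is stated as a conditional expectation given the natural filtration;
  taking its expectation eliminates the filtration and leaves an identity between laws.\<close>

lemma K_chapman:
  assumes s: "0 \<le> s" and t: "0 \<le> t"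
  shows "K (s + t) x = K s x \<bind> K t"
proof (rule measure_eqI)
  have k: "K t \<in> K s x \<rightarrow>\<^sub>M subprob_algebra borel"
    by (rule borel_measurable_K[OF K_kernel_sub[OF t]])
  show "sets (K (s + t) x) = sets (K s x \<bind> K t)"
    by (subst sets_bind[where N = borel]) auto
  fix A assume "A \<in> sets (K (s + t) x)"
  then have A: "A \<in> sets borel" by simp
  interpret P: prob_space "P x" by (rule prob_P)
  interpret F: finite_measure_subalgebra "P x" "natural_filtration M X s"
    by unfold_locales (rule subalgebra_natural_filtration)
  have [measurable]: "X t \<in> M \<rightarrow>\<^sub>M borel" "X s \<in> M \<rightarrow>\<^sub>M borel" "X (s + t) \<in> M \<rightarrow>\<^sub>M borel" for x
    using s t by (auto intro: state_measurable)
  let ?E = "{\<omega> \<in> space M. X (s + t) \<omega> \<in> A}"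
  have E: "?E \<in> sets M" using A by measurable
  have mK: "measure (P y) {\<omega>' \<in> space M. X t \<omega>' \<in> A} = measure (K t y) A" for y
    unfolding K_def using A borel_measurable_P[OF state_measurable[OF t]]
    by (subst measure_distr) (auto simp: vimage_def Int_def conj_commute)
  have Km: "(\<lambda>y. measure (K t y) A) \<in> borel_measurable borel"
    using measurable_compose[OF K_kernel_sub[OF t] measurable_measure_subprob_algebra[OF A]] .
  have "measure (K (s + t) x) A = measure (P x) ?E"
    unfolding K_def using A s t borel_measurable_P[OF state_measurable[of "s + t"]]
    by (subst measure_distr) (auto simp: vimage_def Int_def conj_commute)
  also have "\<dots> = (\<integral>\<omega>. indicator ?E \<omega> \<partial>P x)" using E by simp
  also have "\<dots> = (\<integral>\<omega>. real_cond_exp (P x) (natural_filtration M X s) (indicator ?E) \<omega> \<partial>P x)"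
    using E by (intro F.real_cond_exp_int(2)[symmetric]) (auto simp: P.emeasure_eq_measure)
  also have "\<dots> = (\<integral>\<omega>. measure (K t (X s \<omega>)) A \<partial>P x)"
  proof (rule integral_cong_AE)
    show "AE \<omega> in P x. real_cond_exp (P x) (natural_filtration M X s) (indicator ?E) \<omega> = measure (K t (X s \<omega>)) A"
      using markov[OF s t A, of x] by (simp add: mK)
    show "(\<lambda>\<omega>. measure (K t (X s \<omega>)) A) \<in> borel_measurable (P x)"
      by (rule borel_measurable_P[OF measurable_compose[OF state_measurable[OF s] Km]])
  qed (rule borel_measurable_cond_exp2)
  also have "\<dots> = (\<integral>y. measure (K t y) A \<partial>K s x)"
    unfolding K_def[of s x] using borel_measurable_P[OF state_measurable[OF s]] Km
    by (subst integral_distr) auto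
  finally have "measure (K (s + t) x) A = (\<integral>y. measure (K t y) A \<partial>K s x)" .
  moreover have "(\<integral>\<^sup>+y. emeasure (K t y) A \<partial>K s x) = (\<integral>\<^sup>+y. ennreal (measure (K t y) A) \<partial>K s x)"
    using prob_K[OF t] by (intro nn_integral_cong finite_measure.emeasure_eq_measure prob_space.finite_measure)
  moreover have "\<dots> = ennreal (\<integral>y. measure (K t y) A \<partial>K s x)"
  proof (rule nn_integral_eq_integral)
    interpret prob_space "K s x" by (rule prob_K[OF s])
    show "integrable (K s x) (\<lambda>y. measure (K t y) A)"
      by (rule integrable_const_bound[where B = 1])
        (use Km borel_measurable_K prob_space.prob_le_1[OF prob_K[OF t]] in auto)
  qed simp
  moreover have "emeasure (K (s + t) x) A = ennreal (measure (K (s + t) x) A)"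
    using s t prob_K by (intro finite_measure.emeasure_eq_measure prob_space.finite_measure) simp
  ultimately show "emeasure (K (s + t) x) A = emeasure (K s x \<bind> K t) A"
    using emeasure_bind[OF _ k A] by simp
qed

lemma nn_integral_K_chapman:
  assumes "0 \<le> s" "0 \<le> t" "f \<in> borel_measurable borel"
  shows "(\<integral>\<^sup>+y. f y \<partial>K (s + t) x) = (\<integral>\<^sup>+y. \<integral>\<^sup>+z. f z \<partial>K t y \<partial>K s x)"
  unfolding K_chapman[OF assms(1,2)]
  by (rule nn_integral_bind[OF assms(3) borel_measurable_K[OF K_kernel_sub[OF assms(2)]]])

lemma integral_K: "0 \<le> t \<Longrightarrow> f \<in> borel_measurable borel \<Longrightarrow> (\<integral>\<omega>. f (X t \<omega>) \<partial>P x) = (\<integral>y. f y \<partial>K t x)"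
  for f :: "_ \<Rightarrow> real"
  unfolding K_def using borel_measurable_P[OF state_measurable] by (subst integral_distr) auto

lemma nn_integral_K: "0 \<le> t \<Longrightarrow> f \<in> borel_measurable borel \<Longrightarrow> (\<integral>\<^sup>+\<omega>. f (X t \<omega>) \<partial>P x) = (\<integral>\<^sup>+y. f y \<partial>K t x)"
  unfolding K_def using borel_measurable_P[OF state_measurable] by (subst nn_integral_distr) auto

lemma integrable_K: "0 \<le> t \<Longrightarrow> f \<in> borel_measurable borel \<Longrightarrow> integrable (P x) (\<lambda>\<omega>. f (X t \<omega>)) \<longleftrightarrow> integrable (K t x) f"
  for f :: "_ \<Rightarrow> real"
  unfolding K_def using borel_measurable_P[OF state_measurable] by (subst integrable_distr_eq) auto

lemma killed_semigroup_eq: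
  assumes "0 \<le> t" "f \<in> borel_measurable (state_space c)"
  shows "killed_semigroup P X c t f x = (\<integral>y. zero_ext c f y \<partial>K t x)"
    and "integrable (P x) (semigroup_integrand X c t f) \<longleftrightarrow> integrable (K t x) (zero_ext c f)"
proof -
  show "killed_semigroup P X c t f x = (\<integral>y. zero_ext c f y \<partial>K t x)"
    unfolding killed_semigroup_def using assms
    by (subst integral_K[symmetric])
      (auto simp: borel_measurable_zero_ext semigroup_integrand_eq intro!: Bochner_Integration.integral_cong)
  have "integrable (P x) (semigroup_integrand X c t f) \<longleftrightarrow> integrable (P x) (\<lambda>\<omega>. zero_ext c f (X t \<omega>))"
    using assms by (intro Bochner_Integration.integrable_cong) (auto simp: semigroup_integrand_eq)
  then show "integrable (P x) (semigroup_integrand X c t f) \<longleftrightarrow> integrable (K t x) (zero_ext c f)"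
    using assms by (simp add: integrable_K borel_measurable_zero_ext)
qed

lemma K_stochastically_continuous:
  assumes "x \<noteq> c" "0 < \<epsilon>"
  shows "((\<lambda>t. measure (K t x) {y. \<epsilon> \<le> dist y x}) \<longlongrightarrow> 0) (at_right 0)"
proof (rule Lim_transform_eventually[OF stochastically_continuous[OF assms]])
  have "{y. \<epsilon> \<le> dist y x} \<in> sets borel" by (intro borel_closed closed_Collect_le continuous_intros)
  then show "\<forall>\<^sub>F t in at_right 0. measure (P x) {\<omega> \<in> space M. \<epsilon> \<le> dist (X t \<omega>) x}
      = measure (K t x) {y. \<epsilon> \<le> dist y x}"
    using eventually_at_right_less[of 0]
    by (auto elim!: eventually_mono simp: K_def vimage_def Int_def conj_commute
        intro!: borel_measurable_P state_measurable measure_distr[symmetric, THEN trans[rotated]])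
qed

end

section \<open>The Doob transform\<close>

locale absorbed_markov_poincare = absorbed_markov_process M P X c
  for M :: "'w measure" and P :: "'e::metric_space \<Rightarrow> 'w measure" and X c +
  fixes lambda0 :: real and \<alpha> :: "'e measure" and \<eta> :: "'e \<Rightarrow> real" and C_P :: real
  assumes \<alpha>: "\<alpha> \<in> space (prob_algebra (state_space c))"
    and killed_law_\<alpha>: "\<And>t. 0 \<le> t \<Longrightarrow>
      killed_law P X c \<alpha> t = scale_measure (ennreal (exp (- lambda0 * t))) \<alpha>"
    and \<eta>_measurable: "\<eta> \<in> borel_measurable (state_space c)"
    and \<eta>_pos: "\<And>x. x \<noteq> c \<Longrightarrow> 0 < \<eta> x"
    and \<eta>_integrable: "integrable \<alpha> \<eta>" and \<eta>_integral: "(\<integral>x. \<eta> x \<partial>\<alpha>) = 1"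
    and \<eta>_eigen_integrable: "\<And>x t. x \<noteq> c \<Longrightarrow> 0 \<le> t \<Longrightarrow> integrable (P x) (semigroup_integrand X c t \<eta>)"
    and \<eta>_eigen: "\<And>x t. x \<noteq> c \<Longrightarrow> 0 \<le> t \<Longrightarrow>
      killed_semigroup P X c t \<eta> x = exp (- lambda0 * t) * \<eta> x"
    and C_P: "0 < C_P"
    and poincare_generator: "\<And>f. f \<in> borel_measurable (state_space c) \<Longrightarrow>
      (\<lambda>x. f x * \<eta> x) \<in> generator_domain P X c \<Longrightarrow>
      integrable (reweight \<eta> \<alpha>) (\<lambda>x. (f x)\<^sup>2) \<Longrightarrow>
      integrable \<alpha> (\<lambda>x. f x * generator P X c (\<lambda>y. f y * \<eta> y) x) \<Longrightarrow>
      var (reweight \<eta> \<alpha>) f \<le>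
        - C_P * (\<integral>x. f x * (lambda0 * f x * \<eta> x + generator P X c (\<lambda>y. f y * \<eta> y) x) \<partial>\<alpha>)"
begin

text \<open>The extension by 0 gives absorbed paths no weight in the Doob transform.\<close>

definition e :: "'e \<Rightarrow> real" where "e = zero_ext c \<eta>"

lemma e_measurable [measurable]: "e \<in> borel_measurable borel"
  unfolding e_def by (rule borel_measurable_zero_ext[OF \<eta>_measurable])

lemma e_c [simp]: "e c = 0" and e_pos: "x \<noteq> c \<Longrightarrow> 0 < e x" and e_eq: "x \<noteq> c \<Longrightarrow> e x = \<eta> x"
  by (simp_all add: e_def \<eta>_pos)

lemma e_nonneg [simp]: "0 \<le> e x"
  using e_pos[of x] by (cases "x = c") auto

lemma e_K_integrable: "0 \<le> t \<Longrightarrow> integrable (K t x) e"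
  using \<eta>_eigen_integrable[of x t] killed_semigroup_eq(2)[OF _ \<eta>_measurable, of t x]
  by (cases "x = c") (auto simp: K_cemetery e_def[symmetric] intro!: integrableI_bounded simp: nn_integral_return)

lemma integral_e_K: "0 \<le> t \<Longrightarrow> (\<integral>y. e y \<partial>K t x) = exp (- lambda0 * t) * e x"
  using \<eta>_eigen[of x t] killed_semigroup_eq(1)[OF _ \<eta>_measurable, of t x]
  by (cases "x = c") (auto simp: K_cemetery integral_return e_eq simp flip: e_def)

lemma nn_integral_e_K: "0 \<le> t \<Longrightarrow> (\<integral>\<^sup>+y. ennreal (e y) \<partial>K t x) = ennreal (exp (- lambda0 * t) * e x)"
  by (subst nn_integral_eq_integral) (auto simp: e_K_integrable integral_e_K)

lemma sets_\<alpha> [simp]: "sets \<alpha> = sets (state_space c)" and prob_\<alpha>: "prob_space \<alpha>"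
  using \<alpha> by (simp_all add: space_prob_algebra)

lemma space_\<alpha> [simp]: "space \<alpha> = - {c}"
  using sets_eq_imp_space_eq[OF sets_\<alpha>] by (simp add: space_state_space)

lemma measurable_\<alpha>: "f \<in> borel \<rightarrow>\<^sub>M N \<Longrightarrow> f \<in> \<alpha> \<rightarrow>\<^sub>M N"
  by (subst measurable_cong_sets[OF sets_\<alpha> refl]) (rule measurable_state_spaceI)

text \<open>The point mass at \<open>c\<close> makes \<open>Q\<close> a kernel on the whole type, as \<open>markov_kernel_semigroup\<close> requires.\<close>

definition Q :: "real \<Rightarrow> 'e \<Rightarrow> 'e measure" where
  "Q t x = (if x = c then return borel c
    else density (K t x) (\<lambda>y. ennreal (exp (lambda0 * t) * e y / e x)))"

definition \<beta> :: "'e measure" where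
  "\<beta> = distr (reweight \<eta> \<alpha>) borel (\<lambda>x. x)"

lemma Q_c: "Q t c = return borel c" by (simp add: Q_def)

lemma sets_Q [simp]: "sets (Q t x) = sets borel" by (simp add: Q_def)

text \<open>In this multiplied form there is no division in \<open>ennreal\<close>, and the identity
  also holds at c, where both sides are 0. Away from c, \<open>weight_cancel\<close> removes the
  factor.\<close>

lemma nn_integral_Q:
  assumes t: "0 \<le> t" and u: "u \<in> borel_measurable borel"
  shows "ennreal (exp (- lambda0 * t) * e x) * (\<integral>\<^sup>+y. u y \<partial>Q t x) = (\<integral>\<^sup>+y. ennreal (e y) * u y \<partial>K t x)"
proof (cases "x = c")
  case True
  have "(\<lambda>y. ennreal (e y) * u y) \<in> borel_measurable borel" using u by measurable
  then show ?thesis using True t by (simp add: K_cemetery nn_integral_return)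
next
  case False
  have [measurable]: "u \<in> borel_measurable (K t x)" "e \<in> borel_measurable (K t x)"
    using u by (auto intro: borel_measurable_K)
  have "ennreal (exp (- lambda0 * t) * e x) * (\<integral>\<^sup>+y. u y \<partial>Q t x)
      = (\<integral>\<^sup>+y. ennreal (exp (- lambda0 * t) * e x) * (ennreal (exp (lambda0 * t) * e y / e x) * u y) \<partial>K t x)"
    using False by (simp add: Q_def nn_integral_density nn_integral_cmult)
  also have "\<dots> = (\<integral>\<^sup>+y. ennreal (e y) * u y \<partial>K t x)"
  proof (rule nn_integral_cong)
    fix y
    have "exp (- lambda0 * t) * e x * (exp (lambda0 * t) * e y / e x) = e y"
      using e_pos[OF False] by (simp add: exp_minus field_simps)
    then show "ennreal (exp (- lambda0 * t) * e x) * (ennreal (exp (lambda0 * t) * e y / e x) * u y) = ennreal (e y) * u y"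
      using e_nonneg by (subst mult.assoc[symmetric], subst ennreal_mult[symmetric]) auto
  qed
  finally show ?thesis .
qed

lemma integral_Q:
  fixes f :: "'e \<Rightarrow> real"
  assumes x: "x \<noteq> c" and t: "0 \<le> t" and f: "f \<in> borel_measurable borel"
  shows "(\<integral>y. e y * f y \<partial>K t x) = exp (- lambda0 * t) * e x * (\<integral>y. f y \<partial>Q t x)"
proof -
  have "(\<integral>y. f y \<partial>Q t x) = (\<integral>y. exp (lambda0 * t) * e y / e x * f y \<partial>K t x)"
    using x f e_nonneg unfolding Q_def
    by (simp, subst integral_real_density) (auto intro!: borel_measurable_K)
  also have "\<dots> = exp (lambda0 * t) / e x * (\<integral>y. e y * f y \<partial>K t x)"
    by (subst integral_mult_right_zero[symmetric]) (simp add: mult.assoc)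
  finally show ?thesis using e_pos[OF x] by (simp add: exp_minus field_simps)
qed

lemma weight_cancel:
  assumes "x \<noteq> c" and "ennreal (exp (- lambda0 * t) * e x) * a = ennreal (exp (- lambda0 * t) * e x) * b"
  shows "a = b"
  using assms e_pos[of x] by (subst (asm) ennreal_mult_cancel_left) (auto simp: ennreal_eq_0_iff mult_le_0_iff not_le)

text \<open>Conservation of mass under the transform is exactly the eigenfunction equation for
  \<eta>.\<close>

lemma prob_Q: "0 \<le> t \<Longrightarrow> prob_space (Q t x)"
proof (cases "x = c")
  case True
  then show ?thesis by (simp add: Q_c prob_space_return)
next
  case False
  assume t: "0 \<le> t"
  have "ennreal (exp (- lambda0 * t) * e x) * (\<integral>\<^sup>+y. 1 \<partial>Q t x) = ennreal (exp (- lambda0 * t) * e x) * 1"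
    using t by (subst nn_integral_Q) (simp_all add: nn_integral_e_K)
  then have "(\<integral>\<^sup>+y. 1 \<partial>Q t x) = 1" by (rule weight_cancel[OF False])
  then show ?thesis by (intro prob_spaceI) simp
qed

lemma Q_kernel:
  assumes t: "0 \<le> t"
  shows "Q t \<in> borel \<rightarrow>\<^sub>M prob_algebra borel"
proof (rule measurable_prob_algebraI[OF prob_Q[OF t]], rule measurable_subprob_algebra)
  show "subprob_space (Q t x)" for x using prob_Q[OF t] by (rule prob_space_imp_subprob_space)
  fix A :: "'e set" assume A: "A \<in> sets borel"
  have k: "(\<lambda>x. \<integral>\<^sup>+y. ennreal (e y) * indicator A y \<partial>K t x) \<in> borel_measurable borel"
    by (rule measurable_compose[OF K_kernel_sub[OF t] nn_integral_measurable_subprob_algebra]) (use A in measurable)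
  have eq: "emeasure (Q t x) A = (if x = c then indicator A c
      else ennreal (exp (lambda0 * t) / e x) * (\<integral>\<^sup>+y. ennreal (e y) * indicator A y \<partial>K t x))" for x
  proof (cases "x = c")
    case False
    have "ennreal (exp (- lambda0 * t) * e x) * emeasure (Q t x) A
        = (\<integral>\<^sup>+y. ennreal (e y) * indicator A y \<partial>K t x)"
      using nn_integral_Q[OF t, of "indicator A" x] A by simp
    then have "ennreal (exp (lambda0 * t) / e x) * (ennreal (exp (- lambda0 * t) * e x) * emeasure (Q t x) A)
        = ennreal (exp (lambda0 * t) / e x) * (\<integral>\<^sup>+y. ennreal (e y) * indicator A y \<partial>K t x)"
      by simp
    moreover have "ennreal (exp (lambda0 * t) / e x) * ennreal (exp (- lambda0 * t) * e x) = 1"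
      using e_pos[OF False] by (subst ennreal_mult[symmetric]) (auto simp: exp_minus)
    ultimately show ?thesis using False by (simp add: mult.assoc[symmetric])
  qed (use A in \<open>simp add: Q_c\<close>)
  show "(\<lambda>x. emeasure (Q t x) A) \<in> borel_measurable borel"
    unfolding eq by (intro measurable_If) (use k in measurable)
qed simp

lemma Q_kernel_sub: "0 \<le> t \<Longrightarrow> Q t \<in> borel \<rightarrow>\<^sub>M subprob_algebra borel"
  using Q_kernel by (rule measurable_prob_algebraD)

text \<open>The densities telescope: the factor \<open>e z / e y\<close> of the second step times
  \<open>e y / e x\<close> of the first leaves \<open>e z / e x\<close>, and the exponentials
  multiply.\<close>

lemma Q_chapman:
  assumes s: "0 \<le> s" and t: "0 \<le> t"
  shows "Q (s + t) x = Q s x \<bind> Q t"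
proof (cases "x = c")
  case True
  have "return borel c \<bind> Q t = Q t c" by (rule bind_return[OF Q_kernel_sub[OF t]]) simp
  then show ?thesis using True by (simp add: Q_c)
next
  case False
  have k: "Q t \<in> Q s x \<rightarrow>\<^sub>M subprob_algebra borel"
    using Q_kernel_sub[OF t] by (subst measurable_cong_sets[OF sets_Q refl])
  have ne: "space (Q s x) \<noteq> {}" using prob_space.not_empty[OF prob_Q[OF s]] .
  show ?thesis
  proof (rule measure_eqI)
    show "sets (Q (s + t) x) = sets (Q s x \<bind> Q t)"
      using ne by (subst sets_bind[where N = borel]) auto
    fix A assume "A \<in> sets (Q (s + t) x)"
    then have A: "A \<in> sets borel" by simp
    have em: "(\<lambda>y. emeasure (Q t y) A) \<in> borel_measurable borel"
      using measurable_compose[OF Q_kernel_sub[OF t] measurable_emeasure_subprob_algebra[OF A]] .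
    have [measurable]: "(\<lambda>y. ennreal (e y) * indicator A y) \<in> borel_measurable borel" using A by measurable
    have w: "ennreal (exp (- lambda0 * r) * e y) * emeasure (Q r y) A = (\<integral>\<^sup>+z. ennreal (e z) * indicator A z \<partial>K r y)"
      if "0 \<le> r" for r y using nn_integral_Q[OF that, of "indicator A" y] A by simp
    have "ennreal (exp (- lambda0 * (s + t)) * e x) * emeasure (Q (s + t) x) A
        = (\<integral>\<^sup>+z. ennreal (e z) * indicator A z \<partial>K (s + t) x)"
      using s t by (intro w) simp
    also have "\<dots> = (\<integral>\<^sup>+y. \<integral>\<^sup>+z. ennreal (e z) * indicator A z \<partial>K t y \<partial>K s x)"
      by (rule nn_integral_K_chapman[OF s t]) measurable
    also have "\<dots> = (\<integral>\<^sup>+y. ennreal (exp (- lambda0 * t)) * (ennreal (e y) * emeasure (Q t y) A) \<partial>K s x)"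
      by (simp add: w[OF t, symmetric] ennreal_mult mult.assoc)
    also have "\<dots> = ennreal (exp (- lambda0 * t)) * (\<integral>\<^sup>+y. ennreal (e y) * emeasure (Q t y) A \<partial>K s x)"
      using em by (intro nn_integral_cmult borel_measurable_K borel_measurable_times_ennreal) auto
    also have "\<dots> = ennreal (exp (- lambda0 * t)) * (ennreal (exp (- lambda0 * s) * e x) * (\<integral>\<^sup>+y. emeasure (Q t y) A \<partial>Q s x))"
      by (simp only: nn_integral_Q[OF s em])
    also have "\<dots> = ennreal (exp (- lambda0 * (s + t)) * e x) * (\<integral>\<^sup>+y. emeasure (Q t y) A \<partial>Q s x)"
    proof -
      have "exp (- lambda0 * (s + t)) = exp (- lambda0 * t) * exp (- lambda0 * s)"
        by (subst exp_add[symmetric]) (simp add: algebra_simps)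
      then have "exp (- lambda0 * (s + t)) * e x = exp (- lambda0 * t) * (exp (- lambda0 * s) * e x)"
        by (simp only: mult.assoc)
      then show ?thesis by (simp only: ennreal_mult[OF exp_ge_zero mult_nonneg_nonneg[OF exp_ge_zero e_nonneg]] mult.assoc)
    qed
    finally have "emeasure (Q (s + t) x) A = (\<integral>\<^sup>+y. emeasure (Q t y) A \<partial>Q s x)"
      by (rule weight_cancel[OF False])
    then show "emeasure (Q (s + t) x) A = emeasure (Q s x \<bind> Q t) A"
      using emeasure_bind[OF ne k A] by simp
  qed
qed

lemma Q_0: "Q 0 x = return borel x"
proof (cases "x = c")
  case False
  show ?thesis
  proof (rule measure_eqI)
    fix A assume "A \<in> sets (Q 0 x)"
    then have A: "A \<in> sets borel" by simp
    have [measurable]: "(\<lambda>y. ennreal (e y) * indicator A y) \<in> borel_measurable borel" using A by measurable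
    have "ennreal (exp (- lambda0 * 0) * e x) * emeasure (Q 0 x) A = ennreal (exp (- lambda0 * 0) * e x) * indicator A x"
      using nn_integral_Q[of 0 "indicator A" x] A by (simp add: K_0 nn_integral_return)
    then have "emeasure (Q 0 x) A = indicator A x" by (rule weight_cancel[OF False])
    then show "emeasure (Q 0 x) A = emeasure (return borel x) A" using A by simp
  qed simp
qed (simp add: Q_c)

text \<open>
  Splitting \<open>\<eta>\<close> at height \<open>n\<close> and using the eigenfunction property up to time \<open>1\<close> makes the family
  \<open>\<eta> (X t)\<close>, \<open>t \<le> 1\<close>, uniformly integrable.
\<close>

lemma measure_Q_le:
  assumes x: "x \<noteq> c" and t: "0 \<le> t" "t \<le> 1" and A: "A \<in> sets borel" and n: "0 \<le> n"
  shows "measure (Q t x) A \<le> exp lambda0 / e x * (n * measure (K t x) A + (\<integral>y. max 0 (e y - n) \<partial>K 1 x))"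
proof -
  \<comment> \<open>The excess of \<eta> over the height \<open>n\<close>, the only unbounded
    part.\<close>
  define w where "w y = max 0 (e y - n)" for y
  have w: "w \<in> borel_measurable borel" "0 \<le> w y" "e y \<le> n + w y" "w y \<le> e y" for y
    unfolding w_def using n by (measurable, auto)
  have wi: "integrable (K 1 x) w"
    by (rule Bochner_Integration.integrable_bound[OF e_K_integrable[of 1]])
      (use w borel_measurable_K in auto)
  have t': "0 \<le> 1 - t" using t by simp
  interpret K: prob_space "K t x" using t by (intro prob_K)
  interpret Q: prob_space "Q t x" using t by (intro prob_Q)
  have wm: "(\<lambda>y. \<integral>\<^sup>+z. ennreal (w z) \<partial>K (1 - t) y) \<in> borel_measurable borel"
    by (rule measurable_compose[OF K_kernel_sub[OF t'] nn_integral_measurable_subprob_algebra]) (use w in measurable)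
  \<comment> \<open>This factor belongs to the eigenfunction equation over the remaining time
    \<open>1 - t\<close>. It turns \<open>e y\<close> into an expectation at total time 1, so that
    the excess is integrated against \<open>K 1 x\<close>, which does not depend on t.\<close>
  have "ennreal (exp (- lambda0 * (1 - t))) * (\<integral>\<^sup>+y. ennreal (e y) * indicator A y \<partial>K t x)
      = (\<integral>\<^sup>+y. ennreal (exp (- lambda0 * (1 - t))) * (ennreal (e y) * indicator A y) \<partial>K t x)"
    using A by (intro nn_integral_cmult[symmetric] borel_measurable_K borel_measurable_times_ennreal) auto
  \<comment> \<open>The indicator of \<open>A\<close> is kept for the part below \<open>n\<close>
    and bounded by 1 for the excess.\<close>
  also have "\<dots> \<le> (\<integral>\<^sup>+y. ennreal n * indicator A y + (\<integral>\<^sup>+z. ennreal (w z) \<partial>K (1 - t) y) \<partial>K t x)"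
  proof (rule nn_integral_mono)
    fix y
    interpret K': prob_space "K (1 - t) y" by (rule prob_K[OF t'])
    have "ennreal (exp (- lambda0 * (1 - t))) * ennreal (e y) = (\<integral>\<^sup>+z. ennreal (e z) \<partial>K (1 - t) y)"
      by (simp add: nn_integral_e_K[OF t'] ennreal_mult)
    also have "\<dots> \<le> (\<integral>\<^sup>+z. ennreal n + ennreal (w z) \<partial>K (1 - t) y)"
      using w n by (intro nn_integral_mono) (simp add: ennreal_plus[symmetric] del: ennreal_plus)
    also have "\<dots> = ennreal n + (\<integral>\<^sup>+z. ennreal (w z) \<partial>K (1 - t) y)"
      using w K'.emeasure_space_1 by (subst nn_integral_add) (auto intro!: borel_measurable_K)
    finally show "ennreal (exp (- lambda0 * (1 - t))) * (ennreal (e y) * indicator A y)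
        \<le> ennreal n * indicator A y + (\<integral>\<^sup>+z. ennreal (w z) \<partial>K (1 - t) y)"
      by (auto simp: indicator_def)
  qed
  also have "\<dots> = ennreal n * emeasure (K t x) A + (\<integral>\<^sup>+y. \<integral>\<^sup>+z. ennreal (w z) \<partial>K (1 - t) y \<partial>K t x)"
    using A wm by (subst nn_integral_add) (auto simp: nn_integral_cmult_indicator intro!: borel_measurable_K)
  also have "(\<integral>\<^sup>+y. \<integral>\<^sup>+z. ennreal (w z) \<partial>K (1 - t) y \<partial>K t x) = (\<integral>\<^sup>+z. ennreal (w z) \<partial>K 1 x)"
    using nn_integral_K_chapman[OF t(1) t', of "\<lambda>z. ennreal (w z)" x] w by simp
  also have "\<dots> = ennreal (\<integral>z. w z \<partial>K 1 x)" using wi w by (intro nn_integral_eq_integral) auto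
  also have "(\<integral>\<^sup>+y. ennreal (e y) * indicator A y \<partial>K t x) = ennreal (exp (- lambda0 * t) * e x) * emeasure (Q t x) A"
    using nn_integral_Q[OF t(1), of "indicator A" x] A by simp
  finally have "ennreal (exp (- lambda0 * (1 - t)) * (exp (- lambda0 * t) * e x) * measure (Q t x) A)
      \<le> ennreal (n * measure (K t x) A + (\<integral>z. w z \<partial>K 1 x))"
    using n w by (simp add: K.emeasure_eq_measure Q.emeasure_eq_measure ennreal_mult mult.assoc integral_nonneg_AE)
  then have le: "exp (- lambda0 * (1 - t)) * (exp (- lambda0 * t) * e x) * measure (Q t x) A
      \<le> n * measure (K t x) A + (\<integral>z. w z \<partial>K 1 x)"
    using n w by (subst (asm) ennreal_le_iff) (auto intro!: add_nonneg_nonneg mult_nonneg_nonneg integral_nonneg_AE)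
  have eq: "exp (- lambda0 * (1 - t)) * (exp (- lambda0 * t) * e x) = e x / exp lambda0"
  proof -
    have "exp (- lambda0 * (1 - t)) * exp (- lambda0 * t) = exp (- lambda0)"
      by (subst exp_add[symmetric]) (simp add: algebra_simps)
    then show ?thesis by (simp only: mult.assoc[symmetric]) (simp add: exp_minus field_simps)
  qed
  have "e x / exp lambda0 * measure (Q t x) A \<le> n * measure (K t x) A + (\<integral>z. w z \<partial>K 1 x)"
    using le by (simp only: eq)
  then show ?thesis using e_pos[OF x] by (simp add: w_def field_simps)
qed

text \<open>First \<open>n\<close> is chosen to make the excess term small, which is possible
  uniformly in t; then t is taken small, so that stochastic continuity of X disposes of the term
  multiplied by \<open>n\<close>.\<close>

lemma Q_stochastically_continuous:
  assumes "0 < \<epsilon>"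
  shows "((\<lambda>t. measure (Q t x) {y. \<epsilon> \<le> dist y x}) \<longlongrightarrow> 0) (at_right 0)"
proof (cases "x = c")
  case True
  have "{y. \<epsilon> \<le> dist y c} \<in> sets borel" by (intro borel_closed closed_Collect_le continuous_intros)
  then show ?thesis using True assms by (simp add: Q_c measure_return)
next
  case False
  let ?A = "{y. \<epsilon> \<le> dist y x}"
  have A: "?A \<in> sets borel" by (intro borel_closed closed_Collect_le continuous_intros)
  let ?D = "exp lambda0 / e x"
  have D: "0 < ?D" using e_pos[OF False] by simp
  have "(\<lambda>n. \<integral>y. max 0 (e y - real n) \<partial>K 1 x) \<longlonglongrightarrow> (\<integral>y. 0 \<partial>K 1 x)"
  proof (rule integral_dominated_convergence[where w = e])
    show "AE y in K 1 x. (\<lambda>n. max 0 (e y - real n)) \<longlonglongrightarrow> 0"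
    proof (rule AE_I2)
      fix y
      obtain n0 where "e y < real n0" using reals_Archimedean2 by blast
      then have "\<forall>n\<ge>n0. max 0 (e y - real n) = 0" by auto
      then show "(\<lambda>n. max 0 (e y - real n)) \<longlonglongrightarrow> 0"
        by (intro tendsto_eventually) (auto simp: eventually_sequentially)
    qed
  qed (auto intro!: borel_measurable_K e_K_integrable)
  then have E: "(\<lambda>n. \<integral>y. max 0 (e y - real n) \<partial>K 1 x) \<longlonglongrightarrow> 0" by simp
  show ?thesis
  proof (rule order_tendstoI)
    fix a :: real assume "a < 0"
    then show "\<forall>\<^sub>F t in at_right 0. a < measure (Q t x) ?A"
      by (intro always_eventually) (auto intro: less_le_trans)
  next
    fix a :: real assume a: "0 < a"
    then have "\<forall>\<^sub>F n in sequentially. (\<integral>y. max 0 (e y - real n) \<partial>K 1 x) < a / (2 * ?D)"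
      using e_pos[OF False] by (intro order_tendstoD(2)[OF E] divide_pos_pos mult_pos_pos) simp_all
    then obtain n where n: "(\<integral>y. max 0 (e y - real n) \<partial>K 1 x) < a / (2 * ?D)"
      by (auto simp: eventually_sequentially)
    have "((\<lambda>t. ?D * (real n * measure (K t x) ?A)) \<longlongrightarrow> ?D * (real n * 0)) (at_right 0)"
      by (intro tendsto_intros K_stochastically_continuous False assms)
    then have "\<forall>\<^sub>F t in at_right 0. ?D * (real n * measure (K t x) ?A) < a / 2"
      by (rule order_tendstoD(2)) (use a in simp)
    moreover have "\<forall>\<^sub>F t in at_right (0::real). t \<in> {0<..<1}" by (rule eventually_at_right_real) simp
    ultimately show "\<forall>\<^sub>F t in at_right 0. measure (Q t x) ?A < a"
    proof eventually_elim
      case (elim t)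
      have "measure (Q t x) ?A \<le> ?D * (real n * measure (K t x) ?A + (\<integral>y. max 0 (e y - real n) \<partial>K 1 x))"
        using elim A False by (intro measure_Q_le) auto
      also have "\<dots> = ?D * (real n * measure (K t x) ?A) + ?D * (\<integral>y. max 0 (e y - real n) \<partial>K 1 x)"
        by (simp add: algebra_simps)
      also have "\<dots> < a / 2 + ?D * (a / (2 * ?D))"
        using elim n D by (intro add_strict_mono mult_strict_left_mono) auto
      also have "\<dots> = a" using e_pos[OF False] by simp
      finally show ?case .
    qed
  qed
qed

end

section \<open>Invariance of \<beta> and transfer of the Poincare inequality\<close>

context absorbed_markov_poincare
begin

text \<open>The integrated form of the eigenmeasure equation for \<alpha>. Since \<open>v\<close>
  vanishes at c, restricting to the surviving paths changes nothing.\<close>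

lemma nn_integral_killed_law:
  assumes t: "0 \<le> t" and v: "v \<in> borel_measurable borel" "v c = 0"
  shows "(\<integral>\<^sup>+x. \<integral>\<^sup>+y. v y \<partial>K t x \<partial>\<alpha>) = ennreal (exp (- lambda0 * t)) * (\<integral>\<^sup>+x. v x \<partial>\<alpha>)"
proof -
  let ?N = "\<alpha> \<bind> P"
  have k: "P \<in> \<alpha> \<rightarrow>\<^sub>M subprob_algebra M"
    by (rule measurable_\<alpha>[OF measurable_prob_algebraD[OF kernel]])
  have ne: "space \<alpha> \<noteq> {}" using prob_space.not_empty[OF prob_\<alpha>] .
  have sN: "sets ?N = sets M" by (rule sets_bind[OF _ ne]) simp
  have spN: "space ?N = space M" by (rule sets_eq_imp_space_eq[OF sN])
  have XN: "X t \<in> ?N \<rightarrow>\<^sub>M borel"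
    using state_measurable[OF t] by (subst measurable_cong_sets[OF sN refl])
  have al: "alive ?N X c t = {\<omega> \<in> space M. X t \<omega> \<noteq> c}" by (rule alive_eq[OF spN t])
  have als: "alive ?N X c t \<in> sets ?N"
    unfolding al sN using measurable_sets[OF state_measurable[OF t], of "- {c}"]
    by (simp add: vimage_def Int_def conj_commute)
  have m: "X t \<in> restrict_space ?N (alive ?N X c t) \<rightarrow>\<^sub>M state_space c"
    unfolding state_space_def
    by (rule measurable_restrict_space2) (auto simp: space_restrict_space al intro: measurable_restrict_space1 XN)
  have "(\<integral>\<^sup>+x. v x \<partial>killed_law P X c \<alpha> t) = (\<integral>\<^sup>+\<omega>. v (X t \<omega>) \<partial>restrict_space ?N (alive ?N X c t))"
    unfolding killed_law_def by (rule nn_integral_distr[OF m]) (simp add: measurable_state_spaceI[OF v(1)])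
  also have "\<dots> = (\<integral>\<^sup>+\<omega>. v (X t \<omega>) * indicator (alive ?N X c t) \<omega> \<partial>?N)"
    using als by (intro nn_integral_restrict_space) (simp add: sets.Int)
  also have "\<dots> = (\<integral>\<^sup>+\<omega>. v (X t \<omega>) \<partial>?N)"
    by (rule nn_integral_cong) (auto simp: al spN indicator_def v(2))
  also have "\<dots> = (\<integral>\<^sup>+x. \<integral>\<^sup>+\<omega>. v (X t \<omega>) \<partial>P x \<partial>\<alpha>)"
    by (rule nn_integral_bind[OF measurable_compose[OF state_measurable[OF t] v(1)] k])
  also have "\<dots> = (\<integral>\<^sup>+x. \<integral>\<^sup>+y. v y \<partial>K t x \<partial>\<alpha>)"
    by (simp add: nn_integral_K[OF t v(1)])
  finally have "(\<integral>\<^sup>+x. \<integral>\<^sup>+y. v y \<partial>K t x \<partial>\<alpha>) = (\<integral>\<^sup>+x. v x \<partial>killed_law P X c \<alpha> t)" ..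
  also have "\<dots> = ennreal (exp (- lambda0 * t)) * (\<integral>\<^sup>+x. v x \<partial>\<alpha>)"
    unfolding killed_law_\<alpha>[OF t]
    by (rule nn_integral_scale_measure) (rule measurable_\<alpha>[OF v(1)])
  finally show ?thesis .
qed

lemma reweight_\<alpha>: "reweight \<eta> \<alpha> = density \<alpha> (\<lambda>x. ennreal (\<eta> x))"
  by (simp add: reweight_def \<eta>_integral)

lemma \<eta>_measurable_\<alpha>: "\<eta> \<in> borel_measurable \<alpha>"
  using \<eta>_integrable by simp

lemma sets_reweight [simp]: "sets (reweight \<eta> \<mu>) = sets \<mu>" "space (reweight \<eta> \<mu>) = space \<mu>"
  by (simp_all add: reweight_def)

lemma id_measurable: "sets N = sets (state_space c) \<Longrightarrow> (\<lambda>x. x) \<in> N \<rightarrow>\<^sub>M borel"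
  by (subst measurable_cong_sets[OF _ refl], assumption) (rule measurable_state_spaceI, simp)

lemma sets_\<beta> [simp]: "sets \<beta> = sets borel" and space_\<beta> [simp]: "space \<beta> = UNIV"
  by (simp_all add: \<beta>_def)

lemma measurable_\<beta>: "f \<in> borel \<rightarrow>\<^sub>M N \<Longrightarrow> f \<in> \<beta> \<rightarrow>\<^sub>M N"
  by (subst measurable_cong_sets[OF sets_\<beta> refl])

lemma integral_\<beta>_reweight:
  fixes f :: "'e \<Rightarrow> real"
  assumes "f \<in> borel_measurable borel"
  shows "(\<integral>x. f x \<partial>\<beta>) = (\<integral>x. f x \<partial>reweight \<eta> \<alpha>)"
    and "integrable \<beta> f \<longleftrightarrow> integrable (reweight \<eta> \<alpha>) f"
  unfolding \<beta>_def using assms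
  by (simp_all add: integral_distr integrable_distr_eq id_measurable)

lemma nn_integral_\<beta>:
  assumes "u \<in> borel_measurable borel"
  shows "(\<integral>\<^sup>+x. u x \<partial>\<beta>) = (\<integral>\<^sup>+x. ennreal (e x) * u x \<partial>\<alpha>)"
proof -
  have "(\<integral>\<^sup>+x. u x \<partial>\<beta>) = (\<integral>\<^sup>+x. ennreal (\<eta> x) * u x \<partial>\<alpha>)"
    unfolding \<beta>_def reweight_\<alpha> using assms \<eta>_measurable_\<alpha>
    by (subst nn_integral_distr) (auto simp: id_measurable measurable_\<alpha> intro!: nn_integral_density)
  also have "\<dots> = (\<integral>\<^sup>+x. ennreal (e x) * u x \<partial>\<alpha>)"
    by (rule nn_integral_cong) (simp add: e_eq)
  finally show ?thesis .
qed

lemma integral_\<beta>: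
  fixes f :: "'e \<Rightarrow> real"
  assumes "f \<in> borel_measurable borel"
  shows "(\<integral>x. f x \<partial>\<beta>) = (\<integral>x. \<eta> x * f x \<partial>\<alpha>)"
    and "integrable \<beta> f \<longleftrightarrow> integrable \<alpha> (\<lambda>x. \<eta> x * f x)"
proof -
  have f: "f \<in> borel_measurable \<alpha>" using assms by (rule measurable_\<alpha>)
  have nn: "AE x in \<alpha>. 0 \<le> \<eta> x" by (rule AE_I2) (use \<eta>_pos in \<open>auto simp: less_imp_le\<close>)
  show "(\<integral>x. f x \<partial>\<beta>) = (\<integral>x. \<eta> x * f x \<partial>\<alpha>)"
    unfolding integral_\<beta>_reweight(1)[OF assms] reweight_\<alpha>
    by (rule integral_real_density[OF \<eta>_measurable_\<alpha> nn f])
  show "integrable \<beta> f \<longleftrightarrow> integrable \<alpha> (\<lambda>x. \<eta> x * f x)"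
    unfolding integral_\<beta>_reweight(2)[OF assms] reweight_\<alpha>
    by (rule integrable_real_density[OF \<eta>_measurable_\<alpha> nn f])
qed

lemma prob_\<beta>: "prob_space \<beta>"
proof (rule prob_spaceI)
  have "(\<integral>\<^sup>+x. 1 \<partial>\<beta>) = (\<integral>\<^sup>+x. ennreal (\<eta> x) \<partial>\<alpha>)"
    by (subst nn_integral_\<beta>) (auto intro!: nn_integral_cong simp: e_eq)
  also have "\<dots> = ennreal (\<integral>x. \<eta> x \<partial>\<alpha>)"
    by (rule nn_integral_eq_integral[OF \<eta>_integrable]) (rule AE_I2, use \<eta>_pos in \<open>auto simp: less_imp_le\<close>)
  finally show "emeasure \<beta> (space \<beta>) = 1" by (simp add: \<eta>_integral)
qed

text \<open>Weighting by \<eta> turns \<open>Q t\<close> back into the killed kernel with a factor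
  \<open>exp (lambda0 * t)\<close>, and the eigenmeasure equation for \<alpha> supplies the inverse
  factor.\<close>

lemma \<beta>_invariant:
  assumes t: "0 \<le> t"
  shows "\<beta> \<bind> Q t = \<beta>"
proof (rule measure_eqI)
  have k: "Q t \<in> \<beta> \<rightarrow>\<^sub>M subprob_algebra borel" by (rule measurable_\<beta>[OF Q_kernel_sub[OF t]])
  show s: "sets (\<beta> \<bind> Q t) = sets \<beta>" by (subst sets_bind[where N = borel]) auto
  fix A assume "A \<in> sets (\<beta> \<bind> Q t)"
  then have A: "A \<in> sets borel" using s by simp
  let ?c = "ennreal (exp (- lambda0 * t))"
  have em: "(\<lambda>y. emeasure (Q t y) A) \<in> borel_measurable borel"
    using measurable_compose[OF Q_kernel_sub[OF t] measurable_emeasure_subprob_algebra[OF A]] .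
  have am: "(\<lambda>y. ennreal (e y) * indicator A y) \<in> borel_measurable borel"
    using A by (intro borel_measurable_times_ennreal) auto
  have "?c * (\<integral>\<^sup>+x. emeasure (Q t x) A \<partial>\<beta>) = (\<integral>\<^sup>+x. ?c * (ennreal (e x) * emeasure (Q t x) A) \<partial>\<alpha>)"
    unfolding nn_integral_\<beta>[OF em]
    by (rule nn_integral_cmult[symmetric])
      (intro borel_measurable_times_ennreal measurable_\<alpha>[OF em] measurable_\<alpha>; measurable)
  also have "\<dots> = (\<integral>\<^sup>+x. \<integral>\<^sup>+y. ennreal (e y) * indicator A y \<partial>K t x \<partial>\<alpha>)"
  proof (rule nn_integral_cong)
    fix x
    show "?c * (ennreal (e x) * emeasure (Q t x) A) = (\<integral>\<^sup>+y. ennreal (e y) * indicator A y \<partial>K t x)"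
      using nn_integral_Q[OF t, of "indicator A" x] A by (simp add: ennreal_mult mult.assoc)
  qed
  also have "\<dots> = ?c * (\<integral>\<^sup>+x. ennreal (e x) * indicator A x \<partial>\<alpha>)"
    by (rule nn_integral_killed_law[OF t am]) simp
  also have "(\<integral>\<^sup>+x. ennreal (e x) * indicator A x \<partial>\<alpha>) = emeasure \<beta> A"
    using nn_integral_\<beta>[of "indicator A"] A by simp
  finally have "(\<integral>\<^sup>+x. emeasure (Q t x) A \<partial>\<beta>) = emeasure \<beta> A"
    by (subst (asm) ennreal_mult_cancel_left) auto
  then show "emeasure (\<beta> \<bind> Q t) A = emeasure \<beta> A"
    using emeasure_bind[OF _ k A] by simp
qed

sublocale doob: markov_kernel_semigroup Q \<beta>
proof
  show "\<beta> \<in> space (prob_algebra borel)" by (simp add: space_prob_algebra prob_\<beta>)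
qed (use Q_kernel Q_0 Q_chapman Q_stochastically_continuous \<beta>_invariant in auto)

lemma killed_semigroup_mult_\<eta>:
  assumes x: "x \<noteq> c" and t: "0 \<le> t" and f: "f \<in> borel_measurable borel"
  shows "killed_semigroup P X c t (\<lambda>y. f y * \<eta> y) x = exp (- lambda0 * t) * \<eta> x * doob.S t f x"
proof -
  have m: "(\<lambda>y. f y * \<eta> y) \<in> borel_measurable (state_space c)"
    using measurable_state_spaceI[OF f] \<eta>_measurable by measurable
  have "zero_ext c (\<lambda>y. f y * \<eta> y) = (\<lambda>y. e y * f y)"
    by (auto simp: zero_ext_def e_eq fun_eq_iff)
  then show ?thesis
    using killed_semigroup_eq(1)[OF t m, of x] integral_Q[OF x t f] x t
    by (simp add: doob.S_def e_eq)
qed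

lemma integrable_semigroup_integrand_mult_\<eta>:
  assumes t: "0 \<le> t" and f: "f \<in> borel_measurable borel" and b: "\<And>x. \<bar>f x\<bar> \<le> B"
  shows "integrable (P x) (semigroup_integrand X c t (\<lambda>y. f y * \<eta> y))"
proof -
  have m: "(\<lambda>y. f y * \<eta> y) \<in> borel_measurable (state_space c)"
    using measurable_state_spaceI[OF f] \<eta>_measurable by measurable
  have eq: "zero_ext c (\<lambda>y. f y * \<eta> y) = (\<lambda>y. e y * f y)"
    by (auto simp: zero_ext_def e_eq fun_eq_iff)
  have "integrable (K t x) (\<lambda>y. e y * f y)"
  proof (rule Bochner_Integration.integrable_bound[OF integrable_mult_right[OF e_K_integrable[OF t], where c = B]])
    have "e y * \<bar>f y\<bar> \<le> \<bar>B\<bar> * e y" for y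
      using mult_left_mono[OF order_trans[OF b abs_ge_self], of "e y" y] by (simp add: mult.commute)
    then show "AE y in K t x. norm (e y * f y) \<le> norm (B * e y)"
      by (intro AE_I2) (simp add: abs_mult)
  qed (use f in \<open>auto intro!: borel_measurable_K\<close>)
  then show ?thesis using killed_semigroup_eq(2)[OF t m, of x] by (simp add: eq)
qed

text \<open>The killed semigroup applied to \<open>f * \<eta>\<close> is
  \<open>exp (- lambda0 * t) * \<eta>\<close> times \<open>doob.S t f\<close>. The product rule at
  time 0 gives the generator value \<open>\<eta> x * (l x - lambda0 * f x)\<close>, so the term with
  \<open>lambda0\<close> in (P2) cancels and the Dirichlet form of \<open>Q\<close> remains.
  Boundedness of \<open>f\<close> and \<open>l\<close> provides every integrability condition of
  (P2), with constant multiples of \<eta> as bounds.\<close>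

lemma doob_poincare:
  assumes f: "f \<in> borel_measurable borel" and l: "l \<in> borel_measurable borel"
    and fb: "\<And>x. \<bar>f x\<bar> \<le> B" and lb: "\<And>x. \<bar>l x\<bar> \<le> B"
    and lim: "\<And>x. ((\<lambda>t. (doob.S t f x - f x) / t) \<longlongrightarrow> l x) (at_right 0)"
  shows "(\<integral>x. (f x - (\<integral>y. f y \<partial>\<beta>))\<^sup>2 \<partial>\<beta>) \<le> - C_P * (\<integral>x. f x * l x \<partial>\<beta>)"
proof -
  let ?g = "\<lambda>y. f y * \<eta> y"
  have fs: "f \<in> borel_measurable (state_space c)" using f by (rule measurable_state_spaceI)
  have gm: "?g \<in> borel_measurable (state_space c)" using fs \<eta>_measurable by measurable
  have exp_lim: "((\<lambda>t. (exp (- lambda0 * t) - 1) / t) \<longlongrightarrow> - lambda0) (at_right 0)"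
  proof -
    have "((\<lambda>t. exp (- lambda0 * t)) has_real_derivative - lambda0) (at 0 within {0<..})"
      by (auto intro!: derivative_eq_intros)
    then show ?thesis by (simp add: has_field_derivative_iff)
  qed
  have glim: "((\<lambda>t. (killed_semigroup P X c t ?g x - ?g x) / t) \<longlongrightarrow> \<eta> x * (l x - lambda0 * f x)) (at_right 0)"
    if x: "x \<noteq> c" for x
  proof -
    have "((\<lambda>t. exp (- lambda0 * t)) \<longlongrightarrow> exp (- lambda0 * 0)) (at_right 0)"
      by (intro tendsto_intros)
    then have "((\<lambda>t. \<eta> x * (exp (- lambda0 * t) * ((doob.S t f x - f x) / t) + f x * ((exp (- lambda0 * t) - 1) / t)))
        \<longlongrightarrow> \<eta> x * (exp (- lambda0 * 0) * l x + f x * (- lambda0))) (at_right 0)"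
      by (intro tendsto_mult tendsto_add tendsto_const lim exp_lim)
    moreover have "\<forall>\<^sub>F t in at_right 0. \<eta> x * (exp (- lambda0 * t) * ((doob.S t f x - f x) / t) + f x * ((exp (- lambda0 * t) - 1) / t))
        = (killed_semigroup P X c t ?g x - ?g x) / t"
      using eventually_at_right_less[of 0]
    proof eventually_elim
      case (elim t)
      then have "killed_semigroup P X c t ?g x = exp (- lambda0 * t) * \<eta> x * doob.S t f x"
        using killed_semigroup_mult_\<eta>[OF x _ f, of t] by simp
      then show ?case using elim by (simp add: divide_simps) (simp add: algebra_simps)
    qed
    ultimately have "((\<lambda>t. (killed_semigroup P X c t ?g x - ?g x) / t)
        \<longlongrightarrow> \<eta> x * (exp (- lambda0 * 0) * l x + f x * (- lambda0))) (at_right 0)"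
      by (rule Lim_transform_eventually)
    then show ?thesis by (simp add: algebra_simps)
  qed
  have gen: "generator P X c ?g x = \<eta> x * (l x - lambda0 * f x)" if "x \<noteq> c" for x
    unfolding generator_def by (rule tendsto_Lim[OF _ glim[OF that]]) simp
  have dom: "?g \<in> generator_domain P X c"
    unfolding generator_domain_def
  proof (intro CollectI conjI gm allI impI)
    show "\<forall>\<^sub>F t in at_right 0. integrable (P x) (semigroup_integrand X c t ?g)" for x
      using eventually_at_right_less[of 0]
      by eventually_elim (rule integrable_semigroup_integrand_mult_\<eta>[OF _ f fb], simp)
    show "\<exists>l. ((\<lambda>t. (killed_semigroup P X c t ?g x - ?g x) / t) \<longlongrightarrow> l) (at_right 0)" if "x \<noteq> c" for x
      using glim[OF that] by blast
  qed
  have B: "0 \<le> B" using fb[of c] by linarith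
  have f2: "integrable \<beta> (\<lambda>x. (f x)\<^sup>2)"
    by (rule doob.integrable_\<beta>_bounded[where B = "B\<^sup>2"]) (use f power_mono[OF fb, where n = 2] in auto)
  have gi: "integrable \<alpha> (\<lambda>x. f x * generator P X c ?g x)"
  proof -
    have "integrable \<beta> (\<lambda>x. f x * (l x - lambda0 * f x))"
    proof (rule doob.integrable_\<beta>_bounded[where B = "B * (B + \<bar>lambda0\<bar> * B)"])
      fix x
      have "\<bar>l x - lambda0 * f x\<bar> \<le> \<bar>l x\<bar> + \<bar>lambda0 * f x\<bar>" by linarith
      also have "\<dots> \<le> B + \<bar>lambda0\<bar> * B"
        using lb fb by (intro add_mono) (auto simp: abs_mult intro!: mult_left_mono)
      finally show "\<bar>f x * (l x - lambda0 * f x)\<bar> \<le> B * (B + \<bar>lambda0\<bar> * B)"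
        unfolding abs_mult using fb B by (intro mult_mono) auto
    qed (use f l in measurable)
    then have "integrable \<alpha> (\<lambda>x. \<eta> x * (f x * (l x - lambda0 * f x)))"
      using f l by (subst integral_\<beta>(2)[symmetric]) auto
    then show ?thesis
      by (rule Bochner_Integration.integrable_cong[OF refl, THEN iffD1, rotated]) (simp add: gen)
  qed
  have "var (reweight \<eta> \<alpha>) f \<le>
      - C_P * (\<integral>x. f x * (lambda0 * f x * \<eta> x + generator P X c ?g x) \<partial>\<alpha>)"
    by (rule poincare_generator[OF fs dom _ gi]) (use f2 f in \<open>simp add: integral_\<beta>_reweight(2)\<close>)
  also have "(\<integral>x. f x * (lambda0 * f x * \<eta> x + generator P X c ?g x) \<partial>\<alpha>) = (\<integral>x. \<eta> x * (f x * l x) \<partial>\<alpha>)"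
  proof (rule Bochner_Integration.integral_cong[OF refl])
    fix x assume "x \<in> space \<alpha>"
    then have "x \<noteq> c" by simp
    from gen[OF this] show "f x * (lambda0 * f x * \<eta> x + generator P X c ?g x) = \<eta> x * (f x * l x)"
      by (simp only:) (simp add: algebra_simps)
  qed
  also have "\<dots> = (\<integral>x. f x * l x \<partial>\<beta>)" using f l by (subst integral_\<beta>(1)) auto
  finally show ?thesis
    using f by (simp add: var_def integral_\<beta>_reweight(1))
qed

sublocale doob: poincare_semigroup Q \<beta> C_P
  by unfold_locales (use C_P doob_poincare in blast)+

end

section \<open>Convergence of the conditional laws\<close>

text \<open>A single point is Borel, so an arbitrary value at c does no harm. This makes
  \<open>f (X t \<omega>)\<close> measurable on all paths, including the absorbed ones.\<close>

lemma borel_measurable_state_spaceD: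
  fixes f :: "'e::metric_space \<Rightarrow> real"
  assumes "f \<in> borel_measurable (state_space c)"
  shows "f \<in> borel_measurable borel"
proof -
  have "(\<lambda>x. zero_ext c f x + f c * indicator {c} x) \<in> borel_measurable borel"
    using borel_measurable_zero_ext[OF assms] by measurable
  moreover have "f = (\<lambda>x. zero_ext c f x + f c * indicator {c} x)"
    by (auto simp: zero_ext_def fun_eq_iff)
  ultimately show ?thesis by simp
qed

context absorbed_markov_process
begin

text \<open>Conditioning is the density \<open>indicator A \<omega> / p\<close>, and the
  normalisation \<open>p\<close> is the killed expectation of the function 1. Numerator and
  denominator are thus the same functional, evaluated at \<open>f\<close> and at 1.\<close>

lemma conditional_law_integral:
  fixes f :: "'e \<Rightarrow> real"
  assumes \<mu>: "\<mu> \<in> space (prob_algebra (state_space c))" and t: "0 \<le> t"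
    and f: "f \<in> borel_measurable (state_space c)"
    and fin: "(\<integral>\<^sup>+x. \<integral>\<^sup>+y. ennreal \<bar>zero_ext c f y\<bar> \<partial>K t x \<partial>\<mu>) < \<infinity>"
    and pos: "0 < (\<integral>x. \<integral>y. zero_ext c (\<lambda>_. 1) y \<partial>K t x \<partial>\<mu>)"
  shows "integrable (conditional_law P X c \<mu> t) (\<lambda>\<omega>. f (X t \<omega>))"
    and "(\<integral>\<omega>. f (X t \<omega>) \<partial>conditional_law P X c \<mu> t) =
      (\<integral>x. \<integral>y. zero_ext c f y \<partial>K t x \<partial>\<mu>) / (\<integral>x. \<integral>y. zero_ext c (\<lambda>_. 1) y \<partial>K t x \<partial>\<mu>)"
proof -
  have s\<mu>: "sets \<mu> = sets (state_space c)" and "prob_space \<mu>"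
    using \<mu> by (auto simp: space_prob_algebra)
  interpret \<mu>: prob_space \<mu> by fact
  define N where "N = \<mu> \<bind> P"
  define A where "A = alive N X c t"
  have k': "P \<in> \<mu> \<rightarrow>\<^sub>M prob_algebra M"
    by (subst measurable_cong_sets[OF s\<mu> refl]) (rule measurable_state_spaceI[OF kernel])
  then have k: "P \<in> \<mu> \<rightarrow>\<^sub>M subprob_algebra M" by (rule measurable_prob_algebraD)
  have sN: "sets N = sets M" unfolding N_def by (rule sets_bind[OF _ \<mu>.not_empty]) simp
  have spN: "space N = space M" by (rule sets_eq_imp_space_eq[OF sN])
  have A_eq: "A = {\<omega> \<in> space M. X t \<omega> \<noteq> c}" unfolding A_def by (rule alive_eq[OF spN t])
  have AN: "A \<in> sets N"
    unfolding A_eq sN using measurable_sets[OF state_measurable[OF t], of "- {c}"]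
    by (simp add: vimage_def Int_def conj_commute)
  have Xm: "(\<lambda>\<omega>. g (X t \<omega>)) \<in> borel_measurable M" if "g \<in> borel_measurable borel" for g :: "'e \<Rightarrow> real"
    by (rule measurable_compose[OF state_measurable[OF t] that])
  have bind: "integrable N (\<lambda>\<omega>. g (X t \<omega>)) \<and> (\<integral>\<omega>. g (X t \<omega>) \<partial>N) = (\<integral>x. \<integral>y. g y \<partial>K t x \<partial>\<mu>)"
    if g: "g \<in> borel_measurable borel" and gf: "(\<integral>\<^sup>+x. \<integral>\<^sup>+y. ennreal \<bar>g y\<bar> \<partial>K t x \<partial>\<mu>) < \<infinity>" for g :: "'e \<Rightarrow> real"
  proof -
    have "(\<integral>\<^sup>+x. \<integral>\<^sup>+\<omega>. ennreal \<bar>g (X t \<omega>)\<bar> \<partial>P x \<partial>\<mu>) < \<infinity>"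
      using gf g nn_integral_K[OF t, of "\<lambda>y. ennreal \<bar>g y\<bar>"] by simp
    note ib = integral_bind_kernel[OF k Xm[OF g] \<mu>.not_empty this]
    show ?thesis unfolding N_def using ib(1,4) integral_K[OF t g] by simp
  qed
  have m1: "zero_ext c (\<lambda>_. 1) \<in> borel_measurable borel" by (rule borel_measurable_zero_ext) simp
  have fin1: "(\<integral>\<^sup>+x. \<integral>\<^sup>+y. ennreal \<bar>zero_ext c (\<lambda>_. 1) y\<bar> \<partial>K t x \<partial>\<mu>) < \<infinity>"
  proof -
    have "(\<integral>\<^sup>+x. \<integral>\<^sup>+y. ennreal \<bar>zero_ext c (\<lambda>_. 1) y\<bar> \<partial>K t x \<partial>\<mu>) \<le> (\<integral>\<^sup>+x. \<integral>\<^sup>+y. 1 \<partial>K t x \<partial>\<mu>)"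
      by (intro nn_integral_mono) (simp add: zero_ext_def)
    also have "\<dots> = (\<integral>\<^sup>+x. 1 \<partial>\<mu>)"
      using prob_space.emeasure_space_1[OF prob_K[OF t]] by simp
    also have "\<dots> < \<infinity>" using \<mu>.emeasure_space_1 by simp
    finally show ?thesis .
  qed
  have PN: "prob_space N"
    unfolding N_def by (rule prob_space_bind'[OF _ k']) (use \<open>prob_space \<mu>\<close> in \<open>simp add: space_prob_algebra\<close>)
  interpret N: prob_space N by (rule PN)
  define p where "p = measure N A"
  have "p = (\<integral>\<omega>. zero_ext c (\<lambda>_. 1) (X t \<omega>) \<partial>N)"
  proof -
    have "(\<integral>\<omega>. zero_ext c (\<lambda>_. 1) (X t \<omega>) \<partial>N) = (\<integral>\<omega>. indicator A \<omega> \<partial>N)"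
      by (rule Bochner_Integration.integral_cong) (auto simp: A_eq spN zero_ext_def indicator_def)
    then show ?thesis using AN by (simp add: p_def)
  qed
  then have p: "p = (\<integral>x. \<integral>y. zero_ext c (\<lambda>_. 1) y \<partial>K t x \<partial>\<mu>)" using bind[OF m1 fin1] by simp
  then have p0: "0 < p" using pos by simp
  have cl: "conditional_law P X c \<mu> t = density N (\<lambda>\<omega>. ennreal (indicator A \<omega> / p))"
  proof -
    have "indicator A \<omega> / emeasure N A = ennreal (indicator A \<omega> / p)" for \<omega>
      using p0 unfolding N.emeasure_eq_measure p_def[symmetric]
      by (auto simp: indicator_def divide_ennreal[symmetric])
    then show ?thesis
      unfolding conditional_law_def uniform_measure_def N_def[symmetric] A_def[symmetric] by simp
  qed
  have fX: "(\<lambda>\<omega>. f (X t \<omega>)) \<in> borel_measurable N"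
    using Xm[OF borel_measurable_state_spaceD[OF f]] by (subst measurable_cong_sets[OF sN refl])
  have w: "(\<lambda>\<omega>. indicator A \<omega> / p) \<in> borel_measurable N" using AN by measurable
  have wn: "AE \<omega> in N. 0 \<le> indicator A \<omega> / p" using p0 by (intro AE_I2) simp
  have eq: "indicator A \<omega> / p * f (X t \<omega>) = zero_ext c f (X t \<omega>) / p" if "\<omega> \<in> space N" for \<omega>
    using that by (auto simp: A_eq spN zero_ext_def indicator_def)
  note b = bind[OF borel_measurable_zero_ext[OF f] fin]
  show "integrable (conditional_law P X c \<mu> t) (\<lambda>\<omega>. f (X t \<omega>))"
    unfolding cl integrable_real_density[OF w wn fX]
    using b by (subst Bochner_Integration.integrable_cong[OF refl eq]) auto
  have "(\<integral>\<omega>. f (X t \<omega>) \<partial>conditional_law P X c \<mu> t) = (\<integral>\<omega>. zero_ext c f (X t \<omega>) / p \<partial>N)"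
    unfolding cl integral_real_density[OF w wn fX] by (rule Bochner_Integration.integral_cong[OF refl eq])
  then show "(\<integral>\<omega>. f (X t \<omega>) \<partial>conditional_law P X c \<mu> t) =
      (\<integral>x. \<integral>y. zero_ext c f y \<partial>K t x \<partial>\<mu>) / (\<integral>x. \<integral>y. zero_ext c (\<lambda>_. 1) y \<partial>K t x \<partial>\<mu>)"
    using b by (simp add: p)
qed

end

section \<open>Initial laws at finite chi-squared distance\<close>

context absorbed_markov_poincare
begin

lemma prob_reweight:
  assumes \<mu>: "\<mu> \<in> space (prob_algebra (state_space c))" and i: "integrable \<mu> \<eta>"
  shows "0 < (\<integral>x. \<eta> x \<partial>\<mu>)" and "prob_space (reweight \<eta> \<mu>)"
proof -
  have s\<mu>: "sets \<mu> = sets (state_space c)" and "prob_space \<mu>"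
    using \<mu> by (auto simp: space_prob_algebra)
  interpret \<mu>: prob_space \<mu> by fact
  have sp: "space \<mu> = - {c}" using sets_eq_imp_space_eq[OF s\<mu>] by (simp add: space_state_space)
  have nn: "AE x in \<mu>. 0 \<le> \<eta> x" by (rule AE_I2) (use \<eta>_pos sp in \<open>auto simp: less_imp_le\<close>)
  show h: "0 < (\<integral>x. \<eta> x \<partial>\<mu>)"
  proof (rule ccontr)
    assume "\<not> 0 < (\<integral>x. \<eta> x \<partial>\<mu>)"
    then have "(\<integral>x. \<eta> x \<partial>\<mu>) = 0" using integral_nonneg_AE[OF nn] by linarith
    then have "AE x in \<mu>. \<eta> x = 0" using integral_nonneg_eq_0_iff_AE[OF i nn] by simp
    then have "AE x in \<mu>. False" using AE_space
      by eventually_elim (use \<eta>_pos sp in force)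
    then show False by simp
  qed
  show "prob_space (reweight \<eta> \<mu>)"
  proof (rule prob_spaceI)
    have "emeasure (reweight \<eta> \<mu>) (space (reweight \<eta> \<mu>)) = (\<integral>\<^sup>+x. ennreal (\<eta> x / (\<integral>y. \<eta> y \<partial>\<mu>)) \<partial>\<mu>)"
      using i unfolding reweight_def
      by (subst emeasure_density) (auto intro!: nn_integral_cong simp: indicator_def)
    also have "\<dots> = ennreal (\<integral>x. \<eta> x / (\<integral>y. \<eta> y \<partial>\<mu>) \<partial>\<mu>)"
      using i nn h by (intro nn_integral_eq_integral) auto
    finally show "emeasure (reweight \<eta> \<mu>) (space (reweight \<eta> \<mu>)) = 1" using h by simp
  qed
qed

text \<open>Replaces the \<open>ennreal\<close>-valued Radon-Nikodym derivative by a real version: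
  finite everywhere, Borel on the whole type, with \<open>1 + r\<close> nonnegative at every point
  and r equal to 0 at c.\<close>

lemma chi2_finiteD:
  assumes \<mu>: "\<mu> \<in> space (prob_algebra (state_space c))" and i: "integrable \<mu> \<eta>"
    and fin: "chi2 (reweight \<eta> \<mu>) (reweight \<eta> \<alpha>) \<noteq> \<infinity>"
  obtains r where "r \<in> borel_measurable borel" "\<And>x. 0 \<le> 1 + r x" "integrable \<beta> (\<lambda>x. (r x)\<^sup>2)"
    "reweight \<eta> \<mu> = density (reweight \<eta> \<alpha>) (\<lambda>x. ennreal (1 + r x))"
    "chi2 (reweight \<eta> \<mu>) (reweight \<eta> \<alpha>) = ennreal (sqrt (\<integral>x. (r x)\<^sup>2 \<partial>\<beta>))"
proof
  let ?m = "reweight \<eta> \<mu>" and ?a = "reweight \<eta> \<alpha>"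
  have s\<mu>: "sets \<mu> = sets (state_space c)" using \<mu> by (auto simp: space_prob_algebra)
  interpret m: prob_space ?m by (rule prob_reweight(2)[OF \<mu> i])
  interpret a: prob_space ?a by (rule prob_reweight(2)[OF \<alpha> \<eta>_integrable])
  define \<rho> where "\<rho> x = enn2real (RN_deriv ?a ?m x)" for x
  have ac: "absolutely_continuous ?a ?m" and i2: "integrable ?a (\<lambda>x. (\<rho> x - 1)\<^sup>2)"
    using fin by (auto simp: chi2_def \<rho>_def split: if_splits)
  have ss: "sets ?m = sets ?a" by (simp add: s\<mu>)
  have \<rho>m: "\<rho> \<in> borel_measurable (state_space c)"
  proof -
    have "\<rho> \<in> borel_measurable ?a" unfolding \<rho>_def by measurable
    then show ?thesis by (subst (asm) measurable_cong_sets[where M' = "state_space c"]) auto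
  qed
  define r where "r = zero_ext c (\<lambda>x. \<rho> x - 1)"
  show r: "r \<in> borel_measurable borel"
    unfolding r_def using \<rho>m by (intro borel_measurable_zero_ext borel_measurable_diff) auto
  show "0 \<le> 1 + r x" for x by (auto simp: r_def zero_ext_def \<rho>_def)
  have sq: "(r x)\<^sup>2 = (\<rho> x - 1)\<^sup>2" if "x \<in> space ?a" for x using that by (simp add: r_def)
  show "integrable \<beta> (\<lambda>x. (r x)\<^sup>2)"
    using i2 r by (subst integral_\<beta>_reweight(2), simp, subst Bochner_Integration.integrable_cong[OF refl sq])
  have "chi2 ?m ?a = ennreal (sqrt (\<integral>x. (\<rho> x - 1)\<^sup>2 \<partial>?a))"
    using ac i2 by (simp add: chi2_def \<rho>_def)
  also have "(\<integral>x. (\<rho> x - 1)\<^sup>2 \<partial>?a) = (\<integral>x. (r x)\<^sup>2 \<partial>?a)"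
    by (rule Bochner_Integration.integral_cong) (simp_all add: sq)
  also have "\<dots> = (\<integral>x. (r x)\<^sup>2 \<partial>\<beta>)" using r by (subst integral_\<beta>_reweight(1)) auto
  finally show "chi2 ?m ?a = ennreal (sqrt (\<integral>x. (r x)\<^sup>2 \<partial>\<beta>))" .
  have "?m = density ?a (RN_deriv ?a ?m)" by (rule a.density_RN_deriv[OF ac ss, symmetric])
  also have "\<dots> = density ?a (\<lambda>x. ennreal (1 + r x))"
  proof (rule density_cong)
    show "AE x in ?a. RN_deriv ?a ?m x = ennreal (1 + r x)"
      using a.RN_deriv_finite[OF m.sigma_finite_measure_axioms ac ss] AE_space
      by eventually_elim (auto simp: r_def \<rho>_def less_top)
  qed (use measurable_\<alpha>[OF r] in \<open>auto simp: reweight_\<alpha>\<close>)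
  finally show "?m = density ?a (\<lambda>x. ennreal (1 + r x))" .
qed

end

context absorbed_markov_poincare
begin

context
  fixes \<mu> :: "'e measure" and r :: "'e \<Rightarrow> real" and h :: real
  assumes \<mu>: "\<mu> \<in> space (prob_algebra (state_space c))" and \<mu>\<eta>: "integrable \<mu> \<eta>"
    and r: "r \<in> borel_measurable borel" and r_ge: "\<And>x. 0 \<le> 1 + r x"
    and r2: "integrable \<beta> (\<lambda>x. (r x)\<^sup>2)"
    and dens: "reweight \<eta> \<mu> = density (reweight \<eta> \<alpha>) (\<lambda>x. ennreal (1 + r x))"
  defines "h \<equiv> \<integral>x. \<eta> x \<partial>\<mu>"
begin

private lemma h: "0 < h" unfolding h_def by (rule prob_reweight(1)[OF \<mu> \<mu>\<eta>])

private lemma s\<mu>: "sets \<mu> = sets (state_space c)"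
  using \<mu> by (simp add: space_prob_algebra)

private lemma sp\<mu>: "space \<mu> = - {c}"
  using sets_eq_imp_space_eq[OF s\<mu>] by (simp add: space_state_space)

private lemma measurable_\<mu>: "f \<in> borel \<rightarrow>\<^sub>M N \<Longrightarrow> f \<in> \<mu> \<rightarrow>\<^sub>M N"
  by (subst measurable_cong_sets[OF s\<mu> refl]) (rule measurable_state_spaceI)

private lemma \<eta>_h: "(\<lambda>x. \<eta> x / h) \<in> borel_measurable \<mu>" "AE x in \<mu>. 0 \<le> \<eta> x / h"
proof -
  show "(\<lambda>x. \<eta> x / h) \<in> borel_measurable \<mu>" using \<mu>\<eta> by simp
  show "AE x in \<mu>. 0 \<le> \<eta> x / h"
    by (rule AE_I2) (use \<eta>_pos sp\<mu> h in \<open>auto simp: less_imp_le\<close>)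
qed

text \<open>This form settles finiteness in \<open>initial_law_finite\<close>; the real form
  \<open>integral_initial\<close> then gives the value.\<close>

lemma nn_integral_initial:
  assumes u: "u \<in> borel_measurable borel"
  shows "(\<integral>\<^sup>+x. ennreal (e x) * u x \<partial>\<mu>) = ennreal h * (\<integral>\<^sup>+x. ennreal (1 + r x) * u x \<partial>\<beta>)"
proof -
  have ru: "(\<lambda>x. ennreal (1 + r x) * u x) \<in> borel_measurable borel"
    using r u by measurable
  have "(\<integral>\<^sup>+x. ennreal (1 + r x) * u x \<partial>\<beta>) = (\<integral>\<^sup>+x. ennreal (1 + r x) * u x \<partial>reweight \<eta> \<alpha>)"
    unfolding \<beta>_def using ru by (subst nn_integral_distr) (auto simp: id_measurable)
  also have "\<dots> = (\<integral>\<^sup>+x. u x \<partial>reweight \<eta> \<mu>)"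
    unfolding dens using measurable_\<alpha>[OF u] measurable_\<alpha>[OF r]
    by (intro nn_integral_density[symmetric]) (auto simp: reweight_\<alpha>)
  also have "\<dots> = (\<integral>\<^sup>+x. ennreal (\<eta> x / h) * u x \<partial>\<mu>)"
    unfolding reweight_def h_def[symmetric] using \<eta>_h(1) measurable_\<mu>[OF u]
    by (intro nn_integral_density) auto
  finally have "ennreal h * (\<integral>\<^sup>+x. ennreal (1 + r x) * u x \<partial>\<beta>) = (\<integral>\<^sup>+x. ennreal h * (ennreal (\<eta> x / h) * u x) \<partial>\<mu>)"
    using \<eta>_h(1) measurable_\<mu>[OF u] by (simp add: nn_integral_cmult)
  also have "\<dots> = (\<integral>\<^sup>+x. ennreal (e x) * u x \<partial>\<mu>)"
  proof (rule nn_integral_cong)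
    fix x assume "x \<in> space \<mu>"
    then have x: "x \<noteq> c" by (simp add: sp\<mu>)
    have "ennreal h * ennreal (\<eta> x / h) = ennreal (e x)"
      using h \<eta>_pos[OF x] by (subst ennreal_mult[symmetric]) (auto simp: e_eq x less_imp_le)
    then show "ennreal h * (ennreal (\<eta> x / h) * u x) = ennreal (e x) * u x"
      by (simp add: mult.assoc[symmetric])
  qed
  finally show ?thesis ..
qed

lemma integral_initial:
  fixes u :: "'e \<Rightarrow> real"
  assumes u: "u \<in> borel_measurable borel"
  shows "(\<integral>x. e x * u x \<partial>\<mu>) = h * (\<integral>x. (1 + r x) * u x \<partial>\<beta>)"
proof -
  have ru: "(\<lambda>x. (1 + r x) * u x) \<in> borel_measurable borel" using r u by measurable
  have "(\<integral>x. (1 + r x) * u x \<partial>\<beta>) = (\<integral>x. (1 + r x) * u x \<partial>reweight \<eta> \<alpha>)"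
    by (rule integral_\<beta>_reweight(1)[OF ru])
  also have "\<dots> = (\<integral>x. u x \<partial>reweight \<eta> \<mu>)"
    unfolding dens using measurable_\<alpha>[OF u] measurable_\<alpha>[OF r] r_ge
    by (intro integral_real_density[symmetric]) (auto simp: reweight_\<alpha>)
  also have "\<dots> = (\<integral>x. \<eta> x / h * u x \<partial>\<mu>)"
    unfolding reweight_def h_def[symmetric]
    by (rule integral_real_density[OF \<eta>_h measurable_\<mu>[OF u]])
  finally have "h * (\<integral>x. (1 + r x) * u x \<partial>\<beta>) = (\<integral>x. h * (\<eta> x / h * u x) \<partial>\<mu>)" by simp
  also have "\<dots> = (\<integral>x. e x * u x \<partial>\<mu>)"
    by (rule Bochner_Integration.integral_cong) (use h in \<open>auto simp: e_eq sp\<mu>\<close>)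
  finally show ?thesis ..
qed

text \<open>Both \<beta> and its density \<open>1 + r\<close> have total mass 1. This is the
  centring that \<open>doob.bilinear_decay\<close> requires.\<close>

lemma integral_r: "(\<integral>x. r x \<partial>\<beta>) = 0"
proof -
  interpret \<beta>: prob_space \<beta> by (rule prob_\<beta>)
  have ri: "integrable \<beta> r"
    by (rule \<beta>.square_integrable_imp_integrable[OF measurable_\<beta>[OF r] r2])
  have "(\<integral>x. e x * 1 \<partial>\<mu>) = h" unfolding h_def
    by (rule Bochner_Integration.integral_cong) (auto simp: e_eq sp\<mu>)
  moreover have "(\<integral>x. e x * 1 \<partial>\<mu>) = h * (\<integral>x. (1 + r x) * 1 \<partial>\<beta>)" by (rule integral_initial) simp
  moreover have "(\<integral>x. (1 + r x) * 1 \<partial>\<beta>) = 1 + (\<integral>x. r x \<partial>\<beta>)"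
    using ri \<beta>.prob_space by simp
  ultimately show "(\<integral>x. r x \<partial>\<beta>) = 0" using h by simp
qed

context
  fixes v :: "'e \<Rightarrow> real" and t :: real
  assumes v: "v \<in> borel_measurable borel" and v2: "integrable \<beta> (\<lambda>x. (v x)\<^sup>2)" and t: "0 \<le> t"
begin

text \<open>Up to constants the integral is that of \<open>(1 + r) * doob.S t \<bar>v\<bar>\<close>
  under \<beta>. Both r and \<open>doob.S t \<bar>v\<bar>\<close> are in L2(\<beta>), so
  Cauchy-Schwarz applies.\<close>

lemma initial_law_finite: "(\<integral>\<^sup>+x. \<integral>\<^sup>+y. ennreal \<bar>e y * v y\<bar> \<partial>K t x \<partial>\<mu>) < \<infinity>"
proof -
  interpret \<beta>: prob_space \<beta> by (rule prob_\<beta>)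
  let ?v = "\<lambda>y. \<bar>v y\<bar>"
  let ?c = "ennreal (exp (- lambda0 * t))"
  have vm: "?v \<in> borel_measurable borel" using v by measurable
  have v2': "integrable \<beta> (\<lambda>x. (?v x)\<^sup>2)" using v2 by simp
  have vi: "integrable \<beta> ?v"
    by (rule \<beta>.square_integrable_imp_integrable[OF measurable_\<beta>[OF vm] v2'])
  have em: "(\<lambda>x. \<integral>\<^sup>+y. ennreal (?v y) \<partial>Q t x) \<in> borel_measurable borel"
    by (rule measurable_compose[OF Q_kernel_sub[OF t] nn_integral_measurable_subprob_algebra]) (use v in measurable)
  have "(\<integral>\<^sup>+x. \<integral>\<^sup>+y. ennreal \<bar>e y * v y\<bar> \<partial>K t x \<partial>\<mu>) = (\<integral>\<^sup>+x. ennreal (e x) * (?c * (\<integral>\<^sup>+y. ennreal (?v y) \<partial>Q t x)) \<partial>\<mu>)"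
  proof (rule nn_integral_cong)
    fix x
    show "(\<integral>\<^sup>+y. ennreal \<bar>e y * v y\<bar> \<partial>K t x) = ennreal (e x) * (?c * (\<integral>\<^sup>+y. ennreal (?v y) \<partial>Q t x))"
      using nn_integral_Q[OF t, of "\<lambda>y. ennreal (?v y)" x] v
      by (simp add: abs_mult ennreal_mult mult_ac)
  qed
  also have "\<dots> = ennreal h * (\<integral>\<^sup>+x. ennreal (1 + r x) * (?c * (\<integral>\<^sup>+y. ennreal (?v y) \<partial>Q t x)) \<partial>\<beta>)"
    using em by (intro nn_integral_initial borel_measurable_times_ennreal) auto
  also have "(\<integral>\<^sup>+x. ennreal (1 + r x) * (?c * (\<integral>\<^sup>+y. ennreal (?v y) \<partial>Q t x)) \<partial>\<beta>)
      = (\<integral>\<^sup>+x. ennreal ((1 + r x) * (exp (- lambda0 * t) * doob.S t ?v x)) \<partial>\<beta>)"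
  proof (rule nn_integral_cong_AE)
    show "AE x in \<beta>. ennreal (1 + r x) * (?c * (\<integral>\<^sup>+y. ennreal (?v y) \<partial>Q t x))
        = ennreal ((1 + r x) * (exp (- lambda0 * t) * doob.S t ?v x))"
      using doob.integral_S_\<beta>(3)[OF vm vi t]
    proof eventually_elim
      case (elim x)
      have "(\<integral>\<^sup>+y. ennreal (?v y) \<partial>Q t x) = ennreal (doob.S t ?v x)"
        using nn_integral_eq_integral[OF elim] t by (simp add: doob.S_def)
      moreover have "0 \<le> doob.S t ?v x" by (simp add: doob.S_def)
      ultimately show ?case using r_ge[of x] by (simp add: ennreal_mult)
    qed
  qed
  finally have eq: "(\<integral>\<^sup>+x. \<integral>\<^sup>+y. ennreal \<bar>e y * v y\<bar> \<partial>K t x \<partial>\<mu>)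
    = ennreal h * (\<integral>\<^sup>+x. ennreal ((1 + r x) * (exp (- lambda0 * t) * doob.S t ?v x)) \<partial>\<beta>)" .
  have "(\<integral>\<^sup>+x. ennreal ((1 + r x) * (exp (- lambda0 * t) * doob.S t ?v x)) \<partial>\<beta>) < \<infinity>"
  proof -
    have S2: "integrable \<beta> (\<lambda>x. (doob.S t ?v x)\<^sup>2)" by (rule doob.integral_square_S_le(1)[OF vm v2' t])
    have "integrable \<beta> (\<lambda>x. r x * doob.S t ?v x)"
      by (rule Cauchy_Schwarz_integral(1)[OF measurable_\<beta>[OF r] measurable_\<beta>[OF doob.S_measurable[OF vm]] r2 S2])
    then have "integrable \<beta> (\<lambda>x. doob.S t ?v x + r x * doob.S t ?v x)"
      using doob.integral_S_\<beta>(1)[OF vm vi t] by (intro Bochner_Integration.integrable_add)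
    then have "integrable \<beta> (\<lambda>x. exp (- lambda0 * t) * (doob.S t ?v x + r x * doob.S t ?v x))"
      by (rule integrable_mult_right)
    then have "integrable \<beta> (\<lambda>x. (1 + r x) * (exp (- lambda0 * t) * doob.S t ?v x))"
      by (simp add: algebra_simps)
    then show ?thesis by (simp add: real_integrable_def less_top)
  qed
  then show ?thesis unfolding eq by (simp add: ennreal_mult_less_top)
qed

lemma initial_law_integral:
  "(\<integral>x. \<integral>y. e y * v y \<partial>K t x \<partial>\<mu>)
    = exp (- lambda0 * t) * h * ((\<integral>x. v x \<partial>\<beta>) + (\<integral>x. r x * doob.S t v x \<partial>\<beta>))"
proof -
  interpret \<beta>: prob_space \<beta> by (rule prob_\<beta>)
  have vi: "integrable \<beta> v"
    by (rule \<beta>.square_integrable_imp_integrable[OF measurable_\<beta>[OF v] v2])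
  have Sm: "doob.S t v \<in> borel_measurable borel" by (rule doob.S_measurable[OF v])
  have S2: "integrable \<beta> (\<lambda>x. (doob.S t v x)\<^sup>2)" by (rule doob.integral_square_S_le(1)[OF v v2 t])
  have i1: "integrable \<beta> (\<lambda>x. r x * doob.S t v x)"
    by (rule Cauchy_Schwarz_integral(1)[OF measurable_\<beta>[OF r] measurable_\<beta>[OF Sm] r2 S2])
  have "(\<integral>x. \<integral>y. e y * v y \<partial>K t x \<partial>\<mu>) = (\<integral>x. exp (- lambda0 * t) * (e x * doob.S t v x) \<partial>\<mu>)"
  proof (rule Bochner_Integration.integral_cong[OF refl])
    fix x assume "x \<in> space \<mu>"
    then have "x \<noteq> c" by (simp add: sp\<mu>)
    from integral_Q[OF this t v] show "(\<integral>y. e y * v y \<partial>K t x) = exp (- lambda0 * t) * (e x * doob.S t v x)"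
      using t by (simp add: doob.S_def)
  qed
  also have "\<dots> = exp (- lambda0 * t) * (\<integral>x. e x * doob.S t v x \<partial>\<mu>)" by (rule integral_mult_right_zero)
  also have "\<dots> = exp (- lambda0 * t) * (h * (\<integral>x. (1 + r x) * doob.S t v x \<partial>\<beta>))"
    by (simp only: integral_initial[OF Sm])
  also have "(\<integral>x. (1 + r x) * doob.S t v x \<partial>\<beta>) = (\<integral>x. doob.S t v x + r x * doob.S t v x \<partial>\<beta>)"
    by (simp add: algebra_simps)
  also have "\<dots> = (\<integral>x. v x \<partial>\<beta>) + (\<integral>x. r x * doob.S t v x \<partial>\<beta>)"
    using doob.integral_S_\<beta>[OF v vi t] i1 by simp
  finally show ?thesis by (simp add: mult.assoc)
qed

lemma initial_law_decay:
  "\<bar>\<integral>x. r x * doob.S t v x \<partial>\<beta>\<bar>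
    \<le> exp (- t / C_P) * sqrt (\<integral>x. (r x)\<^sup>2 \<partial>\<beta>) * sqrt (\<integral>x. (v x)\<^sup>2 \<partial>\<beta>)"
  by (rule doob.bilinear_decay[OF v v2 r r2 integral_r t])

end

end

text \<open>The origin of \<alpha>(\<open>\<psi>\<^sup>2 / \<eta>\<close>): since \<beta> has
  density \<eta> with respect to \<alpha>, the squared L2(\<beta>) norm of \<open>f / \<eta>\<close>
  is the \<alpha>-integral of \<open>f\<^sup>2 / \<eta>\<close>.\<close>

lemma square_integral_quotient:
  assumes \<psi>: "\<psi> \<in> borel_measurable (state_space c)" "integrable \<alpha> (\<lambda>x. (\<psi> x)\<^sup>2 / \<eta> x)"
    and f: "f \<in> borel_measurable (state_space c)" "\<forall>x. x \<noteq> c \<longrightarrow> \<bar>f x\<bar> \<le> \<psi> x"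
  defines "v \<equiv> zero_ext c (\<lambda>x. f x / \<eta> x)"
  shows "v \<in> borel_measurable borel" and "zero_ext c f = (\<lambda>y. e y * v y)"
    and "integrable \<beta> (\<lambda>x. (v x)\<^sup>2)" and "(\<integral>x. (v x)\<^sup>2 \<partial>\<beta>) \<le> (\<integral>x. (\<psi> x)\<^sup>2 / \<eta> x \<partial>\<alpha>)"
    and "(\<integral>x. v x \<partial>\<beta>) = (\<integral>x. f x \<partial>\<alpha>)"
proof -
  show v: "v \<in> borel_measurable borel"
    unfolding v_def using f(1) \<eta>_measurable by (intro borel_measurable_zero_ext borel_measurable_divide)
  show "zero_ext c f = (\<lambda>y. e y * v y)"
  proof
    show "zero_ext c f y = e y * v y" for y
      using \<eta>_pos[of y] by (cases "y = c") (auto simp: v_def e_eq)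
  qed
  have vm: "(\<lambda>x. (v x)\<^sup>2) \<in> borel_measurable borel" using v by measurable
  have le: "\<eta> x * (v x)\<^sup>2 \<le> (\<psi> x)\<^sup>2 / \<eta> x" and nn: "0 \<le> \<eta> x * (v x)\<^sup>2" if "x \<noteq> c" for x
  proof -
    have "\<eta> x * (v x)\<^sup>2 = (f x)\<^sup>2 / \<eta> x"
      using \<eta>_pos[OF that] that by (simp add: v_def power2_eq_square)
    moreover have "(f x)\<^sup>2 \<le> (\<psi> x)\<^sup>2" using power_mono[of "\<bar>f x\<bar>" "\<psi> x" 2] f(2) that by simp
    ultimately show "\<eta> x * (v x)\<^sup>2 \<le> (\<psi> x)\<^sup>2 / \<eta> x" "0 \<le> \<eta> x * (v x)\<^sup>2"
      using \<eta>_pos[OF that] by (auto intro: divide_right_mono)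
  qed
  have i: "integrable \<alpha> (\<lambda>x. \<eta> x * (v x)\<^sup>2)"
  proof (rule Bochner_Integration.integrable_bound[OF \<psi>(2)])
    show "(\<lambda>x. \<eta> x * (v x)\<^sup>2) \<in> borel_measurable \<alpha>"
      using \<eta>_measurable_\<alpha> measurable_\<alpha>[OF vm] by measurable
    show "AE x in \<alpha>. norm (\<eta> x * (v x)\<^sup>2) \<le> norm ((\<psi> x)\<^sup>2 / \<eta> x)"
    proof (rule AE_I2)
      fix x assume "x \<in> space \<alpha>"
      then have "x \<noteq> c" by simp
      from le[OF this] nn[OF this] show "norm (\<eta> x * (v x)\<^sup>2) \<le> norm ((\<psi> x)\<^sup>2 / \<eta> x)"
        unfolding real_norm_def by linarith
    qed
  qed
  then show "integrable \<beta> (\<lambda>x. (v x)\<^sup>2)" by (simp only: integral_\<beta>(2)[OF vm])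
  show "(\<integral>x. (v x)\<^sup>2 \<partial>\<beta>) \<le> (\<integral>x. (\<psi> x)\<^sup>2 / \<eta> x \<partial>\<alpha>)"
    unfolding integral_\<beta>(1)[OF vm] by (rule integral_mono[OF i \<psi>(2)]) (simp add: le)
  show "(\<integral>x. v x \<partial>\<beta>) = (\<integral>x. f x \<partial>\<alpha>)"
    unfolding integral_\<beta>(1)[OF v]
  proof (rule Bochner_Integration.integral_cong[OF refl])
    fix x assume "x \<in> space \<alpha>"
    then have "x \<noteq> c" by simp
    then show "\<eta> x * v x = f x" using \<eta>_pos[of x] by (simp add: v_def)
  qed
qed

text \<open>The function 1 is an admissible \<open>f\<close> because \<psi> is at least 1. With
  \<open>A\<close> = \<alpha>(f), the difference of the quotient and \<open>A\<close> is
  \<open>(I f - A * I 1) / (1 + I 1)\<close>. Both errors are at most \<open>\<epsilon>\<close>,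
  \<open>\<bar>A\<bar>\<close> is at most \<alpha>(\<psi>) and the denominator is at least 1/2,
  hence the factor \<open>2 + 2 * p\<close>.\<close>

lemma conditional_distance_bound:
  assumes \<psi>: "\<psi> \<in> borel_measurable (state_space c)" "\<And>x. x \<noteq> c \<Longrightarrow> 1 \<le> \<psi> x"
    and \<psi>i: "integrable \<alpha> \<psi>" "integrable \<alpha> (\<lambda>x. (\<psi> x)\<^sup>2 / \<eta> x)"
    and \<mu>: "\<mu> \<in> space (prob_algebra (state_space c))"
  shows "\<exists>t0\<ge>0. \<forall>t\<ge>t0. conditional_distance P X c \<psi> \<alpha> \<mu> t \<le>
    ennreal ((2 + 2 * (\<integral>x. \<psi> x \<partial>\<alpha>)) * sqrt (\<integral>x. (\<psi> x)\<^sup>2 / \<eta> x \<partial>\<alpha>)) *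
    (if integrable \<mu> \<eta> then chi2 (reweight \<eta> \<mu>) (reweight \<eta> \<alpha>) else \<infinity>) *
    ennreal (exp (- t / C_P))"
proof -
  interpret \<alpha>: prob_space \<alpha> by (rule prob_\<alpha>)
  define s where "s = sqrt (\<integral>x. (\<psi> x)\<^sup>2 / \<eta> x \<partial>\<alpha>)"
  define p where "p = (\<integral>x. \<psi> x \<partial>\<alpha>)"
  have q_pos: "0 < (\<psi> x)\<^sup>2 / \<eta> x" if "x \<noteq> c" for x
    using \<psi>(2)[OF that] \<eta>_pos[OF that] by simp
  \<comment> \<open>Strict positivity matters when the chi-squared distance is infinite: in
    \<open>ennreal\<close>, 0 times \<infinity> is 0, and the right-hand side would not be
    \<infinity>.\<close>
  have s: "0 < s"
  proof -
    have nn: "AE x in \<alpha>. 0 \<le> (\<psi> x)\<^sup>2 / \<eta> x" by (rule AE_I2) (use q_pos in \<open>auto simp: less_imp_le\<close>)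
    have "(\<integral>x. (\<psi> x)\<^sup>2 / \<eta> x \<partial>\<alpha>) \<noteq> 0"
    proof
      assume "(\<integral>x. (\<psi> x)\<^sup>2 / \<eta> x \<partial>\<alpha>) = 0"
      then have "AE x in \<alpha>. (\<psi> x)\<^sup>2 / \<eta> x = 0" using integral_nonneg_eq_0_iff_AE[OF \<psi>i(2) nn] by simp
      then have "AE x in \<alpha>. False" using AE_space
      proof eventually_elim
        case (elim x)
        then have "x \<noteq> c" by simp
        with q_pos[of x] elim(1) show ?case by linarith
      qed
      then show False by simp
    qed
    then show ?thesis unfolding s_def using integral_nonneg_AE[OF nn] by simp
  qed
  have p: "0 \<le> p" unfolding p_def
    by (rule integral_nonneg_AE) (rule AE_I2, use \<psi>(2) in \<open>force intro: order_trans[of 0 1]\<close>)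
  let ?chi = "if integrable \<mu> \<eta> then chi2 (reweight \<eta> \<mu>) (reweight \<eta> \<alpha>) else \<infinity>"
  show ?thesis
  proof (cases "?chi = \<infinity>")
    case True
    have "ennreal ((2 + 2 * p) * s) * ?chi * ennreal (exp (- t / C_P)) = \<infinity>" for t
      unfolding True using p s by (simp add: ennreal_mult_top ennreal_top_mult mult_le_0_iff not_le)
    then show ?thesis unfolding s_def[symmetric] p_def[symmetric] by (intro exI[of _ 0]) simp
  next
    case False
    then have \<mu>\<eta>: "integrable \<mu> \<eta>" and fin: "chi2 (reweight \<eta> \<mu>) (reweight \<eta> \<alpha>) \<noteq> \<infinity>"
      by (auto split: if_splits)
    from chi2_finiteD[OF \<mu> \<mu>\<eta> fin] obtain r where
      r: "r \<in> borel_measurable borel" "\<And>x. 0 \<le> 1 + r x" "integrable \<beta> (\<lambda>x. (r x)\<^sup>2)"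
      "reweight \<eta> \<mu> = density (reweight \<eta> \<alpha>) (\<lambda>x. ennreal (1 + r x))"
      and chi: "chi2 (reweight \<eta> \<mu>) (reweight \<eta> \<alpha>) = ennreal (sqrt (\<integral>x. (r x)\<^sup>2 \<partial>\<beta>))" by blast
    define \<kappa> where "\<kappa> = sqrt (\<integral>x. (r x)\<^sup>2 \<partial>\<beta>)"
    have \<kappa>: "0 \<le> \<kappa>" by (simp add: \<kappa>_def)
    define h where "h = (\<integral>x. \<eta> x \<partial>\<mu>)"
    have h: "0 < h" unfolding h_def by (rule prob_reweight(1)[OF \<mu> \<mu>\<eta>])
    \<comment> \<open>From this time on \<open>exp (- t / C_P)\<close> is at most
      \<open>1 / (2 * (\<kappa> * s) + 1)\<close>, which brings \<open>\<epsilon>\<close> below 1/2.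
      The \<open>+ 1\<close> keeps the logarithm, and so \<open>t0\<close>, nonnegative.\<close>
    define t0 where "t0 = C_P * ln (2 * (\<kappa> * s) + 1)"
    have t0: "0 \<le> t0" unfolding t0_def using C_P \<kappa> s by simp
    have bound: "conditional_distance P X c \<psi> \<alpha> \<mu> t \<le> ennreal ((2 + 2 * p) * s) * ennreal \<kappa> * ennreal (exp (- t / C_P))"
      if t: "t0 \<le> t" for t
    proof -
      have tn: "0 \<le> t" using t t0 by simp
      define \<epsilon> where "\<epsilon> = \<kappa> * s * exp (- t / C_P)"
      have \<epsilon>0: "0 \<le> \<epsilon>" using \<kappa> s by (simp add: \<epsilon>_def)
      have \<epsilon>: "\<epsilon> \<le> 1 / 2"
      proof -
        have a: "0 < 2 * (\<kappa> * s) + 1" using \<kappa> s by (simp add: add_nonneg_pos)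
        have "ln (2 * (\<kappa> * s) + 1) \<le> t / C_P" using t C_P by (simp add: t0_def field_simps)
        then have "exp (- (t / C_P)) \<le> exp (- ln (2 * (\<kappa> * s) + 1))" by simp
        also have "\<dots> = 1 / (2 * (\<kappa> * s) + 1)" using a by (simp add: exp_minus inverse_eq_divide)
        finally have "\<epsilon> \<le> \<kappa> * s * (1 / (2 * (\<kappa> * s) + 1))"
          unfolding \<epsilon>_def using \<kappa> s by (intro mult_left_mono) auto
        also have "\<dots> \<le> 1 / 2" using a by (simp add: field_simps)
        finally show ?thesis .
      qed
      define I where "I f = (\<integral>x. r x * doob.S t (zero_ext c (\<lambda>x. f x / \<eta> x)) x \<partial>\<beta>)" for f
      have key: "(\<integral>\<^sup>+x. \<integral>\<^sup>+y. ennreal \<bar>zero_ext c f y\<bar> \<partial>K t x \<partial>\<mu>) < \<infinity>"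
          "(\<integral>x. \<integral>y. zero_ext c f y \<partial>K t x \<partial>\<mu>) = exp (- lambda0 * t) * h * ((\<integral>x. f x \<partial>\<alpha>) + I f)"
          "\<bar>I f\<bar> \<le> \<epsilon>"
        if f: "f \<in> borel_measurable (state_space c)" "\<forall>x. x \<noteq> c \<longrightarrow> \<bar>f x\<bar> \<le> \<psi> x" for f
      proof -
        note q = square_integral_quotient[OF \<psi>(1) \<psi>i(2) f]
        show "(\<integral>\<^sup>+x. \<integral>\<^sup>+y. ennreal \<bar>zero_ext c f y\<bar> \<partial>K t x \<partial>\<mu>) < \<infinity>"
          unfolding q(2) by (rule initial_law_finite[OF \<mu> \<mu>\<eta> r q(1,3) tn])
        show "(\<integral>x. \<integral>y. zero_ext c f y \<partial>K t x \<partial>\<mu>) = exp (- lambda0 * t) * h * ((\<integral>x. f x \<partial>\<alpha>) + I f)"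
          unfolding I_def h_def q(5)[symmetric] unfolding q(2)
          by (rule initial_law_integral[OF \<mu> \<mu>\<eta> r q(1,3) tn])
        have "\<bar>I f\<bar> \<le> exp (- t / C_P) * \<kappa> * sqrt (\<integral>x. (zero_ext c (\<lambda>x. f x / \<eta> x) x)\<^sup>2 \<partial>\<beta>)"
          unfolding I_def \<kappa>_def by (rule initial_law_decay[OF \<mu> \<mu>\<eta> r q(1,3) tn])
        also have "\<dots> \<le> exp (- t / C_P) * \<kappa> * s"
          unfolding s_def using \<kappa> q(4) by (intro mult_left_mono) auto
        finally show "\<bar>I f\<bar> \<le> \<epsilon>" by (simp add: \<epsilon>_def mult_ac)
      qed
      let ?one = "\<lambda>_. 1 :: real"
      have one: "?one \<in> borel_measurable (state_space c)" "\<forall>x. x \<noteq> c \<longrightarrow> \<bar>1\<bar> \<le> \<psi> x"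
        using \<psi>(2) by auto
      have one_val: "(\<integral>x. \<integral>y. zero_ext c ?one y \<partial>K t x \<partial>\<mu>) = exp (- lambda0 * t) * h * (1 + I ?one)"
        using key(2)[OF one] \<alpha>.prob_space by simp
      have I1: "\<bar>I ?one\<bar> \<le> \<epsilon>" by (rule key(3)[OF one])
      then have d: "1 / 2 \<le> 1 + I ?one" using \<epsilon> by linarith
      have pos: "0 < (\<integral>x. \<integral>y. zero_ext c ?one y \<partial>K t x \<partial>\<mu>)"
        unfolding one_val using h d by (intro mult_pos_pos) auto
      show ?thesis
        unfolding conditional_distance_def
      proof (rule SUP_least)
        fix f assume "f \<in> {f \<in> borel_measurable (state_space c). \<forall>x. x \<noteq> c \<longrightarrow> \<bar>f x\<bar> \<le> \<psi> x}"
        then have f: "f \<in> borel_measurable (state_space c)" "\<forall>x. x \<noteq> c \<longrightarrow> \<bar>f x\<bar> \<le> \<psi> x" by auto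
        note cl = conditional_law_integral[OF \<mu> tn f(1) key(1)[OF f] pos]
        define A where "A = (\<integral>x. f x \<partial>\<alpha>)"
        have A: "\<bar>A\<bar> \<le> p"
        proof -
          have fi: "integrable \<alpha> f"
          proof (rule Bochner_Integration.integrable_bound[OF \<psi>i(1)])
            show "f \<in> borel_measurable \<alpha>" using f(1) by (subst measurable_cong_sets[OF sets_\<alpha> refl])
            show "AE x in \<alpha>. norm (f x) \<le> norm (\<psi> x)"
              by (rule AE_I2) (use f(2) in \<open>auto intro: order_trans[OF _ abs_ge_self]\<close>)
          qed
          have "\<bar>A\<bar> \<le> (\<integral>x. \<bar>f x\<bar> \<partial>\<alpha>)" unfolding A_def by (rule integral_abs_bound)
          also have "\<dots> \<le> p" unfolding p_def
            by (rule integral_mono[OF integrable_abs[OF fi] \<psi>i(1)]) (simp add: f(2))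
          finally show ?thesis .
        qed
        have "(\<integral>\<omega>. f (X t \<omega>) \<partial>conditional_law P X c \<mu> t) = (A + I f) / (1 + I ?one)"
          unfolding cl(2) key(2)[OF f] one_val A_def using h by simp
        then have "(\<integral>\<omega>. f (X t \<omega>) \<partial>conditional_law P X c \<mu> t) - A = (I f - A * I ?one) / (1 + I ?one)"
          using d by (simp add: field_simps)
        also have "\<bar>\<dots>\<bar> = \<bar>I f - A * I ?one\<bar> / (1 + I ?one)" using d by (simp add: abs_divide)
        also have "\<dots> \<le> \<bar>I f - A * I ?one\<bar> / (1 / 2)" using d by (intro divide_left_mono) auto
        also have "\<dots> \<le> 2 * (\<epsilon> + p * \<epsilon>)"
        proof -
          have "\<bar>I f - A * I ?one\<bar> \<le> \<bar>I f\<bar> + \<bar>A\<bar> * \<bar>I ?one\<bar>"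
            using abs_triangle_ineq4[of "I f" "A * I ?one"] by (simp add: abs_mult)
          also have "\<dots> \<le> \<epsilon> + p * \<epsilon>"
            using key(3)[OF f] A I1 p by (intro add_mono mult_mono) auto
          finally show ?thesis by simp
        qed
        also have "\<dots> = (2 + 2 * p) * s * \<kappa> * exp (- t / C_P)" by (simp add: \<epsilon>_def algebra_simps)
        finally have "ennreal \<bar>(\<integral>\<omega>. f (X t \<omega>) \<partial>conditional_law P X c \<mu> t) - A\<bar>
            \<le> ennreal ((2 + 2 * p) * s * \<kappa> * exp (- t / C_P))" by (rule ennreal_leI)
        also have "\<dots> = ennreal ((2 + 2 * p) * s) * ennreal \<kappa> * ennreal (exp (- t / C_P))"
          using p s \<kappa> by (simp add: ennreal_mult)
        finally show "(if integrable (conditional_law P X c \<mu> t) (\<lambda>\<omega>. f (X t \<omega>))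
          then ennreal \<bar>(\<integral>\<omega>. f (X t \<omega>) \<partial>conditional_law P X c \<mu> t) - (\<integral>x. f x \<partial>\<alpha>)\<bar> else \<infinity>)
          \<le> ennreal ((2 + 2 * p) * s) * ennreal \<kappa> * ennreal (exp (- t / C_P))"
          using cl(1) by (simp add: A_def)
      qed
    qed
    have eq: "?chi = ennreal \<kappa>" using \<mu>\<eta> chi by (simp add: \<kappa>_def)
    show ?thesis
      unfolding eq s_def[symmetric] p_def[symmetric] using t0 bound by blast
  qed
qed

end

theorem theorem3:
  shows "\<exists>a>0. \<exists>b>0. \<forall>(M :: 'w measure) (P :: 'e::metric_space \<Rightarrow> 'w measure)
      (X :: real \<Rightarrow> 'w \<Rightarrow> 'e) (c :: 'e)
      (lambda0 :: real) (\<alpha> :: 'e measure) (\<eta> :: 'e \<Rightarrow> real) (C_P :: real) (\<psi> :: 'e \<Rightarrow> real).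
    absorbed_markov_process M P X c \<longrightarrow>
    (0 < lambda0 \<and> quasi_stationary P X c \<alpha> \<and>
      (\<forall>t\<ge>0. killed_law P X c \<alpha> t = scale_measure (ennreal (exp (- lambda0 * t))) \<alpha>) \<and>
      \<eta> \<in> borel_measurable (state_space c) \<and> (\<forall>x. x \<noteq> c \<longrightarrow> 0 < \<eta> x) \<and>
      integrable \<alpha> \<eta> \<and> (\<integral>x. \<eta> x \<partial>\<alpha>) = 1 \<and>
      (\<forall>x t. x \<noteq> c \<longrightarrow> 0 \<le> t \<longrightarrow> integrable (P x) (semigroup_integrand X c t \<eta>) \<and>
        killed_semigroup P X c t \<eta> x = exp (- lambda0 * t) * \<eta> x)) \<longrightarrow>
    (0 < C_P \<and>
      (\<forall>f \<in> borel_measurable (state_space c).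
        (\<lambda>x. f x * \<eta> x) \<in> generator_domain P X c \<longrightarrow>
        integrable (reweight \<eta> \<alpha>) (\<lambda>x. (f x)\<^sup>2) \<longrightarrow>
        integrable \<alpha> (\<lambda>x. f x * generator P X c (\<lambda>y. f y * \<eta> y) x) \<longrightarrow>
        var (reweight \<eta> \<alpha>) f \<le>
          - C_P * (\<integral>x. f x * (lambda0 * f x * \<eta> x + generator P X c (\<lambda>y. f y * \<eta> y) x) \<partial>\<alpha>))) \<longrightarrow>
    (\<psi> \<in> borel_measurable (state_space c) \<and> (\<forall>x. x \<noteq> c \<longrightarrow> 1 \<le> \<psi> x) \<and>
      integrable \<alpha> \<psi> \<and> integrable \<alpha> (\<lambda>x. (\<psi> x)\<^sup>2 / \<eta> x)) \<longrightarrow>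
    (\<forall>\<mu> \<in> space (prob_algebra (state_space c)). \<exists>t\<^sub>\<mu>\<ge>0. \<forall>t\<ge>t\<^sub>\<mu>.
      conditional_distance P X c \<psi> \<alpha> \<mu> t \<le>
        ennreal ((a + b * (\<integral>x. \<psi> x \<partial>\<alpha>)) * sqrt (\<integral>x. (\<psi> x)\<^sup>2 / \<eta> x \<partial>\<alpha>)) *
        (if integrable \<mu> \<eta> then chi2 (reweight \<eta> \<mu>) (reweight \<eta> \<alpha>) else \<infinity>) *
        ennreal (exp (- t / C_P)))"
proof (rule exI[of _ 2], intro conjI, simp, rule exI[of _ 2], intro conjI, simp, intro allI impI ballI)
  fix M :: "'w measure" and P :: "'e \<Rightarrow> 'w measure" and X :: "real \<Rightarrow> 'w \<Rightarrow> 'e" and c :: 'e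
    and lambda0 :: real and \<alpha> :: "'e measure" and \<eta> :: "'e \<Rightarrow> real" and C_P :: real and \<psi> :: "'e \<Rightarrow> real"
    and \<mu> :: "'e measure"
  assume A: "absorbed_markov_process M P X c"
    and P1: "0 < lambda0 \<and> quasi_stationary P X c \<alpha> \<and>
      (\<forall>t\<ge>0. killed_law P X c \<alpha> t = scale_measure (ennreal (exp (- lambda0 * t))) \<alpha>) \<and>
      \<eta> \<in> borel_measurable (state_space c) \<and> (\<forall>x. x \<noteq> c \<longrightarrow> 0 < \<eta> x) \<and>
      integrable \<alpha> \<eta> \<and> (\<integral>x. \<eta> x \<partial>\<alpha>) = 1 \<and>
      (\<forall>x t. x \<noteq> c \<longrightarrow> 0 \<le> t \<longrightarrow> integrable (P x) (semigroup_integrand X c t \<eta>) \<and>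
        killed_semigroup P X c t \<eta> x = exp (- lambda0 * t) * \<eta> x)"
    and P2: "0 < C_P \<and>
      (\<forall>f \<in> borel_measurable (state_space c).
        (\<lambda>x. f x * \<eta> x) \<in> generator_domain P X c \<longrightarrow>
        integrable (reweight \<eta> \<alpha>) (\<lambda>x. (f x)\<^sup>2) \<longrightarrow>
        integrable \<alpha> (\<lambda>x. f x * generator P X c (\<lambda>y. f y * \<eta> y) x) \<longrightarrow>
        var (reweight \<eta> \<alpha>) f \<le>
          - C_P * (\<integral>x. f x * (lambda0 * f x * \<eta> x + generator P X c (\<lambda>y. f y * \<eta> y) x) \<partial>\<alpha>))"
    and P3: "\<psi> \<in> borel_measurable (state_space c) \<and> (\<forall>x. x \<noteq> c \<longrightarrow> 1 \<le> \<psi> x) \<and>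
      integrable \<alpha> \<psi> \<and> integrable \<alpha> (\<lambda>x. (\<psi> x)\<^sup>2 / \<eta> x)"
    and \<mu>: "\<mu> \<in> space (prob_algebra (state_space c))"
  interpret absorbed_markov_process M P X c by (rule A)
  interpret absorbed_markov_poincare M P X c lambda0 \<alpha> \<eta> C_P
    by unfold_locales (use P1 P2 in \<open>auto simp: quasi_stationary_def\<close>)
  show "\<exists>t\<^sub>\<mu>\<ge>0. \<forall>t\<ge>t\<^sub>\<mu>. conditional_distance P X c \<psi> \<alpha> \<mu> t \<le>
        ennreal ((2 + 2 * (\<integral>x. \<psi> x \<partial>\<alpha>)) * sqrt (\<integral>x. (\<psi> x)\<^sup>2 / \<eta> x \<partial>\<alpha>)) *
        (if integrable \<mu> \<eta> then chi2 (reweight \<eta> \<mu>) (reweight \<eta> \<alpha>) else \<infinity>) *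
        ennreal (exp (- t / C_P))"
    by (rule conditional_distance_bound[OF _ _ _ _ \<mu>]) (use P3 in auto)
qed

end
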